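(* Let $V\colon\mathbb{R}^2\to\mathbb{R}$ be smooth and bounded from below, let $n\in\mathbb{N}$, $\beta=2n$, and $\gamma\le4\pi n$. Then $E_{\beta,\gamma,V}$ is bounded above by the infimum of $$\mathcal{E}_{\beta,\gamma,V}[u_{P,Q}]=\int_{\mathbb{R}^2}\left[(4\pi n-\gamma)\frac{1}{\pi^2n^2}\frac{|P'Q-PQ'|^4}{(|P|^2+|Q|^2)^4}+V\,\frac{1}{\pi n}\frac{|P'Q-PQ'|^2}{(|P|^2+|Q|^2)^2}\right]$$ over the $4(n+1)$-(real-)dimensional space of all coprime and linearly independent complex polynomials $P$ and $Q$ such that $\max(\deg P,\deg Q)=n$, or, equivalently, over the $(4n-1)$-(real-)dimensional space of all coprime complex polynomials $P$ and $Q$ with highest-order coefficients $a>0$ and $1$, respectively, and such that $0\le\deg Q<\deg P=n$.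
   Context: $\mathbb{N}=\{1,2,\dots\}$, $\mathbb{R}^2\cong\mathbb{C}$ via $z=x_1+\mathrm{i}x_2$, $H^1=H^1(\mathbb{R}^2;\mathbb{C})$. For $\varrho\in L^1(\mathbb{R}^2)$ set $$\mathbf{A}[\varrho](\mathbf{x}):=\int_{\mathbb{R}^2}\frac{(\mathbf{x}-\mathbf{y})^\perp}{|\mathbf{x}-\mathbf{y}|^2}\varrho(\mathbf{y})\,\mathrm{d}\mathbf{y}$$ (principal value), $(x_1,x_2)^\perp=(-x_2,x_1)$. For $\beta,\gamma\in\mathbb{R}$, $$\mathcal{E}_{\beta,\gamma,V}[u]:=\int_{\mathbb{R}^2}\left[\left|(\nabla+\mathrm{i}\beta\mathbf{A}[|u|^2])u\right|^2-\gamma|u|^4+V|u|^2\right],$$ $$E_{\beta,\gamma,V}:=\inf\left\{\mathcal{E}_{\beta,\gamma,V}[u]:u\in H^1,\ \int|V||u|^2<\infty,\ \int|u|^2=1\right\}.$$ For $\beta=2n$ and coprime, linearly independent complex polynomials $P,Q$ with $\max(\deg P,\deg Q)=n$, $$u_{P,Q}:=\sqrt{\frac{1}{\pi n}}\;\frac{\overline{P'Q-PQ'}}{|P|^2+|Q|^2}.$$ *)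

theory Defs
  imports "HOL-Analysis.Analysis" "HOL-Computational_Algebra.Computational_Algebra"
begin

text \<open>The plane is \<^typ>\<open>complex\<close>: a point $(x_1,x_2)$ is $x_1 + \mathrm{i}x_2$, the coordinate
  directions are \<^term>\<open>1 :: complex\<close> and \<^term>\<open>\<i>\<close>, and a vector field is a complex-valued
  function whose real and imaginary parts are its two components.\<close>

section \<open>Smooth functions and Sobolev space\<close>

primrec C_k :: "nat \<Rightarrow> ('a::euclidean_space \<Rightarrow> 'b::real_normed_vector) \<Rightarrow> bool" where
  "C_k 0 f \<longleftrightarrow> continuous_on UNIV f"
| "C_k (Suc k) f \<longleftrightarrow> (\<forall>x. f differentiable (at x)) \<and> (\<forall>v. C_k k (\<lambda>x. frechet_derivative f (at x) v))"

definition smooth :: "('a::euclidean_space \<Rightarrow> 'b::real_normed_vector) \<Rightarrow> bool" where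
  "smooth f \<longleftrightarrow> (\<forall>k. C_k k f)"

definition test_function :: "(complex \<Rightarrow> real) \<Rightarrow> bool" where
  "test_function \<phi> \<longleftrightarrow> smooth \<phi> \<and> compact (closure {x. \<phi> x \<noteq> 0})"

definition square_integrable :: "(complex \<Rightarrow> complex) \<Rightarrow> bool" where
  "square_integrable u \<longleftrightarrow> u \<in> borel_measurable lborel \<and> integrable lborel (\<lambda>x. (norm (u x))\<^sup>2)"

definition has_weak_derivative ::
    "(complex \<Rightarrow> complex) \<Rightarrow> complex \<Rightarrow> (complex \<Rightarrow> complex) \<Rightarrow> bool" where
  "has_weak_derivative u e g \<longleftrightarrow>
     (\<forall>\<phi>. test_function \<phi> \<longrightarrow>
        (LINT x|lborel. frechet_derivative \<phi> (at x) e *\<^sub>R u x) = - (LINT x|lborel. \<phi> x *\<^sub>R g x))"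

text \<open>Elements of $H^1$ are Borel representatives of the a.e. classes. The weak derivatives are
  unique up to null sets, so the choice below is immaterial under the integral sign.\<close>

definition H1 :: "(complex \<Rightarrow> complex) set" where
  "H1 = {u. square_integrable u \<and>
            (\<exists>g. square_integrable g \<and> has_weak_derivative u 1 g) \<and>
            (\<exists>g. square_integrable g \<and> has_weak_derivative u \<i> g)}"

definition weak_derivative :: "complex \<Rightarrow> (complex \<Rightarrow> complex) \<Rightarrow> complex \<Rightarrow> complex" where
  "weak_derivative e u = (SOME g. square_integrable g \<and> has_weak_derivative u e g)"

section \<open>The energy functional\<close>

text \<open>Integral with values in $[-\infty,\infty]$; meaningful whenever the positive or the negative
  part of the integrand has finite integral.\<close>

definition ext_integral :: "'a measure \<Rightarrow> ('a \<Rightarrow> real) \<Rightarrow> ereal" where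
  "ext_integral M f =
     enn2ereal (\<integral>\<^sup>+x. ennreal (f x) \<partial>M) - enn2ereal (\<integral>\<^sup>+x. ennreal (- f x) \<partial>M)"

text \<open>$(x_1,x_2)^\perp = (-x_2,x_1)$ is multiplication by \<^term>\<open>\<i>\<close>.\<close>

definition vector_potential :: "(complex \<Rightarrow> real) \<Rightarrow> complex \<Rightarrow> complex" where
  "vector_potential \<rho> x =
     Lim (at_right 0) (\<lambda>\<epsilon>::real.
       LINT y:{y. \<epsilon> < norm (x - y)}|lborel. \<i> * (x - y) / complex_of_real ((norm (x - y))\<^sup>2) * complex_of_real (\<rho> y))"

definition energy_density :: "real \<Rightarrow> real \<Rightarrow> (complex \<Rightarrow> real) \<Rightarrow> (complex \<Rightarrow> complex) \<Rightarrow> complex \<Rightarrow> real" where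
  "energy_density \<beta> \<gamma> V u x =
     (let A = vector_potential (\<lambda>y. (norm (u y))\<^sup>2) x
      in (norm (weak_derivative 1 u x + \<i> * complex_of_real (\<beta> * Re A) * u x))\<^sup>2
       + (norm (weak_derivative \<i> u x + \<i> * complex_of_real (\<beta> * Im A) * u x))\<^sup>2
       - \<gamma> * (norm (u x)) ^ 4 + V x * (norm (u x))\<^sup>2)"

definition energy :: "real \<Rightarrow> real \<Rightarrow> (complex \<Rightarrow> real) \<Rightarrow> (complex \<Rightarrow> complex) \<Rightarrow> ereal" where
  "energy \<beta> \<gamma> V u = ext_integral lborel (energy_density \<beta> \<gamma> V u)"

definition ground_energy :: "real \<Rightarrow> real \<Rightarrow> (complex \<Rightarrow> real) \<Rightarrow> ereal" where
  "ground_energy \<beta> \<gamma> V =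
     (INF u \<in> {u \<in> H1. integrable lborel (\<lambda>x. \<bar>V x\<bar> * (norm (u x))\<^sup>2) \<and>
                      (LINT x|lborel. (norm (u x))\<^sup>2) = 1}. energy \<beta> \<gamma> V u)"

section \<open>Polynomial pairs\<close>

definition wronskian :: "complex poly \<Rightarrow> complex poly \<Rightarrow> complex poly" where
  "wronskian P Q = pderiv P * Q - P * pderiv Q"

definition u_PQ :: "nat \<Rightarrow> complex poly \<Rightarrow> complex poly \<Rightarrow> complex \<Rightarrow> complex" where
  "u_PQ n P Q z =
     complex_of_real (sqrt (1 / (pi * real n))) * cnj (poly (wronskian P Q) z)
       / complex_of_real ((norm (poly P z))\<^sup>2 + (norm (poly Q z))\<^sup>2)"

definition lin_indep :: "complex poly \<Rightarrow> complex poly \<Rightarrow> bool" where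
  "lin_indep P Q \<longleftrightarrow> (\<forall>a b. smult a P + smult b Q = 0 \<longrightarrow> a = 0 \<and> b = 0)"

definition coprime_pairs :: "nat \<Rightarrow> (complex poly \<times> complex poly) set" where
  "coprime_pairs n = {(P, Q). coprime P Q \<and> lin_indep P Q \<and> max (degree P) (degree Q) = n}"

text \<open>The condition on the leading coefficient of $Q$ excludes $Q = 0$, whose
  \<^const>\<open>degree\<close> is $0$ in the library.\<close>

definition normalized_pairs :: "nat \<Rightarrow> (complex poly \<times> complex poly) set" where
  "normalized_pairs n =
     {(P, Q). coprime P Q \<and> (\<exists>a>0. lead_coeff P = complex_of_real a) \<and> lead_coeff Q = 1 \<and>
              degree Q < degree P \<and> degree P = n}"

section \<open>Real dimension\<close>

text \<open>The dimension of a space stratified by manifolds: the largest $d$ such that the space contains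
  a homeomorphic copy of a nonempty open subset of $\mathbb{R}^d$. The normalized pairs are such a
  space: fixing the degree of $Q$ gives a stratum, and only the one with $\deg Q = n - 1$ has the
  top dimension.\<close>

definition contains_patch :: "'a topology \<Rightarrow> nat \<Rightarrow> bool" where
  "contains_patch X d \<longleftrightarrow>
     (\<exists>U W. U \<subseteq> topspace X \<and> openin (Euclidean_space d) W \<and> W \<noteq> {} \<and>
            subtopology X U homeomorphic_space subtopology (Euclidean_space d) W)"

definition has_dimension :: "'a topology \<Rightarrow> nat \<Rightarrow> bool" where
  "has_dimension X d \<longleftrightarrow> contains_patch X d \<and> (\<forall>d'>d. \<not> contains_patch X d')"

text \<open>Sets of polynomial pairs carry the topology of convergence of all coefficients.\<close>

definition pair_space :: "(complex poly \<times> complex poly) set \<Rightarrow> (complex poly \<times> complex poly) topology" where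
  "pair_space S = pullback_topology S (\<lambda>(P, Q). (coeff P, coeff Q)) euclidean"

end

(* Write s = |P|^2 + |Q|^2, W = P'Q - PQ', and identify vectors with complex numbers. The function
   h = (d/dz) ln s satisfies dbar h = |W|^2 / s^2 = pi n |u|^2 and decays at infinity, so the
   Cauchy-Pompeiu formula gives the vector potential A = i cnj h / n in closed form. With beta = 2n
   the two covariant derivatives of u are eta and -i eta, and
   dbar (u cnj eta) = |eta|^2 - 2 pi n |u|^4, whose integral over the plane vanishes; this turns the
   kinetic energy into 4 pi n times the integral of |u|^4. Comparing h with n cnj z / (1 + |z|^2),
   which has the same leading term at infinity, gives the mass. The second infimum equals the first
   because unitary changes, common scalings and phases of (P, Q) do not change |u|; the dimensions
   follow from invariance of domain. *)
theory Submission
  imports "HOL-Homology.Invariance_of_Domain" "HOL-Real_Asymp.Real_Asymp" Defs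
begin

section \<open>Radial integrals\<close>

text \<open>The states solve a first-order equation. As \<open>cnj W\<close> is antiholomorphic, the
  \<open>z\<close>-derivative of \<open>u\<close> is \<open>- h * u\<close>; with the potential
  generated by \<open>u\<close> at beta = 2n this says that the covariant
  \<open>z\<close>-derivative of \<open>u\<close> vanishes. So the two covariant derivatives have
  equal modulus. All integral identities rest on one tool: the integral of dbar F vanishes if
  \<open>norm (F z) / (1 + norm z)\<close> is integrable. It does not apply to \<open>h\<close>,
  which is only O(1/|z|) and whose dbar derivative has a nonzero integral; this forces the
  comparison with an explicit function. The decay O(1/|z|^2) of \<open>u\<close> rests on a
  cancellation: the Wronskian has degree at most 2n - 2 instead of 2n - 1. \<open>V\<close> may grow
  arbitrarily, so a state can violate the integrability condition in the infimum; its energy is then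
  infinite and the bound is trivial. The normalized pairs form strata indexed by the degree of
  \<open>Q\<close>. The upper bound on their dimension needs a single continuous map that is
  injective across all strata.\<close>

lemma distr_norm_power2:
  "distr lborel borel (\<lambda>z::complex. (norm z)\<^sup>2) = density lborel (\<lambda>t. ennreal pi * indicator {0..} t)"
    (is "?M = ?N")
proof (rule measure_eqI_generator_eq[where E = "range atMost" and \<Omega> = UNIV and A = "\<lambda>n::nat. {..real n}"])
  \<comment> \<open>Half-lines generate the Borel sets, and the preimage of \<open>{..a}\<close> is
    empty or a disc of area \<open>pi * a\<close>; comparing areas replaces polar
    coordinates.\<close>
  have eq: "emeasure ?M {..a} = ennreal (pi * max 0 a) \<and> emeasure ?N {..a} = ennreal (pi * max 0 a)" for a :: real
  proof -
    have vim: "(\<lambda>z::complex. (norm z)\<^sup>2) -` {..a} \<inter> space lborel = (if a \<ge> 0 then cball 0 (sqrt a) else {})"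
      using real_sqrt_le_iff[of "(norm _)\<^sup>2" a] by (auto intro: order_trans[OF zero_le_power2])
    have "emeasure ?M {..a} = emeasure lborel (if a \<ge> 0 then cball 0 (sqrt a) else {} :: complex set)"
      unfolding vim[symmetric] by (subst emeasure_distr) simp_all
    also have "\<dots> = ennreal (pi * max 0 a)"
      by (auto simp: emeasure_cball unit_ball_vol_2 max_def)
    finally have 1: "emeasure ?M {..a} = ennreal (pi * max 0 a)" .
    have "emeasure ?N {..a} = (\<integral>\<^sup>+t. ennreal pi * indicator {0..a} t \<partial>lborel)"
      by (subst emeasure_density) (auto intro!: nn_integral_cong simp: indicator_def)
    also have "\<dots> = ennreal pi * emeasure lborel {0..a}"
      by (simp add: nn_integral_cmult_indicator)
    also have "\<dots> = ennreal (pi * max 0 a)"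
      by (cases "a \<ge> 0") (auto simp: ennreal_mult max_def)
    finally show ?thesis using 1 by simp
  qed
  show "Int_stable (range (atMost :: real \<Rightarrow> real set))"
    by (auto simp: Int_stable_def)
  show "emeasure ?M X = emeasure ?N X" if "X \<in> range atMost" for X
    using that eq by auto
  show "sets ?M = sigma_sets UNIV (range atMost)" "sets ?N = sigma_sets UNIV (range atMost)"
    by (simp_all add: borel_eq_atMost)
  show "(\<Union>n::nat. {..real n}) = UNIV"
    by (auto simp: real_arch_simple)
  show "emeasure ?M {..real n} \<noteq> \<infinity>" for n :: nat
    using eq by simp
qed auto

lemma radial_integral:
  fixes f :: "real \<Rightarrow> real"
  assumes "set_integrable lborel {0..} f" "f \<in> borel_measurable borel"
  shows "integrable lborel (\<lambda>z::complex. f ((norm z)\<^sup>2))"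
    and "(LINT z::complex|lborel. f ((norm z)\<^sup>2)) = pi * (LINT t:{0..}|lborel. f t)"
proof -
  let ?g = "\<lambda>t::real. pi * indicator {0..} t"
  have d: "distr lborel borel (\<lambda>z::complex. (norm z)\<^sup>2) = density lborel (\<lambda>t. ennreal (?g t))"
    unfolding distr_norm_power2 by (intro density_cong) (auto simp: indicator_def)
  have "integrable lborel (\<lambda>t. pi * (indicator {0..} t *\<^sub>R f t))"
    using assms(1) by (simp add: set_integrable_def)
  then have "integrable (density lborel (\<lambda>t. ennreal (?g t))) f"
    using assms(2) by (subst integrable_density) (auto simp: mult.assoc)
  then show "integrable lborel (\<lambda>z::complex. f ((norm z)\<^sup>2))"
    unfolding d[symmetric] by (rule integrable_distr[rotated]) simp
  have "(LINT z::complex|lborel. f ((norm z)\<^sup>2)) = integral\<^sup>L (density lborel (\<lambda>t. ennreal (?g t))) f"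
    unfolding d[symmetric] using assms(2) by (simp add: integral_distr)
  also have "\<dots> = (LINT t|lborel. pi * (indicator {0..} t *\<^sub>R f t))"
    using assms(2) by (subst integral_density) (auto simp: mult.assoc)
  finally show "(LINT z::complex|lborel. f ((norm z)\<^sup>2)) = pi * (LINT t:{0..}|lborel. f t)"
    by (simp add: set_lebesgue_integral_def)
qed

lemma set_integrable_FTC_atLeast:
  fixes f F :: "real \<Rightarrow> real"
  assumes "f \<in> borel_measurable borel" "\<And>x. x \<ge> 0 \<Longrightarrow> (F has_real_derivative f x) (at x)"
    "\<And>x. x \<ge> 0 \<Longrightarrow> f x \<ge> 0" "(F \<longlongrightarrow> T) at_top"
  shows "set_integrable lborel {0..} f" "(LINT t:{0..}|lborel. f t) = T - F 0"
proof -
  have "has_bochner_integral lborel (\<lambda>t. indicator {0..} t *\<^sub>R f t) (T - F 0)"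
  proof (rule has_bochner_integral_nn_integral)
    have "(\<integral>\<^sup>+x. ennreal (indicator {0..} x *\<^sub>R f x) \<partial>lborel) = (\<integral>\<^sup>+x. ennreal (f x) * indicator {0..} x \<partial>lborel)"
      by (intro nn_integral_cong) (auto simp: indicator_def)
    also have "\<dots> = ennreal (T - F 0)"
      using assms by (intro nn_integral_FTC_atLeast) auto
    finally show "(\<integral>\<^sup>+x. ennreal (indicator {0..} x *\<^sub>R f x) \<partial>lborel) = ennreal (T - F 0)" .
    have "F 0 \<le> T"
    proof (rule tendsto_lowerbound[OF assms(4)])
      show "\<forall>\<^sub>F x in at_top. F 0 \<le> F x"
        using eventually_ge_at_top[of 0]
        by eventually_elim (use assms in \<open>auto intro!: DERIV_nonneg_imp_nondecreasing[where f = F]\<close>)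
    qed simp
    then show "0 \<le> T - F 0" by simp
  qed (use assms in \<open>auto simp: indicator_def\<close>)
  then show "set_integrable lborel {0..} f" "(LINT t:{0..}|lborel. f t) = T - F 0"
    by (auto simp: set_integrable_def set_lebesgue_integral_def has_bochner_integral_iff)
qed

text \<open>The value \<open>pi\<close> is used twice: as the total mass of the approximate identity
  in the Cauchy-Pompeiu formula, and as the reference value in the computation of the mass of
  \<open>u\<close>.\<close>

lemma integrable_inverse_one_plus_square:
  "integrable lborel (\<lambda>z::complex. 1 / (1 + (norm z)\<^sup>2)\<^sup>2)"
  "(LINT z::complex|lborel. 1 / (1 + (norm z)\<^sup>2)\<^sup>2) = pi"
proof -
  let ?f = "\<lambda>t::real. 1 / (1 + t)\<^sup>2" and ?F = "\<lambda>t::real. - 1 / (1 + t)"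
  have 1: "(?F has_real_derivative ?f x) (at x)" if "x \<ge> 0" for x
    using that by (auto intro!: derivative_eq_intros simp: power2_eq_square)
  have 2: "(?F \<longlongrightarrow> 0) at_top" by real_asymp
  note r = set_integrable_FTC_atLeast[OF _ 1 _ 2]
  show "integrable lborel (\<lambda>z::complex. 1 / (1 + (norm z)\<^sup>2)\<^sup>2)"
    by (rule radial_integral(1)[where f = ?f]) (auto intro!: r)
  have "(LINT t:{0..}|lborel. ?f t) = 0 - ?F 0"
    by (rule r) auto
  moreover have "(LINT z::complex|lborel. ?f ((norm z)\<^sup>2)) = pi * (LINT t:{0..}|lborel. ?f t)"
    by (rule radial_integral(2)) (auto intro!: r)
  ultimately show "(LINT z::complex|lborel. 1 / (1 + (norm z)\<^sup>2)\<^sup>2) = pi"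
    by simp
qed

text \<open>The majorant for all decay estimates: 3 is the least integer exponent that is integrable
  in the plane. Since \<open>sqrt (1 + r^2) <= 1 + r\<close>, it is dominated by
  \<open>(1 + r^2)\<close> to the power -3/2, which has an elementary primitive in
  \<open>t = r^2\<close>.\<close>

lemma integrable_inverse_cube:
  "integrable lborel (\<lambda>z::complex. 1 / (1 + norm z) ^ 3)"
proof -
  let ?f = "\<lambda>t::real. 1 / ((1 + t) * sqrt (1 + t))" and ?F = "\<lambda>t::real. - 2 / sqrt (1 + t)"
  have 1: "(?F has_real_derivative ?f x) (at x)" if "x \<ge> 0" for x
    using that by (auto intro!: derivative_eq_intros simp: field_simps)
  have 2: "(?F \<longlongrightarrow> 0) at_top" by real_asymp
  note r = set_integrable_FTC_atLeast[OF _ 1 _ 2]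
  have i: "integrable lborel (\<lambda>z::complex. ?f ((norm z)\<^sup>2))"
    by (rule radial_integral(1)) (auto intro!: r)
  show ?thesis
  proof (rule Bochner_Integration.integrable_bound[OF i])
    have "1 / (1 + r) ^ 3 \<le> 1 / ((1 + r\<^sup>2) * sqrt (1 + r\<^sup>2))" if r: "r \<ge> 0" for r :: real
    proof -
      have a: "1 + r\<^sup>2 \<le> (1 + r)\<^sup>2" using r by (simp add: power2_sum)
      then have "sqrt (1 + r\<^sup>2) \<le> 1 + r" using r by (simp add: real_le_lsqrt)
      with a have "(1 + r\<^sup>2) * sqrt (1 + r\<^sup>2) \<le> (1 + r)\<^sup>2 * (1 + r)"
        using r by (intro mult_mono) auto
      also have "\<dots> = (1 + r) ^ 3" by (simp add: power2_eq_square power3_eq_cube)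
      finally show ?thesis using r by (intro divide_left_mono) (auto simp: add_pos_nonneg)
    qed
    then show "AE z::complex in lborel. norm (1 / (1 + norm z) ^ 3) \<le> norm (?f ((norm z)\<^sup>2))"
      by (intro AE_I2) (simp add: abs_mult)
  qed simp
qed

text \<open>Local integrability of the Cauchy kernel: in the variable \<open>t = |z|^2\<close> the
  singularity becomes \<open>1 / sqrt t\<close>, whose primitive \<open>2 * sqrt t\<close> is finite
  at 0.\<close>

lemma integrable_inverse_norm_ball_0:
  assumes "R > 0"
  shows "integrable lborel (\<lambda>z::complex. indicator (ball 0 R) z / norm z)"
proof -
  let ?f = "\<lambda>t::real. indicator {0<..<R\<^sup>2} t * (1 / sqrt t)"
  have *: "set_integrable lborel (einterval 0 (R\<^sup>2)) (\<lambda>t. 1 / sqrt t)"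
  proof (rule interval_integral_FTC_nonneg(1)[where F = "\<lambda>t. 2 * sqrt t" and A = 0 and B = "2 * R"])
    show "(0::ereal) < ereal (R\<^sup>2)" using assms by simp
    show "((\<lambda>t. 2 * sqrt t) has_real_derivative 1 / sqrt x) (at x)" if "0 < ereal x" for x
      using that by (auto intro!: derivative_eq_intros simp: zero_ereal_def field_simps)
    show "isCont (\<lambda>t. 1 / sqrt t) x" if "0 < ereal x" for x
      using that by (auto intro!: continuous_intros simp: zero_ereal_def)
    show "AE x in lborel. 0 < ereal x \<longrightarrow> ereal x < ereal (R\<^sup>2) \<longrightarrow> 0 \<le> 1 / sqrt x"
      by (auto simp: zero_ereal_def)
    have "((\<lambda>t. 2 * sqrt t) \<longlongrightarrow> 2 * sqrt 0) (at_right 0)" by (intro tendsto_intros)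
    then show "(((\<lambda>t. 2 * sqrt t) \<circ> real_of_ereal) \<longlongrightarrow> 0) (at_right 0)"
      by (simp add: zero_ereal_def ereal_tendsto_simps)
    have "((\<lambda>t. 2 * sqrt t) \<longlongrightarrow> 2 * sqrt (R\<^sup>2)) (at_left (R\<^sup>2))" by (intro tendsto_intros)
    then show "(((\<lambda>t. 2 * sqrt t) \<circ> real_of_ereal) \<longlongrightarrow> 2 * R) (at_left (ereal (R\<^sup>2)))"
      using assms by (simp add: ereal_tendsto_simps)
  qed
  have "einterval 0 (R\<^sup>2) = {0<..<R\<^sup>2}" by (auto simp: einterval_def zero_ereal_def)
  with * have "set_integrable lborel {0..} ?f"
    by (simp add: set_integrable_def indicator_def if_distrib[of "\<lambda>x. x * _"] cong: if_cong)
       (erule Bochner_Integration.integrable_cong[THEN iffD1, rotated 2], auto)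
  then have "integrable lborel (\<lambda>z::complex. ?f ((norm z)\<^sup>2))"
    by (intro radial_integral(1)) auto
  also have "(\<lambda>z::complex. ?f ((norm z)\<^sup>2)) = (\<lambda>z. indicator (ball 0 R) z / norm z)"
    using assms by (auto simp: fun_eq_iff indicator_def power_strict_mono)
       (meson less_eq_real_def norm_ge_zero not_le power_less_imp_less_base)
  finally show ?thesis .
qed

section \<open>Wirtinger derivatives and integration by parts\<close>

text \<open>Every real-linear map of the plane is \<open>a * v + b * cnj v\<close> for unique
  \<open>a\<close> and \<open>b\<close>; these are the derivatives with respect to \<open>z\<close>
  and \<open>cnj z\<close> (the latter is dbar).\<close>

definition has_wirtinger :: "(complex \<Rightarrow> complex) \<Rightarrow> complex \<Rightarrow> complex \<Rightarrow> complex \<Rightarrow> bool" where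
  "has_wirtinger f a b z \<longleftrightarrow> (f has_derivative (\<lambda>v. a * v + b * cnj v)) (at z)"

lemma has_wirtinger_cong:
  "has_wirtinger f a b z \<Longrightarrow> a = a' \<Longrightarrow> b = b' \<Longrightarrow> has_wirtinger f a' b' z"
  by simp

lemma has_wirtinger_field_derivative:
  "(f has_field_derivative a) (at z) \<Longrightarrow> has_wirtinger f a 0 z"
  by (simp add: has_wirtinger_def has_field_derivative_def)

lemma has_wirtinger_const: "has_wirtinger (\<lambda>z. c) 0 0 z"
  by (simp add: has_wirtinger_def)

lemma has_wirtinger_poly: "has_wirtinger (poly P) (poly (pderiv P) z) 0 z"
  by (intro has_wirtinger_field_derivative poly_DERIV)

lemma has_wirtinger_cnj:
  assumes "has_wirtinger f a b z"
  shows "has_wirtinger (\<lambda>z. cnj (f z)) (cnj b) (cnj a) z"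
proof -
  have "((\<lambda>z. cnj (f z)) has_derivative (\<lambda>v. cnj (a * v + b * cnj v))) (at z)"
    using assms unfolding has_wirtinger_def by (rule has_derivative_cnj)
  also have "(\<lambda>v. cnj (a * v + b * cnj v)) = (\<lambda>v. cnj b * v + cnj a * cnj v)"
    by (simp add: fun_eq_iff)
  finally show ?thesis by (simp add: has_wirtinger_def)
qed

lemma has_wirtinger_add:
  assumes "has_wirtinger f a b z" "has_wirtinger g c d z"
  shows "has_wirtinger (\<lambda>z. f z + g z) (a + c) (b + d) z"
proof -
  have "((\<lambda>z. f z + g z) has_derivative (\<lambda>v. (a * v + b * cnj v) + (c * v + d * cnj v))) (at z)"
    using assms unfolding has_wirtinger_def by (rule has_derivative_add)
  then show ?thesis by (simp add: has_wirtinger_def algebra_simps)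
qed

lemma has_wirtinger_mult:
  assumes "has_wirtinger f a b z" "has_wirtinger g c d z"
  shows "has_wirtinger (\<lambda>z. f z * g z) (a * g z + f z * c) (b * g z + f z * d) z"
proof -
  have "((\<lambda>z. f z * g z) has_derivative (\<lambda>v. f z * (c * v + d * cnj v) + (a * v + b * cnj v) * g z)) (at z)"
    using assms unfolding has_wirtinger_def by (rule has_derivative_mult)
  then show ?thesis by (simp add: has_wirtinger_def algebra_simps)
qed

lemma has_wirtinger_minus:
  "has_wirtinger f a b z \<Longrightarrow> has_wirtinger (\<lambda>z. - f z) (- a) (- b) z"
  using has_wirtinger_mult[OF has_wirtinger_const[of "-1"]] by fastforce

lemma has_wirtinger_diff:
  "has_wirtinger f a b z \<Longrightarrow> has_wirtinger g c d z \<Longrightarrow>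
    has_wirtinger (\<lambda>z. f z - g z) (a - c) (b - d) z"
  using has_wirtinger_add[OF _ has_wirtinger_minus] by fastforce

lemma has_wirtinger_divide:
  assumes "has_wirtinger f a b z" "has_wirtinger g c d z" "g z \<noteq> 0"
  shows "has_wirtinger (\<lambda>z. f z / g z) ((a * g z - f z * c) / (g z)\<^sup>2) ((b * g z - f z * d) / (g z)\<^sup>2) z"
proof -
  have "((\<lambda>z. f z / g z) has_derivative
      (\<lambda>v. ((a * v + b * cnj v) * g z - f z * (c * v + d * cnj v)) / (g z * g z))) (at z)"
    using assms unfolding has_wirtinger_def by (intro has_derivative_divide')
  also have "(\<lambda>v. ((a * v + b * cnj v) * g z - f z * (c * v + d * cnj v)) / (g z * g z)) =
      (\<lambda>v. (a * g z - f z * c) / (g z)\<^sup>2 * v + (b * g z - f z * d) / (g z)\<^sup>2 * cnj v)"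
    using assms(3) by (simp add: fun_eq_iff field_simps power2_eq_square)
  finally show ?thesis by (simp add: has_wirtinger_def)
qed

lemma has_wirtinger_imp_isCont: "has_wirtinger f a b z \<Longrightarrow> isCont f z"
  unfolding has_wirtinger_def by (rule has_derivative_continuous)

lemma has_wirtinger_imp_continuous_on: "(\<And>z. has_wirtinger f (a z) (b z) z) \<Longrightarrow> continuous_on S f"
  by (meson continuous_at_imp_continuous_on has_wirtinger_imp_isCont)

section \<open>Vanishing of integrals of derivatives\<close>

lemma continuous_imp_integrable_of_bounded_support:
  fixes f :: "complex \<Rightarrow> 'b::{banach, second_countable_topology}"
  assumes "continuous_on UNIV f" "\<And>x. norm x > R \<Longrightarrow> f x = 0"
  shows "integrable lborel f"
proof -
  have "integrable lborel (\<lambda>x. indicator (cball 0 R) x *\<^sub>R f x)"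
    by (rule borel_integrable_compact) (auto intro: continuous_on_subset[OF assms(1)])
  also have "(\<lambda>x. indicator (cball 0 R) x *\<^sub>R f x) = f"
    using assms(2) by (fastforce simp: indicator_def)
  finally show ?thesis .
qed

lemma integral_translate:
  fixes f :: "'a::euclidean_space \<Rightarrow> 'b::{banach, second_countable_topology}"
  assumes "f \<in> borel_measurable borel"
  shows "(LINT x|lborel. f (c + x)) = (LINT x|lborel. f x)"
  using integral_distr[of "(+) c" lborel borel f] assms by (simp add: lborel_distr_plus)

text \<open>By translation invariance of Lebesgue measure every difference quotient of
  \<open>G\<close> has integral 0, and dominated convergence passes to the derivative. No iterated
  integrals are involved.\<close>

lemma integral_directional_derivative_eq_0:
  fixes G :: "complex \<Rightarrow> complex"
  assumes der: "\<And>x. (G has_derivative G' x) (at x)"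
    and cont: "continuous_on UNIV (\<lambda>x. G' x v)"
    and supp: "\<And>x. norm x > R \<Longrightarrow> G x = 0"
  shows "(LINT x|lborel. G' x v) = 0"
proof -
  have contG: "continuous_on UNIV G"
    by (meson continuous_at_imp_continuous_on der has_derivative_continuous)
  have [measurable]: "G \<in> borel_measurable borel" "(\<lambda>x. G' x v) \<in> borel_measurable borel"
    using contG cont by (auto intro: borel_measurable_continuous_onI)
  have supp': "G' x v = 0" if "norm x > R" for x
  proof -
    have "open {x::complex. norm x > R}"
      by (intro open_Collect_less continuous_intros)
    then have "(G has_derivative (\<lambda>_. 0)) (at x)"
      by (rule has_derivative_transform_within_open[OF has_derivative_const[of 0]])
         (use that supp in auto)
    with der have "G' x = (\<lambda>_. 0)" by (rule has_derivative_unique)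
    then show ?thesis by simp
  qed
  have "compact ((\<lambda>x. G' x v) ` cball 0 R)"
    by (intro compact_continuous_image) (auto intro: continuous_on_subset[OF cont])
  then obtain B where B: "\<And>x. norm x \<le> R \<Longrightarrow> norm (G' x v) \<le> B" "B > 0"
    by (auto dest!: compact_imp_bounded simp: bounded_pos) (metis mem_cball_0)
  have B: "norm (G' x v) \<le> B" for x
    using B supp'[of x] by (cases "norm x \<le> R") auto
  have line: "((\<lambda>s. G (x + s *\<^sub>R v)) has_derivative (\<lambda>u. u *\<^sub>R G' (x + s *\<^sub>R v) v)) (at s)" for x s
  proof -
    have "((\<lambda>s. G (x + s *\<^sub>R v)) has_derivative (\<lambda>u. G' (x + s *\<^sub>R v) (u *\<^sub>R v))) (at s)"
      by (rule has_derivative_compose[OF _ der]) (auto intro!: derivative_eq_intros)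
    then show ?thesis
      using has_derivative_linear[OF der] by (simp add: linear_cmul)
  qed
  define q where "q = (\<lambda>(k::nat) x. real (Suc k) *\<^sub>R (G (x + (1 / real (Suc k)) *\<^sub>R v) - G x))"
  have "(\<lambda>k. integral\<^sup>L lborel (q k)) \<longlonglongrightarrow> (LINT x|lborel. G' x v)"
  \<comment> \<open>The shift has length at most \<open>norm v\<close>, so the difference quotients
    vanish outside the ball enlarged by that amount; inside, the mean value theorem bounds them by
    \<open>B\<close>.\<close>
  proof (rule integral_dominated_convergence[where w = "\<lambda>x. B * indicator (cball 0 (R + norm v)) x"])
    show "integrable lborel (\<lambda>x. B * indicator (cball (0::complex) (R + norm v)) x)"
      using emeasure_lborel_cball_finite by (auto intro!: integrable_real_indicator)
    show "AE x in lborel. (\<lambda>k. q k x) \<longlonglongrightarrow> G' x v"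
    proof (rule AE_I2)
      fix x
      have "(\<lambda>h. norm (G (x + h *\<^sub>R v) - G x - h *\<^sub>R G' x v) / norm h) \<midarrow>0\<rightarrow> 0"
        using line[of x 0] by (simp add: has_derivative_at)
      moreover have "filterlim (\<lambda>k. 1 / real (Suc k)) (at 0) sequentially"
        using LIMSEQ_inverse_real_of_nat by (auto simp: filterlim_at inverse_eq_divide)
      ultimately have "(\<lambda>k. norm (G (x + (1 / real (Suc k)) *\<^sub>R v) - G x - (1 / real (Suc k)) *\<^sub>R G' x v)
          / norm (1 / real (Suc k))) \<longlonglongrightarrow> 0"
        by (rule filterlim_compose)
      also have "(\<lambda>k. norm (G (x + (1 / real (Suc k)) *\<^sub>R v) - G x - (1 / real (Suc k)) *\<^sub>R G' x v)
          / norm (1 / real (Suc k))) = (\<lambda>k. norm (q k x - G' x v))"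
      proof
        fix k
        have "q k x - G' x v =
            real (Suc k) *\<^sub>R (G (x + (1 / real (Suc k)) *\<^sub>R v) - G x - (1 / real (Suc k)) *\<^sub>R G' x v)"
          unfolding q_def scaleR_diff_right[of "real (Suc k)" "_ - _"] scaleR_scaleR by simp
        then show "norm (G (x + (1 / real (Suc k)) *\<^sub>R v) - G x - (1 / real (Suc k)) *\<^sub>R G' x v)
          / norm (1 / real (Suc k)) = norm (q k x - G' x v)"
          by (simp only: norm_scaleR) simp
      qed
      finally show "(\<lambda>k. q k x) \<longlonglongrightarrow> G' x v"
        by (simp add: tendsto_norm_zero_iff LIM_zero_iff)
    qed
    show "AE x in lborel. norm (q k x) \<le> B * indicator (cball 0 (R + norm v)) x" for k
    proof (rule AE_I2)
      fix x
      let ?t = "1 / real (Suc k)"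
      have t: "?t > 0" "?t \<le> 1" by auto
      have "\<exists>s\<in>{0<..<?t}. norm (G (x + ?t *\<^sub>R v) - G (x + 0 *\<^sub>R v)) \<le> norm ((?t - 0) *\<^sub>R G' (x + s *\<^sub>R v) v)"
      proof (rule mvt_general[where f = "\<lambda>s. G (x + s *\<^sub>R v)" and f' = "\<lambda>s u. u *\<^sub>R G' (x + s *\<^sub>R v) v"])
        show "continuous_on {0..?t} (\<lambda>s. G (x + s *\<^sub>R v))"
          by (rule continuous_on_compose2[OF contG]) (auto intro!: continuous_intros)
        show "((\<lambda>s. G (x + s *\<^sub>R v)) has_derivative (\<lambda>u. u *\<^sub>R G' (x + s *\<^sub>R v) v)) (at s)" for s
          by (rule line)
      qed (use t in auto)
      then obtain s where "norm (G (x + ?t *\<^sub>R v) - G x) \<le> ?t * norm (G' (x + s *\<^sub>R v) v)"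
        by (auto simp del: of_nat_Suc)
      also have "\<dots> \<le> ?t * B" using B t by (intro mult_left_mono) auto
      finally have "norm (G (x + ?t *\<^sub>R v) - G x) \<le> B / real (Suc k)"
        by simp
      then have "real (Suc k) * norm (G (x + ?t *\<^sub>R v) - G x) \<le> B"
        by (subst (asm) pos_le_divide_eq) (simp_all add: mult.commute)
      then have 1: "norm (q k x) \<le> B"
        unfolding q_def norm_scaleR by simp
      have 2: "q k x = 0" if "norm x > R + norm v"
      proof -
        have "norm (?t *\<^sub>R v) \<le> norm v"
          unfolding norm_scaleR using t by (intro mult_left_le_one_le) auto
        moreover have "norm x \<le> norm (x + ?t *\<^sub>R v) + norm (?t *\<^sub>R v)"
          using norm_triangle_ineq4[of "x + ?t *\<^sub>R v" "?t *\<^sub>R v"] by (simp del: norm_scaleR)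
        ultimately have "norm (x + ?t *\<^sub>R v) > R" "norm x > R"
          using that norm_ge_zero[of v] by linarith+
        then show ?thesis by (simp add: q_def supp)
      qed
      show "norm (q k x) \<le> B * indicator (cball 0 (R + norm v)) x"
        using 1 2 by (auto simp: indicator_def)
    qed
  qed (auto simp: q_def)
  moreover have "integral\<^sup>L lborel (q k) = 0" for k
  proof -
    let ?w = "(1 / real (Suc k)) *\<^sub>R v"
    have iG: "integrable lborel G"
      using contG supp by (rule continuous_imp_integrable_of_bounded_support)
    have iG': "integrable lborel (\<lambda>x. G (x + ?w))"
      using iG integrable_distr_eq[of "(+) ?w" lborel borel G] by (simp add: lborel_distr_plus add.commute)
    have "integral\<^sup>L lborel (q k) = real (Suc k) *\<^sub>R ((LINT x|lborel. G (x + ?w)) - (LINT x|lborel. G x))"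
      unfolding q_def using iG iG' by (subst integral_scaleR_right) auto
    also have "(LINT x|lborel. G (x + ?w)) = (LINT x|lborel. G x)"
      using integral_translate[of G ?w] by (simp add: add.commute)
    finally show ?thesis by simp
  qed
  ultimately show ?thesis by (simp add: LIMSEQ_const_iff)
qed

text \<open>The directions 1 and \<open>\<i>\<close> show that the sum and the difference of the
  integrals of \<open>a\<close> and \<open>b\<close> vanish.\<close>

lemma integral_dbar_eq_0_compact:
  assumes G: "\<And>z. has_wirtinger G (a z) (b z) z"
    and "continuous_on UNIV a" "continuous_on UNIV b"
    and supp: "\<And>z. norm z > R \<Longrightarrow> G z = 0"
  shows "(LINT z|lborel. b z) = 0"
proof -
  have I: "(LINT z|lborel. a z * v + b z * cnj v) = 0" for v
    using G unfolding has_wirtinger_def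
    by (rule integral_directional_derivative_eq_0) (use assms in \<open>auto intro!: continuous_intros\<close>)
  have z: "a z = 0 \<and> b z = 0" if "norm z > R" for z
  proof -
    have "open {x::complex. norm x > R}"
      by (intro open_Collect_less continuous_intros)
    then have "(G has_derivative (\<lambda>_. 0)) (at z)"
      by (rule has_derivative_transform_within_open[OF has_derivative_const[of 0]])
         (use that supp in auto)
    with G[of z] have *: "(\<lambda>v. a z * v + b z * cnj v) = (\<lambda>_. 0)"
      unfolding has_wirtinger_def by (rule has_derivative_unique)
    show ?thesis using fun_cong[OF *, of 1] fun_cong[OF *, of \<i>]
      by (auto simp: complex_eq_iff)
  qed
  have i: "integrable lborel a" "integrable lborel b"
    using assms z by (auto intro!: continuous_imp_integrable_of_bounded_support[where R = R])
  have "(LINT z|lborel. a z) + (LINT z|lborel. b z) = 0"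
    using I[of 1] i by simp
  moreover have "\<i> * (LINT z|lborel. a z) - \<i> * (LINT z|lborel. b z) = 0"
    using I[of \<i>] i by (simp add: mult.commute)
  ultimately show ?thesis
    by (auto simp: complex_eq_iff)
qed

text \<open>Squaring the positive part makes the cutoff continuously differentiable across the
  circle of radius \<open>k\<close>, which is all the smoothness that the integration by parts asks
  for.\<close>

lemma has_wirtinger_cutoff:
  fixes k :: real
  shows "has_wirtinger (\<lambda>z. complex_of_real ((max 0 (1 - (norm z)\<^sup>2 / k\<^sup>2))\<^sup>2))
     (- 2 * complex_of_real (max 0 (1 - (norm z)\<^sup>2 / k\<^sup>2)) * cnj z / complex_of_real (k\<^sup>2))
     (- 2 * complex_of_real (max 0 (1 - (norm z)\<^sup>2 / k\<^sup>2)) * z / complex_of_real (k\<^sup>2)) z"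
proof -
  have 1: "((\<lambda>t. (max 0 t)\<^sup>2) has_real_derivative 2 * max 0 t) (at t)" for t :: real
  proof -
    consider "t > 0" | "t < 0" | "t = 0" by linarith
    then show ?thesis
    proof cases
      case 1
      have "((\<lambda>t. t\<^sup>2) has_real_derivative 2 * max 0 t) (at t)"
        using 1 by (auto intro!: derivative_eq_intros)
      then show ?thesis
        by (rule DERIV_cong_ev[THEN iffD1, rotated 3, OF _ ])
           (use 1 eventually_nhds_in_open[of "{0<..}" t] in \<open>auto elim!: eventually_mono\<close>)
    next
      case 2
      have "((\<lambda>t. 0) has_real_derivative 2 * max 0 t) (at t)"
        using 2 by (auto intro!: derivative_eq_intros)
      then show ?thesis
        by (rule DERIV_cong_ev[THEN iffD1, rotated 3, OF _ ])
           (use 2 eventually_nhds_in_open[of "{..<0}" t] in \<open>auto elim!: eventually_mono\<close>)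
    next
      case 3
      have "((\<lambda>h. (max 0 h)\<^sup>2 / h) \<longlongrightarrow> 0) (at (0::real))"
      proof (rule Lim_null_comparison)
        show "\<forall>\<^sub>F h in at 0. norm ((max 0 h)\<^sup>2 / h) \<le> \<bar>h\<bar>" for h :: real
          by (intro always_eventually) (auto simp: max_def power2_eq_square)
      qed (auto intro!: tendsto_eq_intros)
      then show ?thesis using 3 by (simp add: has_field_derivative_iff)
    qed
  qed
  have 2: "((\<lambda>z::complex. 1 - (norm z)\<^sup>2 / k\<^sup>2) has_derivative (\<lambda>v. - 2 * (z \<bullet> v) / k\<^sup>2)) (at z)"
    unfolding power2_norm_eq_inner divide_inverse
    by (auto intro!: derivative_eq_intros simp: inner_commute)
  have "((\<lambda>z. complex_of_real ((max 0 (1 - (norm z)\<^sup>2 / k\<^sup>2))\<^sup>2)) has_derivative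
    (\<lambda>v. complex_of_real (2 * max 0 (1 - (norm z)\<^sup>2 / k\<^sup>2) * (- 2 * (z \<bullet> v) / k\<^sup>2)))) (at z)"
    using has_derivative_compose[OF 2 1[THEN has_field_derivative_imp_has_derivative]]
    by (intro has_derivative_of_real) simp
  also have "(\<lambda>v. complex_of_real (2 * max 0 (1 - (norm z)\<^sup>2 / k\<^sup>2) * (- 2 * (z \<bullet> v) / k\<^sup>2))) =
    (\<lambda>v. (- 2 * complex_of_real (max 0 (1 - (norm z)\<^sup>2 / k\<^sup>2)) * cnj z / complex_of_real (k\<^sup>2)) * v +
     (- 2 * complex_of_real (max 0 (1 - (norm z)\<^sup>2 / k\<^sup>2)) * z / complex_of_real (k\<^sup>2)) * cnj v)"
  proof
    fix v
    have *: "2 * complex_of_real (z \<bullet> v) = cnj z * v + z * cnj v"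
      by (simp add: complex_eq_iff inner_complex_def)
    have "complex_of_real (2 * m * (- 2 * (z \<bullet> v) / k\<^sup>2)) =
      - 2 * complex_of_real m * (2 * complex_of_real (z \<bullet> v)) / complex_of_real (k\<^sup>2)" for m
      by simp
    also have "- 2 * complex_of_real m * (2 * complex_of_real (z \<bullet> v)) / complex_of_real (k\<^sup>2) = - 2 * complex_of_real m * cnj z / complex_of_real (k\<^sup>2) * v +
        (- 2 * complex_of_real m * z / complex_of_real (k\<^sup>2)) * cnj v" for m
      unfolding * by (simp add: algebra_simps add_divide_distrib diff_divide_distrib)
    finally show "complex_of_real (2 * max 0 (1 - (norm z)\<^sup>2 / k\<^sup>2) * (- 2 * (z \<bullet> v) / k\<^sup>2)) =
      - 2 * complex_of_real (max 0 (1 - (norm z)\<^sup>2 / k\<^sup>2)) * cnj z / complex_of_real (k\<^sup>2) * v +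
     (- 2 * complex_of_real (max 0 (1 - (norm z)\<^sup>2 / k\<^sup>2)) * z / complex_of_real (k\<^sup>2)) * cnj v" .
  qed
  finally show ?thesis by (simp add: has_wirtinger_def)
qed

text \<open>On the disc of radius \<open>K\<close> the gradient of the cutoff at scale
  \<open>K\<close> is O(1/K), hence O(1/(1 + |z|)) uniformly in \<open>K\<close>. The weighted
  integrability of \<open>F\<close> is therefore exactly what dominates the boundary term, which
  tends to 0 pointwise.\<close>

lemma integral_dbar_eq_0:
  assumes F: "\<And>z. has_wirtinger F (a z) (b z) z"
    and "continuous_on UNIV a" "continuous_on UNIV b"
    and decay: "integrable lborel (\<lambda>z. norm (F z) / (1 + norm z))"
    and ib: "integrable lborel b"
  shows "(LINT z|lborel. b z) = 0"
proof -
  define m where "m = (\<lambda>(k::nat) (z::complex). max 0 (1 - (norm z)\<^sup>2 / (real (Suc k))\<^sup>2))"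
  have m: "0 \<le> m k z" "m k z \<le> 1" for k z
    by (auto simp: m_def)
  have m0: "m k z = 0" if "norm z > real (Suc k)" for k z
  proof -
    have "(norm z)\<^sup>2 \<ge> (real (Suc k))\<^sup>2" using that by (intro power_mono) auto
    then show ?thesis by (simp add: m_def field_simps del: of_nat_Suc)
  qed
  have contF: "continuous_on UNIV F"
    using F by (rule has_wirtinger_imp_continuous_on)
  have contm: "continuous_on UNIV (m k)" for k
    unfolding m_def by (intro continuous_intros) auto
  have [measurable]: "F \<in> borel_measurable borel" "m k \<in> borel_measurable borel" for k
    using contF contm by (auto intro: borel_measurable_continuous_onI)
  define c where "c = (\<lambda>k z. F z * (2 * complex_of_real (m k z) * z / complex_of_real ((real (Suc k))\<^sup>2)))"
  have mlim: "(\<lambda>k. m k z) \<longlonglongrightarrow> 1" for z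
    unfolding m_def by real_asymp
  \<comment> \<open>On the support \<open>norm z <= K\<close> and
    \<open>1 + norm z <= 2 * K\<close>, which gives one factor 2; the derivative of the squared
    cutoff gives the other.\<close>
  have bc: "norm (c k z) \<le> 4 * (norm (F z) / (1 + norm z))" for k z
  proof (cases "norm z > real (Suc k)")
    case True
    then show ?thesis using m0[OF True] by (simp add: c_def)
  next
    case False
    let ?K = "real (Suc k)"
    have K: "?K \<ge> 1" "norm z \<le> ?K" using False by auto
    have "m k z * norm z * (1 + norm z) \<le> 1 * ?K * (2 * ?K)"
      using K m[of k z] by (intro mult_mono) auto
    then have "m k z * norm z / ?K\<^sup>2 \<le> 2 / (1 + norm z)"
      using K by (simp add: field_simps power2_eq_square add_pos_nonneg del: of_nat_Suc)
    then have "norm (F z) * (2 * (m k z * norm z / ?K\<^sup>2)) \<le> norm (F z) * (2 * (2 / (1 + norm z)))"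
      by (intro mult_left_mono) auto
    then show ?thesis
      using m[of k z] by (simp add: c_def norm_mult norm_divide norm_power mult_ac del: of_nat_Suc)
  qed
  have ic: "integrable lborel (c k)" for k
    by (rule Bochner_Integration.integrable_bound[OF integrable_mult_right[OF decay, of 4]])
       (use bc in \<open>auto simp: c_def abs_mult\<close>)
  have bb: "norm (complex_of_real ((m k z)\<^sup>2) * b z) \<le> norm (b z)" for k z
    using m[of k z] by (simp add: norm_mult norm_power mult_left_le_one_le power_le_one)
  have ib': "integrable lborel (\<lambda>z. complex_of_real ((m k z)\<^sup>2) * b z)" for k
    by (rule Bochner_Integration.integrable_bound[OF ib]) (use bb ib in \<open>auto\<close>)
  have eq: "(LINT z|lborel. complex_of_real ((m k z)\<^sup>2) * b z) = (LINT z|lborel. c k z)" for k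
  proof -
    have w: "has_wirtinger (\<lambda>z. complex_of_real ((m k z)\<^sup>2) * F z)
        ((- 2 * complex_of_real (m k z) * cnj z / complex_of_real ((real (Suc k))\<^sup>2)) * F z + complex_of_real ((m k z)\<^sup>2) * a z)
        ((- 2 * complex_of_real (m k z) * z / complex_of_real ((real (Suc k))\<^sup>2)) * F z + complex_of_real ((m k z)\<^sup>2) * b z) z" for z
      unfolding m_def by (intro has_wirtinger_mult has_wirtinger_cutoff F)
    have "(LINT z|lborel. (- 2 * complex_of_real (m k z) * z / complex_of_real ((real (Suc k))\<^sup>2)) * F z
        + complex_of_real ((m k z)\<^sup>2) * b z) = 0"
      by (rule integral_dbar_eq_0_compact[OF w, where R = "real (Suc k)"])
         (use m0 in \<open>auto intro!: continuous_intros contF contm assms simp del: of_nat_Suc\<close>)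
    also have "(\<lambda>z. (- 2 * complex_of_real (m k z) * z / complex_of_real ((real (Suc k))\<^sup>2)) * F z
        + complex_of_real ((m k z)\<^sup>2) * b z) = (\<lambda>z. complex_of_real ((m k z)\<^sup>2) * b z - c k z)"
      by (simp add: c_def fun_eq_iff)
    finally show ?thesis using ic ib' by simp
  qed
  have "(\<lambda>k. LINT z|lborel. complex_of_real ((m k z)\<^sup>2) * b z) \<longlonglongrightarrow> (LINT z|lborel. b z)"
  proof (rule integral_dominated_convergence[where w = "\<lambda>z. norm (b z)"])
    have "(\<lambda>k. complex_of_real ((m k z)\<^sup>2) * b z) \<longlonglongrightarrow> complex_of_real (1\<^sup>2) * b z" for z
      by (intro tendsto_intros mlim)
    then show "AE z in lborel. (\<lambda>k. complex_of_real ((m k z)\<^sup>2) * b z) \<longlonglongrightarrow> b z" by simp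
  qed (use ib ib' bb in auto)
  moreover have "(\<lambda>k. LINT z|lborel. c k z) \<longlonglongrightarrow> (LINT z::complex|lborel. 0)"
  proof (rule integral_dominated_convergence[where w = "\<lambda>z. 4 * (norm (F z) / (1 + norm z))"])
    have "(\<lambda>k. c k z) \<longlonglongrightarrow> 0" for z
    proof -
      have "(\<lambda>k. F z * (2 * complex_of_real (m k z) * z * complex_of_real (1 / (real (Suc k))\<^sup>2)))
          \<longlonglongrightarrow> F z * (2 * complex_of_real 1 * z * complex_of_real 0)"
      proof (intro tendsto_intros mlim)
        show "(\<lambda>k. 1 / (real (Suc k))\<^sup>2) \<longlonglongrightarrow> 0" by real_asymp
      qed
      then show ?thesis by (simp add: c_def divide_inverse del: of_nat_Suc)
    qed
    then show "AE z in lborel. (\<lambda>k. c k z) \<longlonglongrightarrow> 0" by simp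
    show "integrable lborel (\<lambda>z. 4 * (norm (F z) / (1 + norm z)))"
      by (intro integrable_mult_right decay)
  qed (use ic bc in auto)
  ultimately show ?thesis unfolding eq by (simp add: LIMSEQ_unique)
qed

section \<open>The Cauchy--Pompeiu formula\<close>

lemma integral_affine:
  fixes f :: "complex \<Rightarrow> complex"
  assumes "f \<in> borel_measurable borel" "e > 0"
  shows "(LINT y|lborel. f y) = (LINT w|lborel. complex_of_real (e\<^sup>2) * f (x + e *\<^sub>R w))"
proof -
  have "(LINT y|lborel. f y) = (LINT y|density (distr lborel borel (\<lambda>w. x + e *\<^sub>R w)) (\<lambda>_. ennreal (e\<^sup>2)). f y)"
    using assms(2) by (subst lborel_affine[of e x]) (simp_all add: numeral_2_eq_2)
  also have "\<dots> = (LINT w|lborel. complex_of_real (e\<^sup>2) * f (x + e *\<^sub>R w))"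
    using assms(1) by (subst integral_density) (auto simp: integral_distr scaleR_conv_of_real)
  finally show ?thesis .
qed

lemma integrable_inverse_norm_ball:
  "integrable lborel (\<lambda>y::complex. indicator (ball x 1) y / norm (y - x))"
proof -
  let ?g = "\<lambda>z::complex. indicator (ball 0 1) z / norm z :: real"
  have "integrable lborel (\<lambda>y. ?g (- x + y))"
    using integrable_distr_eq[of "(+) (- x)" lborel borel ?g] integrable_inverse_norm_ball_0[of 1]
    by (simp add: lborel_distr_plus del: ab_group_add_class.ab_left_minus)
  also have "(\<lambda>y. ?g (- x + y)) = (\<lambda>y. indicator (ball x 1) y / norm (y - x))"
    by (auto simp: fun_eq_iff indicator_def dist_norm norm_minus_commute)
  finally show ?thesis .
qed

text \<open>Within distance 1 of \<open>x\<close> the density is at most \<open>C\<close> and the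
  kernel is locally integrable; farther away the kernel is at most 1 and the density decays
  cubically.\<close>

lemma integrable_singular_kernel:
  fixes b :: "complex \<Rightarrow> complex"
  assumes [measurable]: "b \<in> borel_measurable borel" and "C \<ge> 0"
    and b: "\<And>z. norm (b z) \<le> C / (1 + norm z) ^ 3"
  shows "integrable lborel (\<lambda>y. norm (b y) / norm (y - x))"
proof (rule Bochner_Integration.integrable_bound)
  show "integrable lborel (\<lambda>y. C * (indicator (ball x 1) y / norm (y - x)) + C * (1 / (1 + norm y) ^ 3))"
    by (intro Bochner_Integration.integrable_add integrable_mult_right
        integrable_inverse_norm_ball integrable_inverse_cube)
  have "norm (b y) / norm (y - x) \<le> C * (indicator (ball x 1) y / norm (y - x)) + C * (1 / (1 + norm y) ^ 3)" for y
  proof (cases "y \<in> ball x 1")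
    case True
    have "1 \<le> (1 + norm y) ^ 3" by (intro one_le_power) simp
    then have "C / (1 + norm y) ^ 3 \<le> C / 1"
      using \<open>C \<ge> 0\<close> by (intro divide_left_mono) (auto simp: add_pos_nonneg)
    with b[of y] have "norm (b y) / norm (y - x) \<le> C / norm (y - x)"
      by (intro divide_right_mono) auto
    then show ?thesis using True \<open>C \<ge> 0\<close> by (simp add: add_increasing2)
  next
    case False
    then have "norm (y - x) \<ge> 1" by (simp add: dist_norm norm_minus_commute)
    then have "norm (b y) / norm (y - x) \<le> norm (b y) / 1"
      by (intro divide_left_mono) auto
    also note b[of y]
    finally show ?thesis using False by simp
  qed
  then show "AE y in lborel. norm (norm (b y) / norm (y - x))
      \<le> norm (C * (indicator (ball x 1) y / norm (y - x)) + C * (1 / (1 + norm y) ^ 3))"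
    using \<open>C \<ge> 0\<close> by (intro AE_I2) (simp add: order.trans[OF _ abs_ge_self])
qed simp

text \<open>\<open>dbar (h K)\<close> has integral \<open>0\<close> for the regularised kernel
  \<open>K y = cnj (y - x) / (\<bar>y - x\<bar>\<^sup>2 + \<epsilon>\<^sup>2)\<close>, whose \<open>dbar\<close> derivative is an approximate identity of
  mass \<open>\<pi>\<close>.\<close>

lemma cauchy_pompeiu:
  assumes h: "\<And>z. has_wirtinger h (a z) (b z) z"
    and cont: "continuous_on UNIV a" "continuous_on UNIV b" and "C \<ge> 0"
    and hC: "\<And>z. norm (h z) \<le> C / (1 + norm z)"
    and bC: "\<And>z. norm (b z) \<le> C / (1 + norm z) ^ 3"
  shows "(LINT y|lborel. b y / (x - y)) = complex_of_real pi * h x"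
proof -
  have conth: "continuous_on UNIV h" using h by (rule has_wirtinger_imp_continuous_on)
  have [measurable]: "h \<in> borel_measurable borel" "b \<in> borel_measurable borel"
    using cont conth by (auto intro: borel_measurable_continuous_onI)
  have hC': "norm (h z) \<le> C" for z
    using hC[of z] \<open>C \<ge> 0\<close> by (smt (verit) divide_le_cancel divide_self_if frac_le norm_ge_zero div_by_1)
  define e where "e = (\<lambda>k. 1 / real (Suc k))"
  have e: "e k > 0" for k by (simp add: e_def)
  have e0: "e \<longlonglongrightarrow> 0" unfolding e_def by real_asymp
  define N where "N = (\<lambda>k y. (y - x) * cnj (y - x) + complex_of_real ((e k)\<^sup>2))"
  have N: "N k y = complex_of_real ((norm (y - x))\<^sup>2 + (e k)\<^sup>2)" for k y
    by (simp add: N_def complex_norm_square del: of_real_power)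
  have Npos: "(norm (y - x))\<^sup>2 + (e k)\<^sup>2 > 0" for k y
    using e[of k] by (simp add: add_nonneg_pos)
  have N0: "N k y \<noteq> 0" for k y
    unfolding N using Npos[of y k] by (metis less_irrefl of_real_eq_0_iff)
  have contN: "continuous_on UNIV (N k)" for k unfolding N_def by (intro continuous_intros)
  define K where "K = (\<lambda>k y. cnj (y - x) / N k y)"
  have wN: "has_wirtinger (N k) (cnj (y - x)) (y - x) y" for k y
  proof -
    have w1: "has_wirtinger (\<lambda>y. y - x) 1 0 y"
      by (rule has_wirtinger_field_derivative) (auto intro!: derivative_eq_intros)
    show ?thesis unfolding N_def
      by (rule has_wirtinger_cong[OF has_wirtinger_add[OF has_wirtinger_mult[OF w1 has_wirtinger_cnj[OF w1]]
            has_wirtinger_const]]) auto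
  qed
  have wK: "has_wirtinger (K k) (- (cnj (y - x))\<^sup>2 / (N k y)\<^sup>2) (complex_of_real ((e k)\<^sup>2) / (N k y)\<^sup>2) y" for k y
  proof -
    have w1: "has_wirtinger (\<lambda>y. cnj (y - x)) 0 1 y"
      using has_wirtinger_diff[OF has_wirtinger_cnj[OF has_wirtinger_field_derivative[OF DERIV_ident, of y]]
          has_wirtinger_const[of "cnj x"]] by simp
    show ?thesis unfolding K_def
      by (rule has_wirtinger_cong[OF has_wirtinger_divide[OF w1 wN N0]])
         (auto simp: power2_eq_square N_def mult.commute)
  qed
  have normK: "norm (K k y) = norm (y - x) / ((norm (y - x))\<^sup>2 + (e k)\<^sup>2)" for k y
    using Npos[of y k] unfolding K_def N norm_divide complex_mod_cnj norm_of_real by simp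
  \<comment> \<open>Uniform in \<open>k\<close>, for dominated convergence. At \<open>y = x\<close>
    both sides are 0, as division by 0 gives 0.\<close>
  have Kle: "norm (K k y) \<le> 1 / norm (y - x)" for k y
  proof (cases "y = x")
    case False
    have "norm (y - x) / ((norm (y - x))\<^sup>2 + (e k)\<^sup>2) \<le> norm (y - x) / (norm (y - x))\<^sup>2"
      using False by (intro divide_left_mono) (auto simp: Npos)
    then show ?thesis using False by (simp add: normK power2_eq_square)
  qed (simp add: normK)
  \<comment> \<open>Here the constant may depend on \<open>k\<close>: for fixed \<open>k\<close> the
    bound makes \<open>h * K k\<close> decay quadratically, as required for the integral of its dbar
    derivative to vanish.\<close>
  have Kle2: "norm (K k y) \<le> ((1 + norm x) / e k + 1) / (1 + norm y)" for k y
  proof -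
    let ?r = "norm (y - x)" and ?e = "e k"
    have r: "norm y \<le> norm x + ?r" by (metis add.commute diff_add_cancel norm_triangle_ineq)
    have "?r * (1 + norm y) \<le> ?r * (1 + (norm x + ?r))" using r by (intro mult_left_mono) auto
    also have "\<dots> = (1 + norm x) * ?r + ?r\<^sup>2" by (simp add: algebra_simps power2_eq_square)
    also have "\<dots> \<le> (1 + norm x) * ((?r\<^sup>2 + ?e\<^sup>2) / ?e) + (?r\<^sup>2 + ?e\<^sup>2)"
    proof (intro add_mono mult_left_mono)
      have "2 * (?r * ?e) \<le> ?r\<^sup>2 + ?e\<^sup>2" using sum_squares_bound[of ?r ?e] by simp
      moreover have "0 \<le> ?r * ?e" using e[of k] by simp
      ultimately have "?r * ?e \<le> ?r\<^sup>2 + ?e\<^sup>2" by linarith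
      then show "?r \<le> (?r\<^sup>2 + ?e\<^sup>2) / ?e" using e[of k] by (simp add: pos_le_divide_eq)
    qed auto
    also have "\<dots> = ((1 + norm x) / ?e + 1) * (?r\<^sup>2 + ?e\<^sup>2)" by (simp add: algebra_simps add_divide_distrib)
    finally show ?thesis
      unfolding normK using Npos[of y k]
      by (subst pos_divide_le_eq) (auto simp: field_simps add_pos_nonneg)
  qed
  have [measurable]: "K k \<in> borel_measurable borel" "N k \<in> borel_measurable borel" for k
    using wK wN by (auto intro!: borel_measurable_continuous_onI has_wirtinger_imp_continuous_on)
  define J where "J = (\<lambda>k y. h y * (complex_of_real ((e k)\<^sup>2) / (N k y)\<^sup>2))"
  \<comment> \<open>The substitution \<open>y = x + e k * w\<close> turns the approximate identity
    into a fixed kernel of integral \<open>pi\<close>, so that only the argument of \<open>h\<close>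
    depends on \<open>k\<close>.\<close>
  have rescale: "complex_of_real ((e k)\<^sup>2) * J k (x + e k *\<^sub>R w) = h (x + e k *\<^sub>R w) * complex_of_real (1 / (1 + (norm w)\<^sup>2)\<^sup>2)" for k w
  proof -
    have pos: "1 + (norm w)\<^sup>2 > 0" by (simp add: add_pos_nonneg)
    have "N k (x + e k *\<^sub>R w) = complex_of_real ((e k)\<^sup>2 * (1 + (norm w)\<^sup>2))"
      unfolding N using e[of k] by (simp add: power_mult_distrib algebra_simps)
    then have "complex_of_real ((e k)\<^sup>2) * (complex_of_real ((e k)\<^sup>2) / (N k (x + e k *\<^sub>R w))\<^sup>2) =
        complex_of_real ((e k)\<^sup>2 * ((e k)\<^sup>2 / ((e k)\<^sup>2 * (1 + (norm w)\<^sup>2))\<^sup>2))"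
      by simp
    also have "(e k)\<^sup>2 * ((e k)\<^sup>2 / ((e k)\<^sup>2 * (1 + (norm w)\<^sup>2))\<^sup>2) = 1 / (1 + (norm w)\<^sup>2)\<^sup>2"
      using e[of k] pos by (simp add: power_mult_distrib)
    finally have "complex_of_real ((e k)\<^sup>2) * (complex_of_real ((e k)\<^sup>2) / (N k (x + e k *\<^sub>R w))\<^sup>2) =
        complex_of_real (1 / (1 + (norm w)\<^sup>2)\<^sup>2)" .
    then show ?thesis unfolding J_def by (metis mult.left_commute)
  qed
  have bint: "integrable lborel (\<lambda>y. norm (b y) / norm (y - x))"
    by (rule integrable_singular_kernel[OF _ \<open>C \<ge> 0\<close> bC]) simp
  have i1: "integrable lborel (\<lambda>y. b y * K k y)" for k
    by (rule Bochner_Integration.integrable_bound[OF bint])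
       (auto simp: norm_mult norm_divide intro!: mult_left_mono Kle[unfolded divide_inverse mult_1] simp: divide_inverse)
  have conv: "integrable lborel (\<lambda>w. h (x + e k *\<^sub>R w) * complex_of_real (1 / (1 + (norm w)\<^sup>2)\<^sup>2))" for k
    by (rule Bochner_Integration.integrable_bound[OF integrable_mult_right[OF integrable_inverse_one_plus_square(1), of C]])
       (auto simp only: norm_mult norm_of_real real_norm_def abs_mult
          intro!: AE_I2 mult_right_mono order.trans[OF hC' abs_ge_self], auto)
  have i2: "integrable lborel (J k)" for k
  proof -
    have "integrable lborel (\<lambda>w. J k (x + e k *\<^sub>R w))"
      using integrable_mult_right[OF conv[of k], of "complex_of_real (1 / (e k)\<^sup>2)"] e[of k]
      unfolding rescale[symmetric] by (simp add: mult.assoc[symmetric])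
    then have "integrable (distr lborel borel (\<lambda>w. x + e k *\<^sub>R w)) (J k)"
      by (subst integrable_distr_eq) (auto simp: J_def)
    then have "integrable (density (distr lborel borel (\<lambda>w. x + e k *\<^sub>R w)) (\<lambda>_. ennreal ((e k)\<^sup>2))) (J k)"
      by (subst integrable_density) (auto simp: J_def)
    then show ?thesis
      using e[of k] by (subst lborel_affine[of "e k" x]) (simp_all add: numeral_2_eq_2)
  qed
  have zero: "(LINT y|lborel. b y * K k y) = - (LINT y|lborel. J k y)" for k
  proof -
    have "(LINT y|lborel. b y * K k y + J k y) = 0"
      unfolding J_def
    proof (rule integral_dbar_eq_0)
      show "has_wirtinger (\<lambda>y. h y * K k y) (a y * K k y + h y * (- (cnj (y - x))\<^sup>2 / (N k y)\<^sup>2))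
          (b y * K k y + h y * (complex_of_real ((e k)\<^sup>2) / (N k y)\<^sup>2)) y" for y
        by (rule has_wirtinger_mult[OF h wK])
      have contK: "continuous_on UNIV (K k)" using wK by (rule has_wirtinger_imp_continuous_on)
      show "continuous_on UNIV (\<lambda>y. a y * K k y + h y * (- (cnj (y - x))\<^sup>2 / (N k y)\<^sup>2))"
        "continuous_on UNIV (\<lambda>y. b y * K k y + h y * (complex_of_real ((e k)\<^sup>2) / (N k y)\<^sup>2))"
        by (intro continuous_intros contK conth cont contN; simp add: N0)+
      let ?c = "C * ((1 + norm x) / e k + 1)"
      have c0: "(1 + norm x) / e k + 1 \<ge> 0" using e[of k] by (simp add: add_nonneg_nonneg)
      show "integrable lborel (\<lambda>y. norm (h y * K k y) / (1 + norm y))"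
      proof (rule Bochner_Integration.integrable_bound[OF integrable_mult_right[OF integrable_inverse_cube, of ?c]])
        have "norm (h y * K k y) / (1 + norm y) \<le> ?c * (1 / (1 + norm y) ^ 3)" for y
        proof -
          have "norm (h y) * norm (K k y) \<le> (C / (1 + norm y)) * (((1 + norm x) / e k + 1) / (1 + norm y))"
            using \<open>C \<ge> 0\<close> hC Kle2 by (intro mult_mono) auto
          then have "norm (h y) * norm (K k y) / (1 + norm y) \<le>
              (C / (1 + norm y)) * (((1 + norm x) / e k + 1) / (1 + norm y)) / (1 + norm y)"
            by (rule divide_right_mono) simp
          then show ?thesis by (simp add: norm_mult power3_eq_cube)
        qed
        then show "AE y in lborel. norm (norm (h y * K k y) / (1 + norm y)) \<le> norm (?c * (1 / (1 + norm y) ^ 3))"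
          using \<open>C \<ge> 0\<close> c0 by (intro AE_I2) (simp add: abs_mult)
      qed simp
      show "integrable lborel (\<lambda>y. b y * K k y + h y * (complex_of_real ((e k)\<^sup>2) / (N k y)\<^sup>2))"
        using i1[of k] i2[of k] unfolding J_def by (rule Bochner_Integration.integrable_add)
    qed
    then show ?thesis using i1[of k] i2[of k] by (simp add: eq_neg_iff_add_eq_0)
  qed
  have "(\<lambda>k. LINT y|lborel. b y * K k y) \<longlonglongrightarrow> (LINT y|lborel. b y * (1 / (y - x)))"
  proof (rule integral_dominated_convergence[OF _ _ bint])
    have "(\<lambda>k. K k y) \<longlonglongrightarrow> 1 / (y - x)" for y
    proof (cases "y = x")
      case False
      have "(\<lambda>k. K k y) \<longlonglongrightarrow> cnj (y - x) / ((y - x) * cnj (y - x) + complex_of_real (0\<^sup>2))"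
        unfolding K_def N_def using False by (intro tendsto_intros e0) auto
      also have "cnj (y - x) / ((y - x) * cnj (y - x) + complex_of_real (0\<^sup>2)) = 1 / (y - x)"
        using False by (simp del: complex_cnj_diff)
      finally show ?thesis .
    qed (simp add: K_def)
    then show "AE y in lborel. (\<lambda>k. b y * K k y) \<longlonglongrightarrow> b y * (1 / (y - x))"
      by (intro AE_I2 tendsto_mult_left)
    show "AE y in lborel. norm (b y * K k y) \<le> norm (b y) / norm (y - x)" for k
      using Kle[of k] by (intro AE_I2) (metis mult_left_mono norm_ge_zero norm_mult times_divide_eq_right mult.right_neutral)
  qed simp_all
  moreover have "(\<lambda>k. LINT y|lborel. J k y) \<longlonglongrightarrow> complex_of_real pi * h x"
  proof -
    have "(LINT y|lborel. J k y) = (LINT w|lborel. h (x + e k *\<^sub>R w) * complex_of_real (1 / (1 + (norm w)\<^sup>2)\<^sup>2))" for k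
      unfolding rescale[symmetric] by (rule integral_affine[OF _ e]) (simp add: J_def)
    moreover have "(\<lambda>k. LINT w|lborel. h (x + e k *\<^sub>R w) * complex_of_real (1 / (1 + (norm w)\<^sup>2)\<^sup>2))
        \<longlonglongrightarrow> (LINT w|lborel. h x * complex_of_real (1 / (1 + (norm (w::complex))\<^sup>2)\<^sup>2))"
    proof (rule integral_dominated_convergence[OF _ _ integrable_mult_right[OF integrable_inverse_one_plus_square(1), of C]])
      have "(\<lambda>k. h (x + e k *\<^sub>R w)) \<longlonglongrightarrow> h x" for w
      proof -
        have "(\<lambda>k. x + e k *\<^sub>R w) \<longlonglongrightarrow> x + 0 *\<^sub>R w" by (intro tendsto_intros e0)
        then show ?thesis
          using isCont_tendsto_compose[OF has_wirtinger_imp_isCont[OF h[of x]]] by simp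
      qed
      then show "AE w in lborel. (\<lambda>k. h (x + e k *\<^sub>R w) * complex_of_real (1 / (1 + (norm w)\<^sup>2)\<^sup>2))
          \<longlonglongrightarrow> h x * complex_of_real (1 / (1 + (norm w)\<^sup>2)\<^sup>2)"
        by (intro AE_I2 tendsto_mult_right)
      show "AE w in lborel. norm (h (x + e k *\<^sub>R w) * complex_of_real (1 / (1 + (norm w)\<^sup>2)\<^sup>2))
          \<le> C * (1 / (1 + (norm w)\<^sup>2)\<^sup>2)" for k
        by (intro AE_I2) (simp only: norm_mult norm_of_real, intro mult_mono hC', auto simp: \<open>C \<ge> 0\<close>)
    qed simp_all
    ultimately show ?thesis
      using integrable_inverse_one_plus_square by (simp only: integral_mult_right_zero integral_complex_of_real) (simp add: mult.commute)
  qed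
  ultimately have "(LINT y|lborel. b y * (1 / (y - x))) = - (complex_of_real pi * h x)"
    unfolding zero using LIMSEQ_unique tendsto_minus by blast
  moreover have "(\<lambda>y. b y / (x - y)) = (\<lambda>y. - (b y * (1 / (y - x))))"
    by (metis (no_types, lifting) minus_diff_eq minus_divide_right mult.right_neutral times_divide_eq_right)
  ultimately show ?thesis by simp
qed

text \<open>The kernel \<open>\<i> * d / |d|^2\<close> is \<open>\<i> * cnj (1 / d)\<close>, so the
  potential is \<open>\<i>\<close> times the conjugate of the Cauchy transform of
  \<open>\<rho>\<close>, which a decaying \<open>h\<close> with dbar h = c rho computes. The
  singularity being integrable, the principal value is an ordinary integral.\<close>

lemma vector_potential_eq:
  assumes \<rho>: "continuous_on UNIV \<rho>" and "c > 0" "C \<ge> 0"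
    and h: "\<And>z. has_wirtinger h (a z) (complex_of_real (c * \<rho> z)) z"
    and a: "continuous_on UNIV a"
    and hC: "\<And>z. norm (h z) \<le> C / (1 + norm z)"
    and bC: "\<And>z. \<bar>c * \<rho> z\<bar> \<le> C / (1 + norm z) ^ 3"
  shows "vector_potential \<rho> x = \<i> * cnj (complex_of_real (pi / c) * h x)"
proof -
  let ?k = "\<lambda>y. \<i> * (x - y) / complex_of_real ((norm (x - y))\<^sup>2) * complex_of_real (\<rho> y)"
  have [measurable]: "\<rho> \<in> borel_measurable borel"
    using \<rho> by (rule borel_measurable_continuous_onI)
  have bC': "norm (complex_of_real (c * \<rho> z)) \<le> C / (1 + norm z) ^ 3" for z
    using bC[of z] by (simp only: norm_of_real)
  have "integrable lborel (\<lambda>y. norm (complex_of_real (c * \<rho> y)) / norm (y - x))"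
    by (rule integrable_singular_kernel[OF _ \<open>C \<ge> 0\<close> bC']) simp
  then have "integrable lborel (\<lambda>y. (1 / c) * (norm (complex_of_real (c * \<rho> y)) / norm (y - x)))"
    by (rule integrable_mult_right)
  then have i: "integrable lborel (\<lambda>y. \<bar>\<rho> y\<bar> / norm (x - y))"
    using \<open>c > 0\<close> by (simp add: norm_mult norm_minus_commute)
  have nk: "norm (?k y) = \<bar>\<rho> y\<bar> / norm (x - y)" for y
    by (simp add: norm_mult norm_divide power2_eq_square norm_power del: of_real_power)
  have "((\<lambda>\<epsilon>. LINT y:{y. \<epsilon> < norm (x - y)}|lborel. ?k y) \<longlongrightarrow> (LINT y|lborel. ?k y)) (at_right 0)"
    unfolding tendsto_at_iff_sequentially
  proof (intro allI impI)
    fix X :: "nat \<Rightarrow> real"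
    assume X: "\<forall>i. X i \<in> {0<..} - {0}" "X \<longlonglongrightarrow> 0"
    have "(\<lambda>i. LINT y|lborel. indicator {y. X i < norm (x - y)} y *\<^sub>R ?k y) \<longlonglongrightarrow> (LINT y|lborel. ?k y)"
    proof (rule integral_dominated_convergence[OF _ _ i])
      show "AE y in lborel. norm (indicator {y. X i < norm (x - y)} y *\<^sub>R ?k y) \<le> \<bar>\<rho> y\<bar> / norm (x - y)" for i
        using nk by (intro AE_I2) (simp only: norm_scaleR, simp add: indicator_def)
      have "(\<lambda>i. indicator {y. X i < norm (x - y)} y *\<^sub>R ?k y) \<longlonglongrightarrow> ?k y" for y
      proof (cases "y = x")
        case False
        then have "\<forall>\<^sub>F i in sequentially. X i < norm (x - y)"
          using order_tendstoD(2)[OF X(2)] by simp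
        then have "\<forall>\<^sub>F i in sequentially. indicator {y. X i < norm (x - y)} y *\<^sub>R ?k y = ?k y"
          by eventually_elim simp
        then show ?thesis by (rule tendsto_eventually)
      qed simp
      then show "AE y in lborel. (\<lambda>i. indicator {y. X i < norm (x - y)} y *\<^sub>R ?k y) \<longlonglongrightarrow> ?k y"
        by (intro AE_I2)
    qed simp_all
    then show "((\<lambda>\<epsilon>. LINT y:{y. \<epsilon> < norm (x - y)}|lborel. ?k y) \<circ> X) \<longlonglongrightarrow> (LINT y|lborel. ?k y)"
      by (simp add: set_lebesgue_integral_def comp_def)
  qed
  then have "vector_potential \<rho> x = (LINT y|lborel. ?k y)"
    unfolding vector_potential_def by (intro tendsto_Lim) (auto simp: trivial_limit_at_right_real)
  also have "?k = (\<lambda>y. \<i> * cnj (complex_of_real (1 / c) * (complex_of_real (c * \<rho> y) / (x - y))))"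
  proof
    fix y
    have "\<i> * d / complex_of_real ((norm d)\<^sup>2) * r = \<i> * (r / cnj d)" for d r
      unfolding complex_norm_square by (cases "d = 0") (simp_all add: field_simps)
    then show "?k y = \<i> * cnj (complex_of_real (1 / c) * (complex_of_real (c * \<rho> y) / (x - y)))"
      using \<open>c > 0\<close> by simp
  qed
  also have "(LINT y|lborel. \<dots> y) = \<i> * cnj (complex_of_real (1 / c) * (LINT y|lborel. complex_of_real (c * \<rho> y) / (x - y)))"
    by (simp only: integral_mult_right_zero Bochner_Integration.integral_cnj)
  also have "(LINT y|lborel. complex_of_real (c * \<rho> y) / (x - y)) = complex_of_real pi * h x"
    by (rule cauchy_pompeiu[OF h a _ \<open>C \<ge> 0\<close> hC bC']) (auto intro!: continuous_intros \<rho>)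
  finally show ?thesis by simp
qed

section \<open>Test functions and uniqueness of weak derivatives\<close>

text \<open>The quotient by \<open>t ^ m\<close> closes the family, up to linear combinations, under
  differentiation, with all derivatives at 0 included.\<close>

definition flat_exp :: "nat \<Rightarrow> real \<Rightarrow> real" where
  "flat_exp m t = (if t > 0 then exp (- (1 / t)) / t ^ m else 0)"

lemma power_div_fact_le_exp:
  fixes x :: real
  assumes "x \<ge> 0"
  shows "x ^ n / fact n \<le> exp x"
  using sum_le_suminf[OF sums_summable[OF exp_converges[of x]], of "{n}"] assms
    sums_unique[OF exp_converges[of x]]
  by (simp add: divide_inverse mult.commute)

text \<open>One term of the exponential series at \<open>1 / t\<close> beats the pole of order
  \<open>m\<close> with two powers of \<open>t\<close> to spare; the quadratic bound gives
  derivative 0 at the origin.\<close>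

lemma flat_exp_bound: "\<bar>flat_exp m t\<bar> \<le> fact (m + 2) * t\<^sup>2"
proof (cases "t > 0")
  case True
  have "(1 / t) ^ (m + 2) / fact (m + 2) \<le> exp (1 / t)"
    using True by (intro power_div_fact_le_exp) auto
  then have "(1 / t) ^ (m + 2) \<le> fact (m + 2) * exp (1 / t)"
    by (subst (asm) pos_divide_le_eq) (simp_all add: mult.commute del: fact_Suc power_Suc power_add)
  then have "(1 / t) ^ (m + 2) * (exp (- (1 / t)) * t\<^sup>2) \<le> fact (m + 2) * exp (1 / t) * (exp (- (1 / t)) * t\<^sup>2)"
    by (rule mult_right_mono) simp
  also have "\<dots> = fact (m + 2) * t\<^sup>2" by (simp add: exp_minus)
  also have "(1 / t) ^ (m + 2) * (exp (- (1 / t)) * t\<^sup>2) = flat_exp m t"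
    using True by (simp add: flat_exp_def power_divide power2_eq_square)
  finally show ?thesis
    using True by (simp add: flat_exp_def)
qed (simp add: flat_exp_def)

lemma flat_exp_derivative:
  "(flat_exp m has_real_derivative - real m * flat_exp (m + 1) t + flat_exp (m + 2) t) (at t)"
proof -
  consider "t > 0" | "t < 0" | "t = 0" by linarith
  then show ?thesis
  proof cases
    case 1
    have "((\<lambda>t. exp (- (1 / t)) / t ^ m) has_real_derivative - real m * flat_exp (m + 1) t + flat_exp (m + 2) t) (at t)"
    \<comment> \<open>The power rule yields the exponent \<open>m - 1\<close> with truncated
      subtraction, so \<open>m = 0\<close> is separate.\<close>
    proof (cases m)
      case 0
      then show ?thesis using 1
        by (auto intro!: derivative_eq_intros simp: flat_exp_def power2_eq_square)
    next
      case (Suc k)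
      show ?thesis using 1
        unfolding Suc flat_exp_def
        by (auto intro!: derivative_eq_intros simp: divide_simps) (cases k; simp add: algebra_simps power2_eq_square)
    qed
    then show ?thesis
      by (rule DERIV_cong_ev[THEN iffD1, rotated 3])
         (use 1 eventually_nhds_in_open[of "{0<..}" t] in \<open>auto simp: flat_exp_def elim!: eventually_mono\<close>)
  next
    case 2
    have "((\<lambda>t. 0) has_real_derivative - real m * flat_exp (m + 1) t + flat_exp (m + 2) t) (at t)"
      using 2 by (auto simp: flat_exp_def)
    then show ?thesis
      by (rule DERIV_cong_ev[THEN iffD1, rotated 3])
         (use 2 eventually_nhds_in_open[of "{..<0}" t] in \<open>auto simp: flat_exp_def elim!: eventually_mono\<close>)
  next
    case 3
    have "((\<lambda>h. flat_exp m h / h) \<longlongrightarrow> 0) (at (0::real))"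
    proof (rule Lim_null_comparison)
      have "norm (flat_exp m h / h) \<le> fact (m + 2) * \<bar>h\<bar>" for h
      proof (cases "h = 0")
        case False
        have "\<bar>flat_exp m h\<bar> \<le> (fact (m + 2) * \<bar>h\<bar>) * \<bar>h\<bar>"
          using flat_exp_bound[of m h] by (simp add: power2_eq_square mult.assoc del: fact_Suc)
        then show ?thesis using False by (simp add: pos_divide_le_eq del: fact_Suc)
      qed simp
      then show "\<forall>\<^sub>F h in at 0. norm (flat_exp m h / h) \<le> fact (m + 2) * \<bar>h\<bar>"
        by (intro always_eventually) auto
    qed (auto intro!: tendsto_eq_intros)
    then show ?thesis using 3 by (simp add: has_field_derivative_iff flat_exp_def)
  qed
qed

text \<open>An algebra of explicit functions closed under directional derivatives. As
  \<open>C_k\<close> iterates such derivatives, membership alone yields all orders of smoothness by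
  induction.\<close>

inductive bump :: "(complex \<Rightarrow> real) \<Rightarrow> bool" where
  bump_flat_exp: "bump (\<lambda>x. flat_exp m (x \<bullet> w + c))"
| bump_const: "bump (\<lambda>x. c)"
| bump_add: "bump f \<Longrightarrow> bump g \<Longrightarrow> bump (\<lambda>x. f x + g x)"
| bump_mult: "bump f \<Longrightarrow> bump g \<Longrightarrow> bump (\<lambda>x. f x * g x)"

lemma bump_derivative:
  assumes "bump f"
  shows "\<exists>f'. (\<forall>x. (f has_derivative f' x) (at x)) \<and> (\<forall>v. bump (\<lambda>x. f' x v))"
  using assms
proof induction
  case (bump_flat_exp m w c)
  let ?d = "\<lambda>x. - real m * flat_exp (m + 1) (x \<bullet> w + c) + flat_exp (m + 2) (x \<bullet> w + c)"
  have "((\<lambda>x. flat_exp m (x \<bullet> w + c)) has_derivative (\<lambda>v. ?d x * (v \<bullet> w))) (at x)" for x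
  proof -
    have "((\<lambda>x. x \<bullet> w + c) has_derivative (\<lambda>v. v \<bullet> w)) (at x)"
      by (auto intro!: derivative_eq_intros)
    from has_derivative_compose[OF this flat_exp_derivative[THEN has_field_derivative_imp_has_derivative]]
    show ?thesis .
  qed
  moreover have "bump (\<lambda>x. ?d x * (v \<bullet> w))" for v
    by (intro bump.intros)
  ultimately show ?case
    by (intro exI[of _ "\<lambda>x v. ?d x * (v \<bullet> w)"]) auto
next
  case (bump_const c)
  show ?case by (intro exI[of _ "\<lambda>x v. 0"]) (auto intro: bump.intros)
next
  case (bump_add f g)
  then obtain f' g' where "\<And>x. (f has_derivative f' x) (at x)" "\<And>v. bump (\<lambda>x. f' x v)"
    "\<And>x. (g has_derivative g' x) (at x)" "\<And>v. bump (\<lambda>x. g' x v)" by blast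
  then show ?case
    by (intro exI[of _ "\<lambda>x v. f' x v + g' x v"]) (auto intro: bump.intros has_derivative_add)
next
  case (bump_mult f g)
  then obtain f' g' where "\<And>x. (f has_derivative f' x) (at x)" "\<And>v. bump (\<lambda>x. f' x v)"
    "\<And>x. (g has_derivative g' x) (at x)" "\<And>v. bump (\<lambda>x. g' x v)" by blast
  with bump_mult.hyps show ?case
    by (intro exI[of _ "\<lambda>x v. f x * g' x v + f' x v * g x"])
       (auto intro: has_derivative_mult bump.bump_add[OF bump.bump_mult bump.bump_mult])
qed

lemma bump_C_k: "bump f \<Longrightarrow> C_k k f"
proof (induction k arbitrary: f)
  case 0
  then obtain f' where "\<And>x. (f has_derivative f' x) (at x)" using bump_derivative by blast
  then show ?case
    by (auto intro!: continuous_at_imp_continuous_on has_derivative_continuous)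
next
  case (Suc k)
  then obtain f' where f': "\<And>x. (f has_derivative f' x) (at x)" "\<And>v. bump (\<lambda>x. f' x v)"
    using bump_derivative by blast
  have "frechet_derivative f (at x) = f' x" for x
    using frechet_derivative_at[OF f'(1)] by simp
  with f' Suc.IH show ?case by (auto simp: differentiable_def)
qed

text \<open>Inside the box each factor \<open>exp (- 1 / (N * t))\<close> tends to 1 as
  \<open>N\<close> grows, outside some factor is 0: test functions converging boundedly to the
  indicator of the box.\<close>

definition box_bump :: "complex \<Rightarrow> complex \<Rightarrow> real \<Rightarrow> complex \<Rightarrow> real" where
  "box_bump a b N x =
     flat_exp 0 (N * (Re x - Re a)) * flat_exp 0 (N * (Re b - Re x)) *
     (flat_exp 0 (N * (Im x - Im a)) * flat_exp 0 (N * (Im b - Im x)))"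

lemma bump_box_bump: "bump (box_bump a b N)"
proof -
  have "bump (\<lambda>x. flat_exp 0 (N * (Re x - Re a)))" "bump (\<lambda>x. flat_exp 0 (N * (Re b - Re x)))"
    "bump (\<lambda>x. flat_exp 0 (N * (Im x - Im a)))" "bump (\<lambda>x. flat_exp 0 (N * (Im b - Im x)))"
    using bump_flat_exp[of 0 "of_real N" "- N * Re a"] bump_flat_exp[of 0 "of_real (- N)" "N * Re b"]
      bump_flat_exp[of 0 "of_real N * \<i>" "- N * Im a"] bump_flat_exp[of 0 "of_real (- N) * \<i>" "N * Im b"]
    by (simp_all add: inner_complex_def algebra_simps)
  then show ?thesis unfolding box_bump_def by (intro bump_mult)
qed

lemma box_bump_bounds: "\<bar>box_bump a b N x\<bar> \<le> 1"
proof -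
  have *: "\<bar>flat_exp 0 t\<bar> \<le> 1" for t by (simp add: flat_exp_def)
  show ?thesis unfolding box_bump_def abs_mult
    by (intro mult_le_one mult_nonneg_nonneg *) auto
qed

lemma box_bump_eq_0: "N > 0 \<Longrightarrow> x \<notin> box a b \<Longrightarrow> box_bump a b N x = 0"
  by (auto simp: box_bump_def flat_exp_def in_box_complex_iff zero_less_mult_iff)

lemma box_bump_tendsto:
  "(\<lambda>k. box_bump a b (real (Suc k)) x) \<longlonglongrightarrow> indicator (box a b) x"
proof (cases "x \<in> box a b")
  case True
  have *: "(\<lambda>k. flat_exp 0 (real (Suc k) * t)) \<longlonglongrightarrow> 1" if "t > 0" for t
  proof -
    have "(\<lambda>k. exp (- (1 / (real (Suc k) * t)))) \<longlonglongrightarrow> 1" using that by real_asymp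
    then show ?thesis using that by (simp add: flat_exp_def del: of_nat_Suc)
  qed
  have "(\<lambda>k. box_bump a b (real (Suc k)) x) \<longlonglongrightarrow> 1 * 1 * (1 * 1)"
    unfolding box_bump_def using True by (intro tendsto_mult *) (auto simp: in_box_complex_iff)
  then show ?thesis using True by simp
next
  case False
  then show ?thesis using box_bump_eq_0[OF _ False] by (simp del: of_nat_Suc)
qed

lemma test_function_box_bump:
  assumes "N > 0"
  shows "test_function (box_bump a b N)"
proof -
  have "{x. box_bump a b N x \<noteq> 0} \<subseteq> box a b"
    using box_bump_eq_0[OF assms] by blast
  then have "bounded {x. box_bump a b N x \<noteq> 0}"
    using bounded_box bounded_subset by blast
  then show ?thesis
    using bump_C_k[OF bump_box_bump] by (simp add: test_function_def smooth_def compact_closure)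
qed

section \<open>Uniqueness of weak derivatives\<close>

lemma AE_eq_0_if_box_integrals_eq_0:
  fixes f :: "complex \<Rightarrow> complex"
  assumes int: "\<And>a b. set_integrable lborel (box a b) f"
    and 0: "\<And>a b. (LINT x:box a b|lborel. f x) = 0"
  shows "AE x in lborel. f x = 0"
proof -
  let ?B = "\<lambda>n::nat. box (- (real n *\<^sub>R One)) (real n *\<^sub>R One) :: complex set"
  have "AE x in lborel. indicator (?B n) x *\<^sub>R f x = 0" for n
  proof (rule sigma_finite_measure.density_zero[OF lborel.sigma_finite_measure_axioms])
    let ?g = "\<lambda>x. indicator (?B n) x *\<^sub>R f x"
    show ig: "integrable lborel ?g"
      using int unfolding set_integrable_def .
    have ig': "set_integrable lborel A ?g" if "A \<in> sets borel" for A
      using integrable_mult_indicator[OF _ ig] that by (simp add: set_integrable_def)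
    fix A :: "complex set" assume A: "A \<in> sets lborel"
    \<comment> \<open>The sets over which the integral vanishes form a Dynkin system containing the
      boxes, which generate the Borel sets and are stable under intersection. Truncation to
      \<open>?B n\<close> makes the function integrable, so complements can be subtracted; as
      \<open>?B n\<close> is itself a box, the total integral is 0.\<close>
    have "Int_stable (range (\<lambda>(a, b). box a b :: complex set))"
      by (auto simp: Int_stable_def box_Int_box)
    moreover have "range (\<lambda>(a, b). box a b :: complex set) \<subseteq> Pow UNIV" by auto
    moreover have "A \<in> sigma_sets UNIV (range (\<lambda>(a, b). box a b))"
      using A unfolding sets_lborel borel_eq_box by simp
    ultimately show "(LINT x:A|lborel. ?g x) = 0"
    proof (induction rule: sigma_sets_induct_disjoint)
      case (basic A)
      then obtain a b where "A = box a b" by auto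
      then obtain c d where "A \<inter> ?B n = box c d"
        by (simp only: box_Int_box)
      then have "(LINT x:A|lborel. ?g x) = (LINT x:box c d|lborel. f x)"
        unfolding set_lebesgue_integral_def
        by (intro Bochner_Integration.integral_cong) (auto simp: indicator_def)
      then show ?case using 0 by simp
    next
      case empty
      show ?case by (simp add: set_lebesgue_integral_def)
    next
      case (compl A)
      then have A: "A \<in> sets borel" by (simp add: borel_eq_box)
      have "(LINT x:UNIV - A|lborel. ?g x) = (LINT x|lborel. ?g x - indicator A x *\<^sub>R ?g x)"
        unfolding set_lebesgue_integral_def
        by (intro Bochner_Integration.integral_cong) (auto simp: indicator_def)
      also have "\<dots> = (LINT x|lborel. ?g x) - (LINT x:A|lborel. ?g x)"
        using ig ig'[OF A] unfolding set_lebesgue_integral_def set_integrable_def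
        by (rule Bochner_Integration.integral_diff)
      also have "(LINT x|lborel. ?g x) = 0"
        using 0 unfolding set_lebesgue_integral_def .
      finally show ?case using compl by simp
    next
      case (union A)
      then have A: "\<And>i. A i \<in> sets borel" by (simp add: borel_eq_box subset_eq)
      have "(LINT x:(\<Union>i. A i)|lborel. ?g x) = suminf (\<lambda>i. LINT x:A i|lborel. ?g x)"
        by (rule lebesgue_integral_countable_add)
           (use A union(1) ig' in \<open>auto simp: disjoint_family_on_def\<close>)
      then show ?case using union by simp
    qed
  qed
  then have "AE x in lborel. \<forall>n. indicator (?B n) x *\<^sub>R f x = 0"
    by (simp only: AE_all_countable) blast
  then show ?thesis
  proof eventually_elim
    case (elim x)
    obtain n where "x \<in> ?B n" using UN_box_eq_UNIV[where 'a = complex] by blast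
    then show ?case using elim[rule_format, of n] by simp
  qed
qed

lemma set_integrable_if_square_integrable:
  assumes "square_integrable g"
  shows "set_integrable lborel (box a b) g"
proof -
  have [measurable]: "g \<in> borel_measurable borel" and g: "integrable lborel (\<lambda>x. (norm (g x))\<^sup>2)"
    using assms by (auto simp: square_integrable_def)
  show ?thesis unfolding set_integrable_def
  proof (rule Bochner_Integration.integrable_bound)
    show "integrable lborel (\<lambda>x. indicator (box a b) x + (norm (g x))\<^sup>2)"
      using g emeasure_lborel_box_finite[of a b]
      by (intro Bochner_Integration.integrable_add integrable_real_indicator) auto
    have "norm (g x) \<le> 1 + (norm (g x))\<^sup>2" for x
      using sum_squares_bound[of "norm (g x)" 1] by (simp add: power2_eq_square) (smt (verit) zero_le_square)
    then show "AE x in lborel. norm (indicator (box a b) x *\<^sub>R g x) \<le> norm (indicator (box a b) x + (norm (g x))\<^sup>2)"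
      by (intro AE_I2) (simp add: indicator_def)
  qed simp
qed

text \<open>Testing against \<open>box_bump\<close> and sharpening it to an indicator shows that
  both candidates have the same integral over every box. This is what ties the arbitrary choice in
  \<open>weak_derivative\<close> to the classical derivative.\<close>

lemma weak_derivative_unique:
  assumes "square_integrable g1" "has_weak_derivative u e g1"
    and "square_integrable g2" "has_weak_derivative u e g2"
  shows "AE x in lborel. g1 x = g2 x"
proof -
  have int: "set_integrable lborel (box a b) (\<lambda>x. g1 x - g2 x)" for a b
    using assms by (intro set_integral_diff set_integrable_if_square_integrable)
  have [measurable]: "g1 \<in> borel_measurable borel" "g2 \<in> borel_measurable borel"
    using assms by (auto simp: square_integrable_def)
  have "(LINT x:box a b|lborel. g1 x - g2 x) = 0" for a b
  proof -
    let ?p = "\<lambda>k. box_bump a b (real (Suc k))"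
    have tf: "test_function (?p k)" for k by (intro test_function_box_bump) simp
    have [measurable]: "?p k \<in> borel_measurable borel" for k
      using tf[of k] unfolding test_function_def smooth_def
      by (metis C_k.simps(1) borel_measurable_continuous_onI)
    have bnd: "norm (?p k x *\<^sub>R g x) \<le> norm (indicator (box a b) x *\<^sub>R g x)" for k x and g :: "complex \<Rightarrow> complex"
      using box_bump_bounds[of a b "real (Suc k)" x] box_bump_eq_0[of "real (Suc k)" x a b]
      by (cases "x \<in> box a b") (auto simp: mult_left_le_one_le simp del: of_nat_Suc)
    have ip: "integrable lborel (\<lambda>x. ?p k x *\<^sub>R g x)" if "square_integrable g" for g k
    proof (rule Bochner_Integration.integrable_bound)
      show "integrable lborel (\<lambda>x. indicator (box a b) x *\<^sub>R g x)"
        using set_integrable_if_square_integrable[OF that] by (simp add: set_integrable_def)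
      show "(\<lambda>x. ?p k x *\<^sub>R g x) \<in> borel_measurable lborel"
        using that by (auto simp: square_integrable_def simp del: of_nat_Suc)
    qed (use bnd in auto)
    have "(LINT x|lborel. ?p k x *\<^sub>R g1 x) = (LINT x|lborel. ?p k x *\<^sub>R g2 x)" for k
      using assms(2,4) tf[of k] unfolding has_weak_derivative_def by (metis neg_equal_iff_equal)
    then have z: "(LINT x|lborel. ?p k x *\<^sub>R (g1 x - g2 x)) = 0" for k
      using ip assms(1,3) by (simp add: scaleR_diff_right)
    have "(\<lambda>k. LINT x|lborel. ?p k x *\<^sub>R (g1 x - g2 x)) \<longlonglongrightarrow> (LINT x|lborel. indicator (box a b) x *\<^sub>R (g1 x - g2 x))"
    proof (rule integral_dominated_convergence)
      show "integrable lborel (\<lambda>x. norm (indicator (box a b) x *\<^sub>R (g1 x - g2 x)))"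
        using int unfolding set_integrable_def by (rule integrable_norm)
      show "AE x in lborel. (\<lambda>k. ?p k x *\<^sub>R (g1 x - g2 x)) \<longlonglongrightarrow> indicator (box a b) x *\<^sub>R (g1 x - g2 x)"
        by (intro AE_I2 tendsto_scaleR box_bump_tendsto tendsto_const)
      show "AE x in lborel. norm (?p k x *\<^sub>R (g1 x - g2 x)) \<le> norm (indicator (box a b) x *\<^sub>R (g1 x - g2 x))" for k
        by (intro AE_I2 bnd)
    qed (simp_all del: of_nat_Suc)
    then show ?thesis unfolding z by (simp add: set_lebesgue_integral_def LIMSEQ_const_iff)
  qed
  from AE_eq_0_if_box_integrals_eq_0[OF int this] show ?thesis by simp
qed

text \<open>The product of the test function with \<open>u\<close> has bounded support, so its
  directional derivative integrates to 0; the product rule splits it into the two required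
  terms.\<close>

lemma has_weak_derivative_classical:
  assumes der: "\<And>x. (u has_derivative u' x) (at x)"
    and cont: "continuous_on UNIV (\<lambda>x. u' x e)"
  shows "has_weak_derivative u e (\<lambda>x. u' x e)"
  unfolding has_weak_derivative_def
proof (intro allI impI)
  fix \<phi> assume "test_function \<phi>"
  then have \<phi>: "C_k (Suc 0) \<phi>" and "compact (closure {x. \<phi> x \<noteq> 0})"
    by (auto simp: test_function_def smooth_def)
  then have "bounded {x. \<phi> x \<noteq> 0}"
    by (meson bounded_subset closure_subset compact_imp_bounded)
  then obtain R where R: "\<And>x. \<phi> x \<noteq> 0 \<Longrightarrow> norm x \<le> R"
    by (auto simp: bounded_iff)
  define d where "d = (\<lambda>x. frechet_derivative \<phi> (at x))"
  have d: "(\<phi> has_derivative d x) (at x)" "continuous_on UNIV (\<lambda>x. d x v)" for x v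
    using \<phi> by (auto simp: d_def frechet_derivative_works)
  have c: "continuous_on UNIV \<phi>" "continuous_on UNIV u"
    by (meson continuous_at_imp_continuous_on d(1) der has_derivative_continuous)+
  have z: "\<phi> x = 0 \<and> d x e = 0" if "norm x > R" for x
  proof -
    have "open {x::complex. norm x > R}"
      by (intro open_Collect_less continuous_intros)
    then have "(\<phi> has_derivative (\<lambda>_. 0)) (at x)"
      by (rule has_derivative_transform_within_open[OF has_derivative_const[of 0]])
         (use that R in force)+
    with d(1) have "d x = (\<lambda>_. 0)" by (rule has_derivative_unique)
    with that R show ?thesis by force
  qed
  have "(LINT x|lborel. \<phi> x *\<^sub>R u' x e + d x e *\<^sub>R u x) = 0"
    using has_derivative_scaleR[OF d(1) der]
    by (rule integral_directional_derivative_eq_0[where R = R])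
       (use z in \<open>auto intro!: continuous_intros c d cont\<close>)
  moreover have "integrable lborel (\<lambda>x. \<phi> x *\<^sub>R u' x e)" "integrable lborel (\<lambda>x. d x e *\<^sub>R u x)"
    by (rule continuous_imp_integrable_of_bounded_support[where R = R],
        use z in \<open>auto intro!: continuous_intros c d cont\<close>)+
  ultimately show "(LINT x|lborel. frechet_derivative \<phi> (at x) e *\<^sub>R u x) = - (LINT x|lborel. \<phi> x *\<^sub>R u' x e)"
    by (simp add: d_def eq_neg_iff_add_eq_0 add.commute)
qed

lemma weak_derivative_AE_eq:
  assumes "\<And>x. (u has_derivative u' x) (at x)" "continuous_on UNIV (\<lambda>x. u' x e)"
    and "square_integrable (\<lambda>x. u' x e)"
  shows "AE x in lborel. weak_derivative e u x = u' x e"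
proof -
  have "\<exists>g. square_integrable g \<and> has_weak_derivative u e g"
    using assms has_weak_derivative_classical by blast
  from someI_ex[OF this] show ?thesis
    using weak_derivative_unique has_weak_derivative_classical assms
    unfolding weak_derivative_def by blast
qed

section \<open>Asymptotics of polynomial pairs\<close>

lemma poly_growth:
  fixes p :: "complex poly"
  assumes "p = 0 \<or> degree p + j \<le> k"
  obtains C where "C \<ge> 0" "\<And>z. norm (poly p z) * (1 + norm z) ^ j \<le> C * (1 + norm z) ^ k"
proof
  let ?C = "\<Sum>i\<le>degree p. norm (coeff p i)"
  show "?C \<ge> 0" by (simp add: sum_nonneg)
  show "norm (poly p z) * (1 + norm z) ^ j \<le> ?C * (1 + norm z) ^ k" for z
  proof (cases "p = 0")
    case False
    with assms have jk: "degree p + j \<le> k" by simp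
    have "norm (poly p z) \<le> (\<Sum>i\<le>degree p. norm (coeff p i * z ^ i))"
      unfolding poly_altdef by (rule norm_sum)
    also have "\<dots> \<le> (\<Sum>i\<le>degree p. norm (coeff p i) * (1 + norm z) ^ degree p)"
    proof (rule sum_mono)
      fix i assume "i \<in> {..degree p}"
      have "norm z ^ i \<le> (1 + norm z) ^ i" by (intro power_mono) auto
      also have "\<dots> \<le> (1 + norm z) ^ degree p" using \<open>i \<in> _\<close> by (intro power_increasing) auto
      finally show "norm (coeff p i * z ^ i) \<le> norm (coeff p i) * (1 + norm z) ^ degree p"
        by (simp add: norm_mult norm_power mult_left_mono)
    qed
    also have "\<dots> = ?C * (1 + norm z) ^ degree p" by (simp add: sum_distrib_right)
    finally have "norm (poly p z) * (1 + norm z) ^ j \<le> ?C * (1 + norm z) ^ degree p * (1 + norm z) ^ j"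
      by (rule mult_right_mono) auto
    also have "\<dots> = ?C * (1 + norm z) ^ (degree p + j)" by (simp add: power_add)
    also have "\<dots> \<le> ?C * (1 + norm z) ^ k"
      using jk by (intro mult_left_mono power_increasing) (auto simp: sum_nonneg)
    finally show ?thesis .
  qed simp
qed

lemma poly_eq_sum_coeff: "degree p \<le> k \<Longrightarrow> poly p (z::complex) = (\<Sum>i\<le>k. coeff p i * z ^ i)"
  unfolding poly_altdef by (intro sum.mono_neutral_left) (auto simp: coeff_eq_0)

lemma poly_div_power_tendsto:
  fixes p :: "complex poly"
  assumes "degree p \<le> n"
  shows "((\<lambda>z. poly p z / z ^ n) \<longlongrightarrow> coeff p n) at_infinity"
proof -
  have "((\<lambda>z. \<Sum>i\<le>n. coeff p i * inverse z ^ (n - i)) \<longlongrightarrow> (\<Sum>i\<le>n. coeff p i * 0 ^ (n - i))) at_infinity"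
    by (intro tendsto_intros tendsto_inverse_0)
  also have "(\<Sum>i\<le>n. coeff p i * 0 ^ (n - i)) = (\<Sum>i\<le>n. if i = n then coeff p n else 0)"
    by (intro sum.cong) (auto simp: power_0_left)
  also have "\<dots> = coeff p n" by simp
  finally show ?thesis
  proof (rule Lim_transform_eventually)
    have "\<forall>\<^sub>F z in at_infinity. z \<noteq> (0::complex)"
      by (auto simp: eventually_at_infinity intro!: exI[of _ 1])
    then show "\<forall>\<^sub>F z in at_infinity. (\<Sum>i\<le>n. coeff p i * inverse z ^ (n - i)) = poly p z / z ^ n"
    proof eventually_elim
      case (elim z)
      have "poly p z = (\<Sum>i\<le>n. coeff p i * z ^ i)"
        using assms by (rule poly_eq_sum_coeff)
      also have "\<dots> / z ^ n = (\<Sum>i\<le>n. coeff p i * inverse z ^ (n - i))"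
        unfolding sum_divide_distrib using elim
        by (intro sum.cong) (auto simp: power_diff field_simps)
      finally show ?case by simp
    qed
  qed
qed

lemma poly_coprime_no_common_root:
  fixes P Q :: "complex poly"
  assumes "coprime P Q" "poly P z = 0"
  shows "poly Q z \<noteq> 0"
proof
  assume "poly Q z = 0"
  with assms have "[:- z, 1:] dvd P" "[:- z, 1:] dvd Q" by (auto simp: poly_eq_0_iff_dvd)
  with assms(1) have "[:- z, 1:] dvd 1" by (auto simp: coprime_def)
  then show False by (simp add: is_unit_pCons_iff)
qed

lemma integrable_if_cubic_decay:
  fixes f :: "complex \<Rightarrow> 'b::{banach, second_countable_topology}"
  assumes "continuous_on UNIV f" "k \<ge> 3" and b: "\<And>z. norm (f z) \<le> C / (1 + norm z) ^ k"
  shows "integrable lborel f"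
proof (rule Bochner_Integration.integrable_bound[OF integrable_mult_right[OF integrable_inverse_cube, of "\<bar>C\<bar>"]])
  show "f \<in> borel_measurable lborel"
    using assms(1) by (auto intro: borel_measurable_continuous_onI)
  have "norm (f z) \<le> \<bar>C\<bar> * (1 / (1 + norm z) ^ 3)" for z
  proof -
    have "C / (1 + norm z) ^ k \<le> \<bar>C\<bar> / (1 + norm z) ^ k" by (intro divide_right_mono) auto
    also have "\<dots> \<le> \<bar>C\<bar> / (1 + norm z) ^ 3"
      using assms(2) by (intro divide_left_mono power_increasing) (auto intro!: mult_pos_pos zero_less_power add_pos_nonneg)
    finally show ?thesis using b[of z] by simp
  qed
  then show "AE z in lborel. norm (f z) \<le> norm (\<bar>C\<bar> * (1 / (1 + norm z) ^ 3))"
    by (intro AE_I2) (simp add: abs_mult)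
qed

locale polynomial_pair =
  fixes P Q :: "complex poly" and n :: nat
  assumes coprime: "coprime P Q" and degree: "max (degree P) (degree Q) = n" and n_pos: "n \<ge> 1"
begin

abbreviation "W \<equiv> wronskian P Q"

definition s :: "complex \<Rightarrow> real" where
  "s z = (norm (poly P z))\<^sup>2 + (norm (poly Q z))\<^sup>2"

definition g :: "complex \<Rightarrow> complex" where
  "g z = poly (pderiv P) z * cnj (poly P z) + poly (pderiv Q) z * cnj (poly Q z)"

text \<open>The holomorphic derivative of \<open>ln s\<close>; the potential \<open>A\<close> is \<open>\<i> cnj h / n\<close>.\<close>

definition h :: "complex \<Rightarrow> complex" where
  "h z = g z / complex_of_real (s z)"

lemma s_pos: "s z > 0"
  using poly_coprime_no_common_root[OF coprime, of z]
  by (cases "poly P z = 0") (auto simp: s_def add_pos_nonneg)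

lemma s_nz [simp]: "s z \<noteq> 0" using s_pos[of z] by simp

lemma of_real_s: "complex_of_real (s z) = poly P z * cnj (poly P z) + poly Q z * cnj (poly Q z)"
  by (simp add: s_def complex_norm_square del: of_real_power)

lemma continuous_s: "continuous_on S s"
  unfolding s_def by (intro continuous_intros)

lemma degree_PQ: "degree P \<le> n" "degree Q \<le> n"
  using degree by auto

text \<open>At infinity \<open>s z / |z| ^ (2 * n)\<close> tends to a positive limit because one of
  the two \<open>n\<close>-th coefficients is nonzero; on a large disc \<open>s\<close> has a
  positive minimum because there is no common root.\<close>

lemma s_lower:
  obtains c where "c > 0" "\<And>z. c * (1 + norm z) ^ (2 * n) \<le> s z"
proof -
  define L where "L = (norm (coeff P n))\<^sup>2 + (norm (coeff Q n))\<^sup>2"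
  have "coeff P n \<noteq> 0 \<or> coeff Q n \<noteq> 0"
    using degree n_pos by (metis degree_0 leading_coeff_0_iff max_def not_one_le_zero)
  then have L: "L > 0" by (auto simp: L_def add_pos_nonneg add_nonneg_pos)
  have "((\<lambda>z. (norm (poly P z / z ^ n))\<^sup>2 + (norm (poly Q z / z ^ n))\<^sup>2) \<longlongrightarrow> L) at_infinity"
    unfolding L_def by (intro tendsto_intros poly_div_power_tendsto degree_PQ)
  then have "\<forall>\<^sub>F z in at_infinity. L / 2 < (norm (poly P z / z ^ n))\<^sup>2 + (norm (poly Q z / z ^ n))\<^sup>2"
    by (rule order_tendstoD) (use L in simp)
  then obtain R0 where R0: "\<And>z. norm z \<ge> R0 \<Longrightarrow> L / 2 < (norm (poly P z / z ^ n))\<^sup>2 + (norm (poly Q z / z ^ n))\<^sup>2"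
    by (auto simp: eventually_at_infinity)
  define R where "R = max R0 1"
  have "compact (s ` cball 0 R)" "s ` cball 0 R \<noteq> {}"
    using continuous_s by (auto intro!: compact_continuous_image simp: R_def)
  then obtain z0 where z0: "\<And>z. norm z \<le> R \<Longrightarrow> s z0 \<le> s z"
    using compact_attains_inf[of "s ` cball 0 R"] by fastforce
  \<comment> \<open>On the disc \<open>1 + norm z <= 1 + R\<close>; outside,
    \<open>1 + norm z <= 2 * norm z\<close> costs the factor \<open>2 ^ (2 * n)\<close>, and half
    the limit \<open>L\<close> is kept.\<close>
  define c where "c = min (s z0 / (1 + R) ^ (2 * n)) (L / 2 / 2 ^ (2 * n))"
  show ?thesis
  proof
    have "R > 0" by (simp add: R_def)
    then show "c > 0" using s_pos L by (simp add: c_def)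
    show "c * (1 + norm z) ^ (2 * n) \<le> s z" for z
    proof (cases "norm z \<le> R")
      case True
      have "c * (1 + norm z) ^ (2 * n) \<le> (s z0 / (1 + R) ^ (2 * n)) * (1 + R) ^ (2 * n)"
        using True \<open>c > 0\<close> by (intro mult_mono power_mono) (auto simp: c_def)
      also have "\<dots> = s z0" using \<open>R > 0\<close> by simp
      finally show ?thesis using z0[OF True] by simp
    next
      case False
      then have z: "norm z \<ge> R0" "norm z \<ge> 1" by (auto simp: R_def)
      have "c * (1 + norm z) ^ (2 * n) \<le> (L / 2 / 2 ^ (2 * n)) * (2 * norm z) ^ (2 * n)"
        using z L by (intro mult_mono power_mono) (auto simp: c_def)
      also have "\<dots> = L / 2 * (norm z ^ n)\<^sup>2"
        by (simp add: power_mult_distrib power_mult[symmetric] mult.commute)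
      also have "\<dots> \<le> ((norm (poly P z / z ^ n))\<^sup>2 + (norm (poly Q z / z ^ n))\<^sup>2) * (norm z ^ n)\<^sup>2"
        using R0[OF z(1)] by (intro mult_right_mono) auto
      also have "\<dots> = s z"
      proof -
        have "norm z ^ n \<noteq> 0" using z by auto
        then show ?thesis
          by (simp add: s_def norm_divide norm_power power_divide distrib_right)
      qed
      finally show ?thesis .
    qed
  qed
qed

text \<open>The operator \<open>z * p' - n * p\<close> annihilates \<open>z ^ n\<close>, so the top
  term cancels. Both cancellations at infinity, in the Wronskian and in the comparison of
  \<open>h\<close>, come from this.\<close>

lemma euler_degree:
  fixes p :: "complex poly"
  assumes "degree p \<le> n"
  shows "degree (pCons 0 (pderiv p) - smult (of_nat n) p) + 1 \<le> n"
proof -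
  have "degree (pCons 0 (pderiv p) - smult (of_nat n) p) \<le> n - 1"
  proof (rule degree_le, intro allI impI)
    fix i assume "n - 1 < i"
    then obtain j where j: "i = Suc j" "n \<le> i" using n_pos by (cases i) auto
    then show "coeff (pCons 0 (pderiv p) - smult (of_nat n) p) i = 0"
      using assms coeff_eq_0[of p i] by (cases "i = n") (auto simp: coeff_pderiv)
  qed
  with n_pos show ?thesis by linarith
qed

text \<open>The added terms \<open>n * P * Q\<close> cancel:
  \<open>z * W = (z * P' - n * P) * Q - P * (z * Q' - n * Q)\<close>, and each product has degree at
  most 2n - 1.\<close>

lemma degree_wronskian: "W = 0 \<or> degree W + 2 \<le> 2 * n"
proof (cases "W = 0")
  case False
  let ?E = "\<lambda>p :: complex poly. pCons 0 (pderiv p) - smult (of_nat n) p"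
  have "pCons 0 W = ?E P * Q - P * ?E Q"
    by (simp add: wronskian_def algebra_simps)
  also have "degree \<dots> \<le> 2 * n - 1"
    using euler_degree[OF degree_PQ(1)] euler_degree[OF degree_PQ(2)] degree_PQ n_pos
      degree_mult_le[of "?E P" Q] degree_mult_le[of P "?E Q"]
    by (intro degree_diff_le) linarith+
  finally show ?thesis using False n_pos by simp
qed simp

lemma growth_div_s:
  assumes "p \<ge> 0" "\<And>z. norm (F z) * (1 + norm z) ^ j \<le> p * (1 + norm z) ^ (2 * n)"
  obtains C where "C \<ge> 0" "\<And>z. norm (F z / complex_of_real (s z)) \<le> C / (1 + norm z) ^ j"
proof -
  obtain c where c: "c > 0" "\<And>z. c * (1 + norm z) ^ (2 * n) \<le> s z" by (rule s_lower) (rule that)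
  show ?thesis
  proof
    show "p / c \<ge> 0" using c assms by simp
    show "norm (F z / complex_of_real (s z)) \<le> p / c / (1 + norm z) ^ j" for z
    proof -
      have w: "(1 + norm z) ^ j > 0" by (simp add: add_pos_nonneg)
      have "c * (norm (F z) * (1 + norm z) ^ j) \<le> c * (p * (1 + norm z) ^ (2 * n))"
        using assms(2) c by (intro mult_left_mono) auto
      also have "\<dots> = p * (c * (1 + norm z) ^ (2 * n))" by simp
      also have "\<dots> \<le> p * s z" using assms(1) c by (intro mult_left_mono) auto
      finally have "c * (norm (F z) * (1 + norm z) ^ j) \<le> p * s z" .
      then show ?thesis
        using c(1) w s_pos[of z] by (simp add: norm_divide field_simps)
    qed
  qed
qed

lemma pderiv_growth_degree:
  fixes p :: "complex poly"
  assumes "p = 0 \<or> degree p + j \<le> k"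
  shows "pderiv p = 0 \<or> degree (pderiv p) + Suc j \<le> k"
  using assms by (cases "degree p = 0") (auto simp: degree_pderiv pderiv_eq_0_iff)

lemma poly_mult_cnj_growth:
  fixes p q :: "complex poly"
  assumes "p = 0 \<or> degree p + i \<le> n" "q = 0 \<or> degree q \<le> n"
  obtains C where "C \<ge> 0" "\<And>z. norm (poly p z * cnj (poly q z)) * (1 + norm z) ^ i \<le> C * (1 + norm z) ^ (2 * n)"
proof -
  obtain A where A: "A \<ge> 0" "\<And>z. norm (poly p z) * (1 + norm z) ^ i \<le> A * (1 + norm z) ^ n"
    using poly_growth[OF assms(1)] by metis
  obtain B where B: "B \<ge> 0" "\<And>z. norm (poly q z) * (1 + norm z) ^ 0 \<le> B * (1 + norm z) ^ n"
    using poly_growth[of q 0 n] assms(2) by (metis add.right_neutral)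
  show ?thesis
  proof
    show "A * B \<ge> 0" using A B by simp
    show "norm (poly p z * cnj (poly q z)) * (1 + norm z) ^ i \<le> A * B * (1 + norm z) ^ (2 * n)" for z
    proof -
      have "(norm (poly p z) * (1 + norm z) ^ i) * (norm (poly q z) * (1 + norm z) ^ 0)
          \<le> (A * (1 + norm z) ^ n) * (B * (1 + norm z) ^ n)"
        using A(1) B(1) by (intro mult_mono[OF A(2) B(2)]) auto
      also have "\<dots> = A * B * (1 + norm z) ^ (2 * n)" by (simp add: mult_2 power_add)
      finally show ?thesis by (simp add: norm_mult mult_ac)
    qed
  qed
qed

lemma g_growth: obtains C where "C \<ge> 0" "\<And>z. norm (g z) * (1 + norm z) \<le> C * (1 + norm z) ^ (2 * n)"
proof -
  have 1: "pderiv p = 0 \<or> degree (pderiv p) + 1 \<le> n" if "degree p \<le> n" for p :: "complex poly"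
    using pderiv_growth_degree[of p 0 n] that by simp
  obtain A where A: "A \<ge> 0" "\<And>z. norm (poly (pderiv P) z * cnj (poly P z)) * (1 + norm z) ^ 1 \<le> A * (1 + norm z) ^ (2 * n)"
    by (rule poly_mult_cnj_growth[OF 1[OF degree_PQ(1)] disjI2[OF degree_PQ(1)]]) (rule that)
  obtain B where B: "B \<ge> 0" "\<And>z. norm (poly (pderiv Q) z * cnj (poly Q z)) * (1 + norm z) ^ 1 \<le> B * (1 + norm z) ^ (2 * n)"
    by (rule poly_mult_cnj_growth[OF 1[OF degree_PQ(2)] disjI2[OF degree_PQ(2)]]) (rule that)
  show ?thesis
  proof
    show "A + B \<ge> 0" using A B by simp
    show "norm (g z) * (1 + norm z) \<le> (A + B) * (1 + norm z) ^ (2 * n)" for z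
    proof -
      have "norm (g z) \<le> norm (poly (pderiv P) z * cnj (poly P z)) + norm (poly (pderiv Q) z * cnj (poly Q z))"
        unfolding g_def by (rule norm_triangle_ineq)
      then have "norm (g z) * (1 + norm z) \<le>
          (norm (poly (pderiv P) z * cnj (poly P z)) + norm (poly (pderiv Q) z * cnj (poly Q z))) * (1 + norm z)"
        by (rule mult_right_mono) simp
      with A(2)[of z] B(2)[of z] show ?thesis by (simp add: distrib_right)
    qed
  qed
qed

lemma h_decay: obtains C where "C \<ge> 0" "\<And>z. norm (h z) \<le> C / (1 + norm z)"
proof -
  obtain p where "p \<ge> 0" "\<And>z. norm (g z) * (1 + norm z) ^ 1 \<le> p * (1 + norm z) ^ (2 * n)"
    using g_growth by (metis power_one_right)
  then show ?thesis using growth_div_s[of p g 1] that unfolding h_def by (metis power_one_right)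
qed

lemma wronskian_decay:
  obtains C where "C \<ge> 0" "\<And>z. norm (poly W z / complex_of_real (s z)) \<le> C / (1 + norm z)\<^sup>2"
  using poly_growth[of W 2 "2 * n"] degree_wronskian growth_div_s by metis

lemma wronskian_deriv_decay:
  obtains C where "C \<ge> 0" "\<And>z. norm (poly (pderiv W) z / complex_of_real (s z)) \<le> C / (1 + norm z) ^ 3"
proof -
  have "pderiv W = 0 \<or> degree (pderiv W) + 3 \<le> 2 * n"
    using pderiv_growth_degree[OF degree_wronskian] by (simp add: eval_nat_numeral)
  then show ?thesis using poly_growth[of "pderiv W" 3 "2 * n"] growth_div_s that by metis
qed

lemma h_difference_decay:
  obtains C where "C \<ge> 0"
    "\<And>z. norm (h z - of_nat n * cnj z / complex_of_real (1 + (norm z)\<^sup>2)) \<le> C / (1 + norm z)\<^sup>2"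
proof -
  let ?E = "\<lambda>p :: complex poly. pCons 0 (pderiv p) - smult (of_nat n) p"
  \<comment> \<open>The numerator of the difference over the common denominator
    \<open>s z * (1 + |z|^2)\<close>. Written with the Euler operator it is O(s), which leaves the
    decay of \<open>1 / (1 + |z|^2)\<close>.\<close>
  define N where "N = (\<lambda>z. cnj z * (poly (?E P) z * cnj (poly P z)) + cnj z * (poly (?E Q) z * cnj (poly Q z)) + g z)"
  obtain A where A: "A \<ge> 0" "\<And>z. norm (poly (?E P) z * cnj (poly P z)) * (1 + norm z) ^ 1 \<le> A * (1 + norm z) ^ (2 * n)"
    by (rule poly_mult_cnj_growth[OF disjI2[OF euler_degree[OF degree_PQ(1)]] disjI2[OF degree_PQ(1)]]) (rule that)
  obtain B where B: "B \<ge> 0" "\<And>z. norm (poly (?E Q) z * cnj (poly Q z)) * (1 + norm z) ^ 1 \<le> B * (1 + norm z) ^ (2 * n)"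
    by (rule poly_mult_cnj_growth[OF disjI2[OF euler_degree[OF degree_PQ(2)]] disjI2[OF degree_PQ(2)]]) (rule that)
  obtain D where D: "D \<ge> 0" "\<And>z. norm (g z) * (1 + norm z) \<le> D * (1 + norm z) ^ (2 * n)"
    by (rule g_growth) (rule that)
  have Nle: "norm (N z) * (1 + norm z) ^ 0 \<le> (A + B + D) * (1 + norm z) ^ (2 * n)" for z
  proof -
    have sm: "norm z * x \<le> x * (1 + norm z)" "x \<le> x * (1 + norm z)" if "x \<ge> 0" for x :: real
      using that by (simp_all add: algebra_simps)
    have "norm (N z) \<le> norm z * norm (poly (?E P) z * cnj (poly P z)) + norm z * norm (poly (?E Q) z * cnj (poly Q z)) + norm (g z)"
      unfolding N_def
      by (rule norm_triangle_le, intro add_right_mono norm_triangle_le, unfold norm_mult[of "cnj z"], simp)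
    also have "\<dots> \<le> norm (poly (?E P) z * cnj (poly P z)) * (1 + norm z) +
        norm (poly (?E Q) z * cnj (poly Q z)) * (1 + norm z) + norm (g z) * (1 + norm z)"
      by (intro add_mono sm) auto
    also have "\<dots> \<le> (A + B + D) * (1 + norm z) ^ (2 * n)"
      unfolding distrib_right using A(2)[of z] B(2)[of z] D(2)[of z] by simp
    finally show ?thesis by simp
  qed
  obtain C where C: "C \<ge> 0" "\<And>z. norm (N z / complex_of_real (s z)) \<le> C / (1 + norm z) ^ 0"
    using growth_div_s[OF _ Nle] A(1) B(1) D(1) by (metis add_nonneg_nonneg)
  show ?thesis
  proof
    show "2 * C \<ge> 0" using C by simp
    show "norm (h z - of_nat n * cnj z / complex_of_real (1 + (norm z)\<^sup>2)) \<le> 2 * C / (1 + norm z)\<^sup>2" for z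
    proof -
      have nz: "complex_of_real (1 + (norm z)\<^sup>2) \<noteq> 0"
        by (metis of_real_eq_0_iff add_pos_nonneg less_irrefl zero_le_power2 zero_less_one)
      have "N z = g z * complex_of_real (1 + (norm z)\<^sup>2) - of_nat n * cnj z * complex_of_real (s z)"
        unfolding of_real_s of_real_add complex_norm_square N_def g_def
        by (simp add: algebra_simps)
      then have eq: "h z - of_nat n * cnj z / complex_of_real (1 + (norm z)\<^sup>2) =
          (N z / complex_of_real (s z)) / complex_of_real (1 + (norm z)\<^sup>2)"
        using nz unfolding h_def by (simp add: field_simps del: of_real_add of_real_power)
      have "norm (h z - of_nat n * cnj z / complex_of_real (1 + (norm z)\<^sup>2)) \<le> C / (1 + (norm z)\<^sup>2)"
        unfolding eq norm_divide[of _ "complex_of_real (1 + _)"] using C(2)[of z]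
        by (simp add: divide_right_mono del: of_real_add of_real_power)
      also have "\<dots> = 2 * C / (2 * (1 + (norm z)\<^sup>2))" by (rule mult_divide_mult_cancel_left[symmetric]) simp
      also have "\<dots> \<le> 2 * C / (1 + norm z)\<^sup>2"
      proof (intro divide_left_mono)
        show "(1 + norm z)\<^sup>2 \<le> 2 * (1 + (norm z)\<^sup>2)"
          using sum_squares_bound[of 1 "norm z"] by (simp add: power2_sum)
      qed (use C in \<open>auto intro!: mult_pos_pos add_pos_nonneg zero_less_power\<close>)
      finally show ?thesis .
    qed
  qed
qed

end

section \<open>The critical state of a polynomial pair\<close>

context polynomial_pair
begin

abbreviation "u \<equiv> u_PQ n P Q"

abbreviation c0 :: complex where "c0 \<equiv> complex_of_real (sqrt (1 / (pi * real n)))"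

text \<open>The \<open>z\<close>-derivative of \<open>h\<close>; integration by parts asks for its
  continuity.\<close>

definition h_hol :: "complex \<Rightarrow> complex" where
  "h_hol z = ((poly (pderiv (pderiv P)) z * cnj (poly P z) + poly (pderiv (pderiv Q)) z * cnj (poly Q z))
      * complex_of_real (s z) - g z * g z) / (complex_of_real (s z))\<^sup>2"

definition u_dbar :: "complex \<Rightarrow> complex" where
  "u_dbar z = c0 * cnj (poly (pderiv W) z - poly W z * h z) / complex_of_real (s z)"

text \<open>The covariant derivatives of \<open>u\<close> in the directions \<open>1\<close> and \<open>\<i>\<close> are \<open>\<eta>\<close> and \<open>- \<i> \<eta>\<close>.\<close>

definition \<eta> :: "complex \<Rightarrow> complex" where
  "\<eta> z = u_dbar z - cnj (h z) * u z"

definition \<eta>_dbar :: "complex \<Rightarrow> complex" where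
  "\<eta>_dbar z = c0 * (cnj (poly (pderiv (pderiv W)) z - 2 * poly (pderiv W) z * h z - 2 * poly W z * h_hol z)
      * complex_of_real (s z) - cnj (poly (pderiv W) z - 2 * poly W z * h z) * cnj (g z)) / (complex_of_real (s z))\<^sup>2"

lemma n_real_pos: "real n > 0" using n_pos by simp

lemma u_eq: "u z = c0 * cnj (poly W z) / complex_of_real (s z)"
  by (simp add: u_PQ_def s_def)

lemma norm_u_power2: "(norm (u z))\<^sup>2 = 1 / (pi * real n) * ((norm (poly W z))\<^sup>2 / (s z)\<^sup>2)"
  using n_real_pos by (simp add: u_eq norm_mult norm_divide power_mult_distrib power_divide)

lemma norm_u_power4: "(norm (u z)) ^ 4 = 1 / (pi\<^sup>2 * (real n)\<^sup>2) * ((norm (poly W z)) ^ 4 / (s z) ^ 4)"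
proof -
  have "(norm (u z)) ^ 4 = ((norm (u z))\<^sup>2)\<^sup>2" by simp
  also have "\<dots> = 1 / (pi\<^sup>2 * (real n)\<^sup>2) * ((norm (poly W z)) ^ 4 / (s z) ^ 4)"
    unfolding norm_u_power2 by (simp add: power_mult_distrib power_divide)
  finally show ?thesis .
qed

lemma has_wirtinger_s: "has_wirtinger (\<lambda>z. complex_of_real (s z)) (g z) (cnj (g z)) z"
  unfolding of_real_s
  by (rule has_wirtinger_cong[OF has_wirtinger_add[OF has_wirtinger_mult has_wirtinger_mult]])
     (rule has_wirtinger_poly has_wirtinger_cnj[OF has_wirtinger_poly] | simp add: g_def mult.commute)+

lemma has_wirtinger_g:
  "has_wirtinger g (poly (pderiv (pderiv P)) z * cnj (poly P z) + poly (pderiv (pderiv Q)) z * cnj (poly Q z))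
     (poly (pderiv P) z * cnj (poly (pderiv P) z) + poly (pderiv Q) z * cnj (poly (pderiv Q) z)) z"
  unfolding g_def[abs_def]
  by (rule has_wirtinger_cong[OF has_wirtinger_add[OF has_wirtinger_mult has_wirtinger_mult]])
     (rule has_wirtinger_poly has_wirtinger_cnj[OF has_wirtinger_poly] | simp)+

text \<open>The quotient rule leaves \<open>(|P'|^2 + |Q'|^2) * s - |g|^2\<close> in the numerator,
  which is \<open>|W|^2\<close> by Lagrange's identity, the exact form of the Cauchy-Schwarz
  inequality.\<close>

lemma has_wirtinger_h:
  "has_wirtinger h (h_hol z) (complex_of_real (pi * real n * (norm (u z))\<^sup>2)) z"
  unfolding h_def[abs_def]
proof (rule has_wirtinger_cong[OF has_wirtinger_divide[OF has_wirtinger_g has_wirtinger_s]])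
  let ?p = "poly P z" and ?q = "poly Q z" and ?p' = "poly (pderiv P) z" and ?q' = "poly (pderiv Q) z"
  have "(?p' * cnj ?p' + ?q' * cnj ?q') * complex_of_real (s z) - g z * cnj (g z) = poly W z * cnj (poly W z)"
    unfolding of_real_s g_def wronskian_def by (simp add: algebra_simps)
  also have "\<dots> = complex_of_real ((norm (poly W z))\<^sup>2)" by (simp only: complex_norm_square)
  finally show "((?p' * cnj ?p' + ?q' * cnj ?q') * complex_of_real (s z) - g z * cnj (g z)) / (complex_of_real (s z))\<^sup>2
      = complex_of_real (pi * real n * (norm (u z))\<^sup>2)"
    using n_real_pos by (simp add: norm_u_power2)
qed (simp_all add: h_hol_def)

text \<open>The \<open>z\<close>-derivative acts on \<open>1 / s\<close> alone and produces
  \<open>- h * u\<close>; this is the first-order equation of the state.\<close>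

lemma has_wirtinger_u: "has_wirtinger u (- h z * u z) (u_dbar z) z"
proof -
  have eq: "u = (\<lambda>z. c0 * cnj (poly W z) / complex_of_real (s z))" by (simp add: fun_eq_iff u_eq)
  show ?thesis
    unfolding eq
    by (rule has_wirtinger_cong[OF has_wirtinger_divide[OF has_wirtinger_mult[OF has_wirtinger_const
            has_wirtinger_cnj[OF has_wirtinger_poly]] has_wirtinger_s]])
       (simp_all add: h_def u_dbar_def field_simps power2_eq_square)
qed

lemma \<eta>_eq: "\<eta> z = c0 * cnj (poly (pderiv W) z - 2 * poly W z * h z) / complex_of_real (s z)"
  by (simp add: \<eta>_def u_dbar_def u_eq field_simps)

text \<open>The dbar derivative of \<open>h\<close> inside the conjugate brings in the density
  \<open>|u|^2\<close>. This term is the source of the quartic integral in the kinetic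
  energy.\<close>

lemma has_wirtinger_\<eta>:
  "has_wirtinger \<eta> (- 2 * u z * complex_of_real (pi * real n * (norm (u z))\<^sup>2) - h z * \<eta> z) (\<eta>_dbar z) z"
proof -
  let ?b = "complex_of_real (pi * real n * (norm (u z))\<^sup>2)"
  have "has_wirtinger (\<lambda>z. poly (pderiv W) z - 2 * poly W z * h z)
      (poly (pderiv (pderiv W)) z - 2 * poly (pderiv W) z * h z - 2 * poly W z * h_hol z)
      (- 2 * poly W z * ?b) z"
    by (rule has_wirtinger_cong[OF has_wirtinger_diff[OF has_wirtinger_poly has_wirtinger_mult[OF has_wirtinger_mult[OF
            has_wirtinger_const has_wirtinger_poly] has_wirtinger_h]]]) (simp_all del: of_real_mult)
  note T = has_wirtinger_cnj[OF this]
  have eq: "\<eta> = (\<lambda>z. c0 * cnj (poly (pderiv W) z - 2 * poly W z * h z) / complex_of_real (s z))"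
    by (simp add: fun_eq_iff \<eta>_eq)
  have 1: "- 2 * u z * ?b - h z * \<eta> z =
     (c0 * cnj (- 2 * poly W z * ?b) * complex_of_real (s z)
       - c0 * cnj (poly (pderiv W) z - 2 * poly W z * h z) * g z) / (complex_of_real (s z))\<^sup>2"
  proof -
    \<comment> \<open>The identity is checked with all analytic quantities abstracted to free
      variables, which keeps conjugates from being expanded.\<close>
    have *: "- 2 * (c * w / t) * b - G / t * (c * T / t) = (c * (- 2 * w * b) * t - c * T * G) / t\<^sup>2"
      if "t \<noteq> 0" for b c w T G t :: complex
      using that by (simp add: field_simps power2_eq_square)
    have b: "cnj (- 2 * poly W z * ?b) = - 2 * cnj (poly W z) * ?b"
      by (simp only: complex_cnj_mult complex_cnj_complex_of_real) simp
    define T where "T = cnj (poly (pderiv W) z - 2 * poly W z * h z)"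
    define b where "b = ?b"
    have "- 2 * u z * b - h z * \<eta> z = - 2 * (c0 * cnj (poly W z) / complex_of_real (s z)) * b
        - g z / complex_of_real (s z) * (c0 * T / complex_of_real (s z))"
      unfolding \<eta>_eq T_def by (subst u_eq) (simp add: h_def)
    also have "\<dots> = (c0 * (- 2 * cnj (poly W z) * b) * complex_of_real (s z) - c0 * T * g z) / (complex_of_real (s z))\<^sup>2"
      by (rule *) simp
    finally show ?thesis unfolding b unfolding b_def T_def .
  qed
  show ?thesis
    unfolding eq
    by (rule has_wirtinger_cong[OF has_wirtinger_divide[OF has_wirtinger_mult[OF has_wirtinger_const T] has_wirtinger_s]])
       (use 1 in \<open>simp_all add: \<eta>_dbar_def eq right_diff_distrib mult.assoc del: of_real_mult complex_cnj_diff complex_cnj_mult\<close>)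
qed

lemma continuous_aux:
  "continuous_on S g" "continuous_on S h" "continuous_on S u" "continuous_on S \<eta>"
  "continuous_on S h_hol" "continuous_on S u_dbar" "continuous_on S \<eta>_dbar"
proof -
  show 1: "continuous_on S g" "continuous_on S h" "continuous_on S u" "continuous_on S \<eta>"
    by (rule has_wirtinger_imp_continuous_on, rule has_wirtinger_g has_wirtinger_h has_wirtinger_u has_wirtinger_\<eta>)+
  show "continuous_on S u_dbar"
    unfolding u_dbar_def[abs_def] by (intro continuous_intros 1 continuous_s) auto
  show 2: "continuous_on S h_hol"
    unfolding h_hol_def[abs_def] by (intro continuous_intros 1 continuous_s) auto
  show "continuous_on S \<eta>_dbar"
    unfolding \<eta>_dbar_def[abs_def] by (intro continuous_intros 1 2 continuous_s) auto
qed

section \<open>Decay and square integrability of the state and its derivatives\<close>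

lemma decay_mult:
  fixes f k :: "complex \<Rightarrow> complex"
  assumes "A \<ge> 0" "\<And>z. norm (f z) \<le> A / (1 + norm z) ^ i" "\<And>z. norm (k z) \<le> B / (1 + norm z) ^ j"
  shows "norm (f z * k z) \<le> A * B / (1 + norm z) ^ (i + j)"
proof -
  have "norm (f z) * norm (k z) \<le> (A / (1 + norm z) ^ i) * (B / (1 + norm z) ^ j)"
    using assms by (intro mult_mono) auto
  then show ?thesis by (simp add: norm_mult power_add)
qed

lemma u_decay: obtains C where "C \<ge> 0" "\<And>z. norm (u z) \<le> C / (1 + norm z) ^ 2"
proof -
  obtain C where C: "C \<ge> 0" "\<And>z. norm (poly W z / complex_of_real (s z)) \<le> C / (1 + norm z)\<^sup>2"
    by (rule wronskian_decay) (rule that)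
  show ?thesis
  proof
    show "norm c0 * C \<ge> 0" using C by simp
    show "norm (u z) \<le> norm c0 * C / (1 + norm z)\<^sup>2" for z
    proof -
      have "norm (u z) = norm c0 * norm (poly W z / complex_of_real (s z))"
        unfolding u_eq by (simp only: norm_mult norm_divide complex_mod_cnj times_divide_eq_right)
      also have "\<dots> \<le> norm c0 * (C / (1 + norm z)\<^sup>2)"
        by (intro mult_left_mono C) simp
      finally show ?thesis by simp
    qed
  qed
qed

lemma hu_decay: obtains C where "C \<ge> 0" "\<And>z. norm (h z * u z) \<le> C / (1 + norm z) ^ 3"
proof -
  obtain A where A: "A \<ge> 0" "\<And>z. norm (h z) \<le> A / (1 + norm z)"
    by (rule h_decay) (rule that)
  obtain B where B: "B \<ge> 0" "\<And>z. norm (u z) \<le> B / (1 + norm z) ^ 2"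
    by (rule u_decay) (rule that)
  show ?thesis
  proof
    show "A * B \<ge> 0" using A B by simp
    show "norm (h z * u z) \<le> A * B / (1 + norm z) ^ 3" for z
      using decay_mult[of A h 1 u B 2] A B by (simp del: power_Suc add: numeral_3_eq_3)
  qed
qed

lemma u_dbar_decay: obtains C where "C \<ge> 0" "\<And>z. norm (u_dbar z) \<le> C / (1 + norm z) ^ 3"
proof -
  obtain A where A: "A \<ge> 0" "\<And>z. norm (poly (pderiv W) z / complex_of_real (s z)) \<le> A / (1 + norm z) ^ 3"
    by (rule wronskian_deriv_decay) (rule that)
  obtain B where B: "B \<ge> 0" "\<And>z. norm (h z * u z) \<le> B / (1 + norm z) ^ 3"
    by (rule hu_decay) (rule that)
  show ?thesis
  proof
    show "norm c0 * A + B \<ge> 0" using A B by simp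
    show "norm (u_dbar z) \<le> (norm c0 * A + B) / (1 + norm z) ^ 3" for z
    proof -
      have "u_dbar z = c0 * cnj (poly (pderiv W) z / complex_of_real (s z)) - cnj (h z) * u z"
        by (simp add: u_dbar_def u_eq field_simps)
      then have "norm (u_dbar z) \<le> norm (c0 * cnj (poly (pderiv W) z / complex_of_real (s z))) + norm (cnj (h z) * u z)"
        by (simp only: norm_triangle_ineq4)
      also have "\<dots> = norm c0 * norm (poly (pderiv W) z / complex_of_real (s z)) + norm (h z * u z)"
        by (simp only: norm_mult complex_mod_cnj)
      also have "\<dots> \<le> norm c0 * (A / (1 + norm z) ^ 3) + B / (1 + norm z) ^ 3"
        by (intro add_mono mult_left_mono A B) simp
      finally show ?thesis by (simp add: add_divide_distrib)
    qed
  qed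
qed

lemma \<eta>_decay: obtains C where "C \<ge> 0" "\<And>z. norm (\<eta> z) \<le> C / (1 + norm z) ^ 3"
proof -
  obtain A where A: "A \<ge> 0" "\<And>z. norm (u_dbar z) \<le> A / (1 + norm z) ^ 3"
    by (rule u_dbar_decay) (rule that)
  obtain B where B: "B \<ge> 0" "\<And>z. norm (h z * u z) \<le> B / (1 + norm z) ^ 3"
    by (rule hu_decay) (rule that)
  show ?thesis
  proof
    show "A + B \<ge> 0" using A B by simp
    show "norm (\<eta> z) \<le> (A + B) / (1 + norm z) ^ 3" for z
      using norm_triangle_ineq4[of "u_dbar z" "cnj (h z) * u z"] A(2)[of z] B(2)[of z]
      by (simp add: \<eta>_def norm_mult add_divide_distrib)
  qed
qed

lemma integrable_norm_mult:
  fixes f k :: "complex \<Rightarrow> complex"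
  assumes "continuous_on UNIV f" "continuous_on UNIV k" "A \<ge> 0" "i + j \<ge> 3"
    and "\<And>z. norm (f z) \<le> A / (1 + norm z) ^ i" "\<And>z. norm (k z) \<le> B / (1 + norm z) ^ j"
  shows "integrable lborel (\<lambda>z. norm (f z) * norm (k z))"
  by (rule integrable_if_cubic_decay[where k = "i + j" and C = "A * B"])
     (use assms decay_mult[OF assms(3,5,6)] in \<open>auto intro!: continuous_intros simp: norm_mult\<close>)

lemma integrable_u2: "integrable lborel (\<lambda>z. (norm (u z))\<^sup>2)"
  and integrable_u4: "integrable lborel (\<lambda>z. (norm (u z)) ^ 4)"
  and integrable_\<eta>2: "integrable lborel (\<lambda>z. (norm (\<eta> z))\<^sup>2)"
  and integrable_hu2: "integrable lborel (\<lambda>z. (norm (h z * u z))\<^sup>2)"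
  and integrable_u_dbar2: "integrable lborel (\<lambda>z. (norm (u_dbar z))\<^sup>2)"
proof -
  obtain U where U: "U \<ge> 0" "\<And>z. norm (u z) \<le> U / (1 + norm z) ^ 2"
    by (rule u_decay) (rule that)
  obtain E where E: "E \<ge> 0" "\<And>z. norm (\<eta> z) \<le> E / (1 + norm z) ^ 3"
    by (rule \<eta>_decay) (rule that)
  obtain H where H: "H \<ge> 0" "\<And>z. norm (h z * u z) \<le> H / (1 + norm z) ^ 3"
    by (rule hu_decay) (rule that)
  obtain D where D: "D \<ge> 0" "\<And>z. norm (u_dbar z) \<le> D / (1 + norm z) ^ 3"
    by (rule u_dbar_decay) (rule that)
  have c: "continuous_on UNIV (\<lambda>z. h z * u z)" by (intro continuous_intros continuous_aux)
  show "integrable lborel (\<lambda>z. (norm (u z))\<^sup>2)"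
    using integrable_norm_mult[OF _ _ U(1) _ U(2) U(2)] continuous_aux by (simp add: power2_eq_square)
  show "integrable lborel (\<lambda>z. (norm (\<eta> z))\<^sup>2)"
    using integrable_norm_mult[OF _ _ E(1) _ E(2) E(2)] continuous_aux by (simp add: power2_eq_square)
  show "integrable lborel (\<lambda>z. (norm (h z * u z))\<^sup>2)"
    using integrable_norm_mult[OF c c H(1) _ H(2) H(2)] by (simp add: power2_eq_square)
  show "integrable lborel (\<lambda>z. (norm (u_dbar z))\<^sup>2)"
    using integrable_norm_mult[OF _ _ D(1) _ D(2) D(2)] continuous_aux by (simp add: power2_eq_square)
  have c2: "continuous_on UNIV (\<lambda>z. u z * u z)" by (intro continuous_intros continuous_aux)
  have "norm (u z * u z) \<le> U * U / (1 + norm z) ^ 4" for z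
    using decay_mult[OF U(1) U(2) U(2)] by simp
  from integrable_norm_mult[OF c2 c2 _ _ this this] U(1)
  show "integrable lborel (\<lambda>z. (norm (u z)) ^ 4)"
    by (simp add: norm_mult power4_eq_xxxx mult.assoc)
qed

text \<open>\<open>\<pi> n \<bar>u\<bar>\<^sup>2 = dbar h\<close> has the same integral as \<open>dbar (n cnj z / (1 + \<bar>z\<bar>\<^sup>2)) = n / (1 + \<bar>z\<bar>\<^sup>2)\<^sup>2\<close>,
  since the two primitives agree up to \<open>O(\<bar>z\<bar>\<^sup>-\<^sup>2)\<close> at infinity.\<close>

lemma mass: "(LINT z|lborel. (norm (u z))\<^sup>2) = 1"
proof -
  let ?t = "\<lambda>z::complex. complex_of_real (1 + (norm z)\<^sup>2)"
  have nz: "?t z \<noteq> 0" for z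
    by (metis of_real_eq_0_iff add_pos_nonneg less_irrefl zero_le_power2 zero_less_one)
  have t: "?t z = 1 + z * cnj z" for z by (simp add: complex_norm_square del: of_real_power)
  have wid: "has_wirtinger (\<lambda>z. z) 1 0 z" for z
    by (rule has_wirtinger_field_derivative) (rule DERIV_ident)
  have wt: "has_wirtinger ?t (cnj z) z z" for z
    unfolding t
    by (rule has_wirtinger_cong[OF has_wirtinger_add[OF has_wirtinger_const has_wirtinger_mult[OF wid has_wirtinger_cnj[OF wid]]]])
       simp_all
  have w0: "has_wirtinger (\<lambda>z. of_nat n * cnj z / ?t z) (- of_nat n * (cnj z)\<^sup>2 / (?t z)\<^sup>2)
      (complex_of_real (real n * (1 / (1 + (norm z)\<^sup>2)\<^sup>2))) z" for z
  proof (rule has_wirtinger_cong[OF has_wirtinger_divide[OF has_wirtinger_mult[OF has_wirtinger_const has_wirtinger_cnj[OF wid]] wt nz]])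
    have "(0 * cnj z + of_nat n * cnj 1) * ?t z - of_nat n * cnj z * z = of_nat n"
      unfolding t by (simp add: algebra_simps)
    then show "((0 * cnj z + of_nat n * cnj 1) * ?t z - of_nat n * cnj z * z) / (?t z)\<^sup>2
        = complex_of_real (real n * (1 / (1 + (norm z)\<^sup>2)\<^sup>2))"
      by simp
  qed (simp add: power2_eq_square)
  obtain C where C: "C \<ge> 0" "\<And>z. norm (h z - of_nat n * cnj z / ?t z) \<le> C / (1 + norm z)\<^sup>2"
    by (rule h_difference_decay) (rule that)
  have i1: "integrable lborel (\<lambda>z. complex_of_real (pi * real n * (norm (u z))\<^sup>2))"
    using integrable_u2 by (intro integrable_of_real integrable_mult_right) auto
  have i2: "integrable lborel (\<lambda>z. complex_of_real (real n * (1 / (1 + (norm (z::complex))\<^sup>2)\<^sup>2)))"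
    using integrable_inverse_one_plus_square by (intro integrable_of_real integrable_mult_right) auto
  have "(LINT z|lborel. complex_of_real (pi * real n * (norm (u z))\<^sup>2) - complex_of_real (real n * (1 / (1 + (norm z)\<^sup>2)\<^sup>2))) = 0"
  proof (rule integral_dbar_eq_0[OF has_wirtinger_diff[OF has_wirtinger_h w0]])
    show "continuous_on UNIV (\<lambda>z. h_hol z - - of_nat n * (cnj z)\<^sup>2 / (?t z)\<^sup>2)"
      using nz by (intro continuous_intros continuous_aux) auto
    have "1 + (norm z)\<^sup>2 \<noteq> 0" for z :: complex by (metis nz of_real_0)
    then show "continuous_on UNIV (\<lambda>z. complex_of_real (pi * real n * (norm (u z))\<^sup>2) - complex_of_real (real n * (1 / (1 + (norm z)\<^sup>2)\<^sup>2)))"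
      by (intro continuous_intros continuous_aux) auto
    \<comment> \<open>The difference is O(1/|z|^2), and the weight brings it to the integrable cubic
      rate; \<open>h\<close> alone would reach only the rate 2, which just fails.\<close>
    show "integrable lborel (\<lambda>z. norm (h z - of_nat n * cnj z / ?t z) / (1 + norm z))"
    proof (rule integrable_if_cubic_decay[where k = 3 and C = C])
      have "1 + norm z \<noteq> 0" for z :: complex by (smt (verit) norm_ge_zero)
      then show "continuous_on UNIV (\<lambda>z. norm (h z - of_nat n * cnj z / ?t z) / (1 + norm z))"
        using nz by (intro continuous_intros continuous_aux) auto
      show "norm (norm (h z - of_nat n * cnj z / ?t z) / (1 + norm z)) \<le> C / (1 + norm z) ^ 3" for z
        using divide_right_mono[OF C(2)[of z], of "1 + norm z"]
        by (simp add: power3_eq_cube power2_eq_square)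
    qed simp
    show "integrable lborel (\<lambda>z. complex_of_real (pi * real n * (norm (u z))\<^sup>2) - complex_of_real (real n * (1 / (1 + (norm z)\<^sup>2)\<^sup>2)))"
      using i1 i2 by (rule Bochner_Integration.integrable_diff)
  qed
  then have "(LINT z|lborel. complex_of_real (pi * real n * (norm (u z))\<^sup>2)) = (LINT z|lborel. complex_of_real (real n * (1 / (1 + (norm (z::complex))\<^sup>2)\<^sup>2)))"
    using i1 i2 by (subst (asm) Bochner_Integration.integral_diff) auto
  then have "complex_of_real (pi * real n * (LINT z|lborel. (norm (u z))\<^sup>2)) = complex_of_real (real n * pi)"
    by (simp only: integral_complex_of_real integral_mult_right_zero integrable_inverse_one_plus_square)
  then show ?thesis using n_real_pos by (simp only: of_real_eq_iff) simp
qed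

text \<open>Integrate \<open>dbar (u cnj \<eta>) = \<bar>\<eta>\<bar>\<^sup>2 - 2 \<pi> n \<bar>u\<bar>\<^sup>4\<close>, where \<open>u cnj \<eta>\<close> is the holomorphic derivative of \<open>\<bar>u\<bar>\<^sup>2\<close>.\<close>

lemma kinetic_energy: "(LINT z|lborel. (norm (\<eta> z))\<^sup>2) = 2 * pi * real n * (LINT z|lborel. (norm (u z)) ^ 4)"
proof -
  let ?b = "\<lambda>z. complex_of_real ((norm (\<eta> z))\<^sup>2 - 2 * pi * real n * norm (u z) ^ 4)"
  have w: "has_wirtinger (\<lambda>z. u z * cnj (\<eta> z)) ((- h z * u z) * cnj (\<eta> z) + u z * cnj (\<eta>_dbar z)) (?b z) z" for z
  proof (rule has_wirtinger_cong[OF has_wirtinger_mult[OF has_wirtinger_u has_wirtinger_cnj[OF has_wirtinger_\<eta>]]])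
    have n4: "complex_of_real (norm (u z) ^ 4) = (u z * cnj (u z)) * complex_of_real ((norm (u z))\<^sup>2)"
      unfolding complex_norm_square[symmetric] by (simp add: power2_eq_square power4_eq_xxxx)
    \<comment> \<open>The dbar derivative of \<open>u\<close> enters as
      \<open>u_dbar * cnj \<eta>\<close>, and the conjugated \<open>z\<close>-derivative of
      \<open>\<eta>\<close> contributes \<open>- u * cnj h * cnj \<eta>\<close>. By definition of
      \<open>\<eta>\<close> the two combine to \<open>|\<eta>|^2\<close>.\<close>
    have "?b z = \<eta> z * cnj (\<eta> z) - 2 * complex_of_real (pi * real n * (norm (u z))\<^sup>2) * (u z * cnj (u z))"
      unfolding of_real_diff complex_norm_square[of "\<eta> z"] of_real_mult n4 by (simp add: mult_ac)
    then show "u_dbar z * cnj (\<eta> z) + u z * cnj (- 2 * u z * complex_of_real (pi * real n * (norm (u z))\<^sup>2) - h z * \<eta> z) = ?b z"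
      by (simp add: \<eta>_def[of z] algebra_simps del: of_real_mult of_real_power)
  qed simp
  obtain U where U: "U \<ge> 0" "\<And>z. norm (u z) \<le> U / (1 + norm z) ^ 2"
    by (rule u_decay) (rule that)
  obtain E where E: "E \<ge> 0" "\<And>z. norm (\<eta> z) \<le> E / (1 + norm z) ^ 3"
    by (rule \<eta>_decay) (rule that)
  have i: "integrable lborel (\<lambda>z. (norm (\<eta> z))\<^sup>2 - 2 * pi * real n * norm (u z) ^ 4)"
    by (intro Bochner_Integration.integrable_diff integrable_mult_right integrable_\<eta>2 integrable_u4)
  have "(LINT z|lborel. ?b z) = 0"
  proof (rule integral_dbar_eq_0[OF w])
    show "continuous_on UNIV (\<lambda>z. - h z * u z * cnj (\<eta> z) + u z * cnj (\<eta>_dbar z))" "continuous_on UNIV ?b"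
      by (intro continuous_intros continuous_aux)+
    show "integrable lborel ?b" using i by (rule integrable_of_real)
    show "integrable lborel (\<lambda>z. norm (u z * cnj (\<eta> z)) / (1 + norm z))"
    proof (rule Bochner_Integration.integrable_bound[OF integrable_norm_mult[OF _ _ U(1) _ U(2) E(2)]])
      have "1 + norm z \<noteq> 0" for z :: complex by (smt (verit) norm_ge_zero)
      then have "continuous_on UNIV (\<lambda>z. norm (u z * cnj (\<eta> z)) / (1 + norm z))"
        by (intro continuous_intros continuous_aux) auto
      then show "(\<lambda>z. norm (u z * cnj (\<eta> z)) / (1 + norm z)) \<in> borel_measurable lborel"
        by (auto intro: borel_measurable_continuous_onI)
      have "norm (u z) * norm (\<eta> z) / (1 + norm z) \<le> norm (u z) * norm (\<eta> z) / 1" for z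
        by (intro divide_left_mono) (auto simp: add_pos_nonneg)
      then show "AE z in lborel. norm (norm (u z * cnj (\<eta> z)) / (1 + norm z)) \<le> norm (norm (u z) * norm (\<eta> z))"
        by (intro AE_I2) (simp add: norm_mult)
    qed (use continuous_aux in auto)
  qed
  then have "(LINT z|lborel. (norm (\<eta> z))\<^sup>2 - 2 * pi * real n * norm (u z) ^ 4) = 0"
    by (simp only: integral_complex_of_real of_real_eq_0_iff)
  then show ?thesis
    using integrable_\<eta>2 integrable_u4 by simp
qed

lemma vector_potential_u: "vector_potential (\<lambda>y. (norm (u y))\<^sup>2) x = \<i> * cnj (h x) / of_nat n"
proof -
  obtain H where H: "H \<ge> 0" "\<And>z. norm (h z) \<le> H / (1 + norm z)"
    by (rule h_decay) (rule that)
  obtain U where U: "U \<ge> 0" "\<And>z. norm (u z) \<le> U / (1 + norm z) ^ 2"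
    by (rule u_decay) (rule that)
  let ?C = "max H (pi * real n * (U * U))"
  have "vector_potential (\<lambda>y. (norm (u y))\<^sup>2) x = \<i> * cnj (complex_of_real (pi / (pi * real n)) * h x)"
  proof (rule vector_potential_eq[OF _ _ _ has_wirtinger_h])
    show "norm (h z) \<le> ?C / (1 + norm z)" for z
    proof -
      have "H / (1 + norm z) \<le> ?C / (1 + norm z)" by (intro divide_right_mono) auto
      with H(2)[of z] show ?thesis by linarith
    qed
    show "\<bar>pi * real n * (norm (u z))\<^sup>2\<bar> \<le> ?C / (1 + norm z) ^ 3" for z
    proof -
      have "norm (u z * u z) \<le> U * U / (1 + norm z) ^ (2 + 2)" by (rule decay_mult[OF U(1) U(2) U(2)])
      also have "\<dots> \<le> U * U / (1 + norm z) ^ 3"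
        using U(1) by (intro divide_left_mono power_increasing) (auto intro!: mult_pos_pos zero_less_power add_pos_nonneg)
      finally have "pi * real n * (norm (u z))\<^sup>2 \<le> pi * real n * (U * U / (1 + norm z) ^ 3)"
        by (intro mult_left_mono) (auto simp: norm_mult power2_eq_square)
      also have "\<dots> \<le> ?C / (1 + norm z) ^ 3"
        unfolding times_divide_eq_right by (intro divide_right_mono) auto
      finally show ?thesis by (simp add: abs_mult)
    qed
  qed (use n_real_pos H in \<open>auto intro!: continuous_intros continuous_aux simp: le_max_iff_disj\<close>)
  then show ?thesis using n_real_pos by simp
qed

section \<open>Weak and covariant derivatives of the state\<close>

lemma u_weak_derivative:
  "u \<in> H1"
  "AE x in lborel. weak_derivative 1 u x = u_dbar x - h x * u x"
  "AE x in lborel. weak_derivative \<i> u x = - \<i> * (u_dbar x + h x * u x)"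
proof -
  define u' where "u' = (\<lambda>z v. - h z * u z * v + u_dbar z * cnj v)"
  have der: "(u has_derivative u' x) (at x)" for x
    using has_wirtinger_u unfolding has_wirtinger_def u'_def .
  have cont: "continuous_on UNIV (\<lambda>x. u' x e)" for e
    unfolding u'_def by (intro continuous_intros continuous_aux)
  have si: "square_integrable (\<lambda>x. u' x e)" if "norm e = 1" for e
    unfolding square_integrable_def
  proof
    show m: "(\<lambda>x. u' x e) \<in> borel_measurable lborel"
      using cont by (auto intro: borel_measurable_continuous_onI)
    show "integrable lborel (\<lambda>x. (norm (u' x e))\<^sup>2)"
    proof (rule Bochner_Integration.integrable_bound)
      show "integrable lborel (\<lambda>x. 2 * (norm (h x * u x))\<^sup>2 + 2 * (norm (u_dbar x))\<^sup>2)"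
        by (intro Bochner_Integration.integrable_add integrable_mult_right integrable_hu2 integrable_u_dbar2)
      have "(norm (u' x e))\<^sup>2 \<le> 2 * (norm (h x * u x))\<^sup>2 + 2 * (norm (u_dbar x))\<^sup>2" for x
      proof -
        have "norm (u' x e) \<le> norm (h x * u x) + norm (u_dbar x)"
          unfolding u'_def using that by (intro norm_triangle_le) (simp add: norm_mult)
        then have "(norm (u' x e))\<^sup>2 \<le> (norm (h x * u x) + norm (u_dbar x))\<^sup>2"
          by (intro power_mono) auto
        with sum_squares_bound[of "norm (h x * u x)" "norm (u_dbar x)"] show ?thesis
          by (simp add: power2_sum)
      qed
      then show "AE x in lborel. norm ((norm (u' x e))\<^sup>2) \<le> norm (2 * (norm (h x * u x))\<^sup>2 + 2 * (norm (u_dbar x))\<^sup>2)"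
        by (intro AE_I2) simp
    qed (use m in simp)
  qed
  have su: "square_integrable u"
    using integrable_u2 continuous_aux(3) by (auto simp: square_integrable_def intro: borel_measurable_continuous_onI)
  show "u \<in> H1"
    unfolding H1_def using su si[of 1] si[of \<i>] has_weak_derivative_classical[OF der cont] by auto
  show "AE x in lborel. weak_derivative 1 u x = u_dbar x - h x * u x"
    using weak_derivative_AE_eq[OF der cont si[of 1]] by (simp add: u'_def)
  show "AE x in lborel. weak_derivative \<i> u x = - \<i> * (u_dbar x + h x * u x)"
    using weak_derivative_AE_eq[OF der cont si[of \<i>]] by (simp add: u'_def algebra_simps)
qed

text \<open>The coupling 2n cancels the \<open>1 / n\<close> of the potential: adding
  \<open>2 * \<i> * Im h\<close> turns \<open>- h\<close> into \<open>- cnj h\<close>, and the other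
  component works likewise. Both covariant derivatives then have modulus
  \<open>norm (\<eta> x)\<close>.\<close>

lemma energy_density_u:
  "AE x in lborel. energy_density (2 * real n) \<gamma> V u x =
     2 * (norm (\<eta> x))\<^sup>2 - \<gamma> * norm (u x) ^ 4 + V x * (norm (u x))\<^sup>2"
  using u_weak_derivative(2,3)
proof eventually_elim
  case (elim x)
  have A: "vector_potential (\<lambda>y. (norm (u y))\<^sup>2) x = Complex (Im (h x) / real n) (Re (h x) / real n)"
    unfolding vector_potential_u by (simp add: complex_eq_iff)
  have 1: "u_dbar x - h x * u x + \<i> * complex_of_real (2 * real n * (Im (h x) / real n)) * u x = \<eta> x"
    using n_real_pos by (simp add: \<eta>_def complex_eq_iff algebra_simps)
  have 2: "- \<i> * (u_dbar x + h x * u x) + \<i> * complex_of_real (2 * real n * (Re (h x) / real n)) * u x = - \<i> * \<eta> x"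
    using n_real_pos by (simp add: \<eta>_def complex_eq_iff algebra_simps)
  show ?case
    unfolding energy_density_def Let_def A complex.sel elim 1 2 by (simp add: norm_mult)
qed

end

section \<open>The energy of the critical states\<close>

lemma ext_integral_cong_AE:
  assumes "AE x in M. f x = g x"
  shows "ext_integral M f = ext_integral M g"
proof -
  have "(\<integral>\<^sup>+x. ennreal (f x) \<partial>M) = (\<integral>\<^sup>+x. ennreal (g x) \<partial>M)"
    "(\<integral>\<^sup>+x. ennreal (- f x) \<partial>M) = (\<integral>\<^sup>+x. ennreal (- g x) \<partial>M)"
    by (intro nn_integral_cong_AE; use assms in eventually_elim; simp)+
  then show ?thesis by (simp add: ext_integral_def)
qed

lemma ext_integral_eq_integral:
  assumes "integrable M f"
  shows "ext_integral M f = ereal (integral\<^sup>L M f)"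
proof -
  have fin: "(\<integral>\<^sup>+x. ennreal (f x) \<partial>M) < \<infinity>" "(\<integral>\<^sup>+x. ennreal (- f x) \<partial>M) < \<infinity>"
    using assms by (auto simp: real_integrable_def top.not_eq_extremum)
  then obtain a b where ab: "(\<integral>\<^sup>+x. ennreal (f x) \<partial>M) = ennreal a" "a \<ge> 0"
      "(\<integral>\<^sup>+x. ennreal (- f x) \<partial>M) = ennreal b" "b \<ge> 0"
    by (metis ennreal_cases infinity_ennreal_def less_irrefl)
  then show ?thesis
    using assms by (simp add: ext_integral_def real_lebesgue_integral_def)
qed

lemma ext_integral_eq_infinity:
  fixes f :: "'a \<Rightarrow> real"
  assumes "f \<in> borel_measurable M" "(\<integral>\<^sup>+x. ennreal (- f x) \<partial>M) < \<infinity>" "\<not> integrable M f"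
  shows "ext_integral M f = \<infinity>"
proof -
  have "(\<integral>\<^sup>+x. ennreal (f x) \<partial>M) = \<infinity>"
    using assms by (auto simp: real_integrable_def)
  moreover obtain b where "(\<integral>\<^sup>+x. ennreal (- f x) \<partial>M) = ennreal b" "b \<ge> 0"
    using assms(2) by (metis ennreal_cases infinity_ennreal_def less_irrefl)
  ultimately show ?thesis by (simp add: ext_integral_def)
qed

text \<open>If \<open>v\<close> is not integrable, neither is the sum; both negative parts being
  finite, both sides are then infinite. This allows potentials with no upper bound.\<close>

lemma ext_integral_add:
  fixes a v :: "'a \<Rightarrow> real"
  assumes a: "integrable M a" and v: "v \<in> borel_measurable M" "(\<integral>\<^sup>+x. ennreal (- v x) \<partial>M) < \<infinity>"
  shows "ext_integral M (\<lambda>x. a x + v x) = ereal (integral\<^sup>L M a) + ext_integral M v"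
proof (cases "integrable M v")
  case True
  with a show ?thesis by (simp add: ext_integral_eq_integral)
next
  case False
  have [measurable]: "a \<in> borel_measurable M" using a by auto
  have ni: "\<not> integrable M (\<lambda>x. a x + v x)"
    using a False Bochner_Integration.integrable_diff[of M "\<lambda>x. a x + v x" a] by auto
  have "(\<integral>\<^sup>+x. ennreal (- (a x + v x)) \<partial>M) \<le> (\<integral>\<^sup>+x. ennreal (- a x) + ennreal (- v x) \<partial>M)"
  proof (rule nn_integral_mono)
    fix x
    have "ennreal (- (a x + v x)) \<le> ennreal (max 0 (- a x) + max 0 (- v x))"
      by (intro ennreal_leI) auto
    also have "\<dots> = ennreal (max 0 (- a x)) + ennreal (max 0 (- v x))"
      by (rule ennreal_plus) auto
    finally show "ennreal (- (a x + v x)) \<le> ennreal (- a x) + ennreal (- v x)"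
      by (simp add: ennreal_max_0 max.commute)
  qed
  also have "\<dots> = (\<integral>\<^sup>+x. ennreal (- a x) \<partial>M) + (\<integral>\<^sup>+x. ennreal (- v x) \<partial>M)"
    using v by (intro nn_integral_add) auto
  also have "\<dots> < \<infinity>"
    using v a by (auto simp: real_integrable_def top.not_eq_extremum)
  finally have "ext_integral M (\<lambda>x. a x + v x) = \<infinity>"
    using v ni by (intro ext_integral_eq_infinity) auto
  then show ?thesis
    using v False by (simp add: ext_integral_eq_infinity)
qed

lemma smooth_imp_borel_measurable:
  assumes "smooth (V :: complex \<Rightarrow> real)"
  shows "V \<in> borel_measurable borel"
proof -
  have "C_k 0 V" using assms by (simp add: smooth_def del: C_k.simps)
  then show ?thesis by (auto intro: borel_measurable_continuous_onI)
qed

context polynomial_pair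
begin

context
  fixes V :: "complex \<Rightarrow> real" and \<gamma> :: real
  assumes V: "smooth V" "bdd_below (range V)"
begin

lemma potential_measurable [measurable]: "(\<lambda>x. V x * (norm (u x))\<^sup>2) \<in> borel_measurable lborel"
proof -
  have [measurable]: "V \<in> borel_measurable borel" "u \<in> borel_measurable borel"
    using V smooth_imp_borel_measurable continuous_aux(3)
    by (auto intro: borel_measurable_continuous_onI)
  show ?thesis by simp
qed

lemma potential_negative_part: "(\<integral>\<^sup>+x. ennreal (- (V x * (norm (u x))\<^sup>2)) \<partial>lborel) < \<infinity>"
proof -
  obtain C where C: "\<And>x. C \<le> V x" using V(2) by (auto simp: bdd_below_def)
  have "(\<integral>\<^sup>+x. ennreal (- (V x * (norm (u x))\<^sup>2)) \<partial>lborel) \<le> (\<integral>\<^sup>+x. ennreal (norm (\<bar>C\<bar> * (norm (u x))\<^sup>2)) \<partial>lborel)"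
  proof (intro nn_integral_mono ennreal_leI)
    fix x
    have "- V x * (norm (u x))\<^sup>2 \<le> \<bar>C\<bar> * (norm (u x))\<^sup>2"
      using C[of x] by (intro mult_right_mono) auto
    then show "- (V x * (norm (u x))\<^sup>2) \<le> norm (\<bar>C\<bar> * (norm (u x))\<^sup>2)" by simp
  qed
  also have "\<dots> < \<infinity>"
    using integrable_mult_right[OF integrable_u2, of "\<bar>C\<bar>"] unfolding integrable_iff_bounded by blast
  finally show ?thesis .
qed

lemma energy_u:
  "energy (2 * real n) \<gamma> V u =
     ereal ((4 * pi * real n - \<gamma>) * (LINT x|lborel. norm (u x) ^ 4)) + ext_integral lborel (\<lambda>x. V x * (norm (u x))\<^sup>2)"
proof -
  have "energy (2 * real n) \<gamma> V u =
      ext_integral lborel (\<lambda>x. (2 * (norm (\<eta> x))\<^sup>2 - \<gamma> * norm (u x) ^ 4) + V x * (norm (u x))\<^sup>2)"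
    unfolding energy_def by (rule ext_integral_cong_AE[OF energy_density_u])
  also have "\<dots> = ereal (LINT x|lborel. 2 * (norm (\<eta> x))\<^sup>2 - \<gamma> * norm (u x) ^ 4) + ext_integral lborel (\<lambda>x. V x * (norm (u x))\<^sup>2)"
    by (intro ext_integral_add potential_negative_part potential_measurable
        Bochner_Integration.integrable_diff integrable_mult_right integrable_\<eta>2 integrable_u4)
  also have "(LINT x|lborel. 2 * (norm (\<eta> x))\<^sup>2 - \<gamma> * norm (u x) ^ 4) = (4 * pi * real n - \<gamma>) * (LINT x|lborel. norm (u x) ^ 4)"
    using integrable_\<eta>2 integrable_u4 by (simp add: kinetic_energy left_diff_distrib)
  finally show ?thesis .
qed

lemma energy_u_eq:
  "energy (2 * real n) \<gamma> V u =
     ext_integral lborel (\<lambda>z.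
          (4 * pi * real n - \<gamma>) * (1 / (pi\<^sup>2 * (real n)\<^sup>2)) *
            ((norm (poly W z)) ^ 4 / ((norm (poly P z))\<^sup>2 + (norm (poly Q z))\<^sup>2) ^ 4)
          + V z * (1 / (pi * real n)) *
            ((norm (poly W z))\<^sup>2 / ((norm (poly P z))\<^sup>2 + (norm (poly Q z))\<^sup>2)\<^sup>2))"
proof -
  have "energy (2 * real n) \<gamma> V u =
      ext_integral lborel (\<lambda>x. (4 * pi * real n - \<gamma>) * norm (u x) ^ 4 + V x * (norm (u x))\<^sup>2)"
    unfolding energy_u
    by (subst ext_integral_add)
       (simp_all add: potential_negative_part integrable_u4 del: infinity_ennreal_def)
  also have "(\<lambda>x. (4 * pi * real n - \<gamma>) * norm (u x) ^ 4 + V x * (norm (u x))\<^sup>2) = (\<lambda>z.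
          (4 * pi * real n - \<gamma>) * (1 / (pi\<^sup>2 * (real n)\<^sup>2)) *
            ((norm (poly W z)) ^ 4 / ((norm (poly P z))\<^sup>2 + (norm (poly Q z))\<^sup>2) ^ 4)
          + V z * (1 / (pi * real n)) *
            ((norm (poly W z))\<^sup>2 / ((norm (poly P z))\<^sup>2 + (norm (poly Q z))\<^sup>2)\<^sup>2))"
    unfolding norm_u_power2 norm_u_power4 s_def by (simp only: mult.assoc)
  finally show ?thesis .
qed

text \<open>If the potential term is integrable, then so is its absolute value and \<open>u\<close>
  is admissible. Otherwise only its positive part can diverge, and the right-hand side is
  infinite.\<close>

lemma ground_energy_le: "ground_energy (2 * real n) \<gamma> V \<le> energy (2 * real n) \<gamma> V u"
proof (cases "integrable lborel (\<lambda>x. V x * (norm (u x))\<^sup>2)")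
  case True
  then have "integrable lborel (\<lambda>x. \<bar>V x\<bar> * (norm (u x))\<^sup>2)"
    using integrable_abs[OF True] by (simp add: abs_mult)
  then show ?thesis
    unfolding ground_energy_def using mass u_weak_derivative(1) by (intro INF_lower) auto
next
  case False
  then have "energy (2 * real n) \<gamma> V u = \<infinity>"
    unfolding energy_u
    using ext_integral_eq_infinity[OF potential_measurable potential_negative_part False] by simp
  then show ?thesis by simp
qed

end

end

section \<open>Normalisation\<close>

text \<open>A relation with \<open>a\<close> nonzero makes \<open>P\<close> a multiple of
  \<open>Q\<close>; then \<open>Q\<close> divides both polynomials, so it is constant, and so is
  \<open>P\<close>, against the degree condition.\<close>

lemma coprime_imp_lin_indep:
  fixes P Q :: "complex poly"
  assumes "coprime P Q" "max (degree P) (degree Q) \<ge> 1"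
  shows "lin_indep P Q"
proof -
  have aux: "a = 0" if "coprime P Q" "max (degree P) (degree Q) \<ge> 1" "smult a P + smult b Q = 0"
    for a b :: complex and P Q :: "complex poly"
  proof (rule ccontr)
    assume "a \<noteq> 0"
    have "P = smult (1 / a) (smult a P)" using \<open>a \<noteq> 0\<close> by simp
    also have "smult a P = - smult b Q" using that(3) by (simp add: eq_neg_iff_add_eq_0)
    finally have P: "P = smult (- b / a) Q" by simp
    then have "Q dvd P" by (metis dvd_refl dvd_smult)
    with that(1) have "Q dvd 1" by (auto simp: coprime_def)
    then have "degree Q = 0" using dvd_imp_degree_le[of Q 1] by simp
    with P that(2) show False by (metis degree_smult_eq max_def not_one_le_zero)
  qed
  show ?thesis unfolding lin_indep_def
  proof (intro allI impI)
    fix a b assume "smult a P + smult b Q = 0"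
    moreover from this have "smult b Q + smult a P = 0" by (simp add: add.commute)
    moreover have "coprime Q P" "max (degree Q) (degree P) \<ge> 1"
      using assms by (simp_all add: coprime_commute max.commute)
    ultimately show "a = 0 \<and> b = 0" using aux assms by blast
  qed
qed

lemma coprime_pairs_eq:
  assumes "n \<ge> 1"
  shows "(P, Q) \<in> coprime_pairs n \<longleftrightarrow> coprime P Q \<and> max (degree P) (degree Q) = n"
  using assms coprime_imp_lin_indep by (auto simp: coprime_pairs_def)

lemma normalized_pairs_subset:
  assumes "n \<ge> 1"
  shows "normalized_pairs n \<subseteq> coprime_pairs n"
  using coprime_pairs_eq[OF assms] by (auto simp: normalized_pairs_def)

text \<open>A unitary change of the pair removes the \<open>n\<close>-th coefficient of \<open>Q\<close>; scaling the pair and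
  rotating the phase of \<open>P\<close> then normalise the leading coefficients.\<close>

lemma exists_normalized_pair:
  assumes n: "n \<ge> 1" and PQ: "(P, Q) \<in> coprime_pairs n"
  obtains P' Q' and k :: real where "(P', Q') \<in> normalized_pairs n" "k > 0"
    "\<And>z. norm (poly (wronskian P' Q') z) = k * norm (poly (wronskian P Q) z)"
    "\<And>z. (norm (poly P' z))\<^sup>2 + (norm (poly Q' z))\<^sup>2 = k * ((norm (poly P z))\<^sup>2 + (norm (poly Q z))\<^sup>2)"
proof -
  from PQ have cop: "coprime P Q" and li: "lin_indep P Q" and deg: "max (degree P) (degree Q) = n"
    by (auto simp: coprime_pairs_def)
  define p q where "p = coeff P n" and "q = coeff Q n"
  define r where "r = (norm p)\<^sup>2 + (norm q)\<^sup>2"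
  have pq0: "p \<noteq> 0 \<or> q \<noteq> 0"
    using deg n unfolding p_def q_def by (metis degree_0 leading_coeff_0_iff max_def not_one_le_zero)
  then have r: "r > 0" by (auto simp: r_def add_pos_nonneg add_nonneg_pos)
  have rr: "complex_of_real r = p * cnj p + q * cnj q"
    by (simp add: r_def complex_norm_square del: of_real_power)
  \<comment> \<open>The coefficient matrix is \<open>sqrt r\<close> times a unitary one: it
    multiplies \<open>|P|^2 + |Q|^2\<close> by \<open>r\<close> and, having determinant
    \<open>r\<close>, the Wronskian by \<open>r\<close> as well.\<close>
  define P1 where "P1 = smult (cnj p) P + smult (cnj q) Q"
  define Q1 where "Q1 = smult p Q - smult q P"
  have "Q1 \<noteq> 0"
  proof
    assume "Q1 = 0"
    then have "smult (- q) P + smult p Q = 0" by (simp add: Q1_def)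
    with li pq0 show False unfolding lin_indep_def by (metis neg_equal_0_iff_equal)
  qed
  define l where "l = lead_coeff Q1"
  have l: "l \<noteq> 0" using \<open>Q1 \<noteq> 0\<close> by (simp add: l_def)
  \<comment> \<open>Dividing \<open>Q1\<close> by \<open>l\<close> makes it monic; dividing
    \<open>P1\<close> by \<open>norm l\<close> keeps its leading coefficient positive. The divisors
    have equal modulus, so the sum of squares scales by a single factor.\<close>
  define P2 where "P2 = smult (1 / complex_of_real (norm l)) P1"
  define Q2 where "Q2 = smult (1 / l) Q1"
  have cP1: "coeff P1 n = complex_of_real r" by (simp add: P1_def p_def[symmetric] q_def[symmetric] rr mult.commute)
  have dP1: "degree P1 \<le> n" "degree Q1 \<le> n"
    using deg by (auto simp: P1_def Q1_def intro!: degree_add_le degree_diff_le order.trans[OF degree_smult_le])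
  have "coeff Q1 n = 0" by (simp add: Q1_def p_def[symmetric] q_def[symmetric])
  with \<open>Q1 \<noteq> 0\<close> dP1 have dQ1: "degree Q1 < n" by (metis leading_coeff_0_iff order_le_less)
  have dP1n: "degree P1 = n" using cP1 r dP1(1) by (metis le_antisym le_degree less_irrefl of_real_eq_0_iff)
  have inv: "smult (complex_of_real r) P = smult p P1 - smult (cnj q) Q1"
    "smult (complex_of_real r) Q = smult q P1 + smult (cnj p) Q1"
    unfolding P1_def Q1_def rr
    by (simp_all add: smult_add_right smult_diff_right smult_add_left mult.commute)
  have cop1: "coprime P1 Q1"
  proof (rule coprimeI)
    fix d assume "d dvd P1" "d dvd Q1"
    then have "d dvd smult (complex_of_real r) P" "d dvd smult (complex_of_real r) Q"
      unfolding inv by (auto intro: dvd_add dvd_diff dvd_smult)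
    then have "d dvd P" "d dvd Q" using r by (auto dest: dvd_smult_cancel)
    with cop show "is_unit d" by (auto simp: coprime_def)
  qed
  have nl: "norm l > 0" using l by simp
  have cop2: "coprime P2 Q2"
    using cop1 l unfolding P2_def Q2_def coprime_def by (simp add: dvd_smult_iff)
  have n1: "(norm (poly P1 z))\<^sup>2 + (norm (poly Q1 z))\<^sup>2 = r * ((norm (poly P z))\<^sup>2 + (norm (poly Q z))\<^sup>2)" for z
  proof -
    have "complex_of_real ((norm (poly P1 z))\<^sup>2 + (norm (poly Q1 z))\<^sup>2) =
        complex_of_real (r * ((norm (poly P z))\<^sup>2 + (norm (poly Q z))\<^sup>2))"
      unfolding of_real_add of_real_mult rr complex_norm_square P1_def Q1_def
      by (simp add: algebra_simps)
    then show ?thesis by (simp only: of_real_eq_iff)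
  qed
  have W1: "wronskian P1 Q1 = smult (complex_of_real r) (wronskian P Q)"
    unfolding wronskian_def P1_def Q1_def rr
    by (simp add: pderiv_add pderiv_diff pderiv_smult algebra_simps smult_add_left smult_add_right smult_diff_right)
  have W2: "wronskian P2 Q2 = smult (1 / (complex_of_real (norm l) * l)) (wronskian P1 Q1)"
    by (simp add: wronskian_def P2_def Q2_def pderiv_smult smult_diff_right mult.commute)
  show ?thesis
  proof
    show "(P2, Q2) \<in> normalized_pairs n"
      unfolding normalized_pairs_def
    proof (clarsimp, intro conjI)
      show "coprime P2 Q2" by (rule cop2)
      have "lead_coeff P2 = complex_of_real (r / norm l)"
        using dP1n cP1 nl by (simp add: P2_def)
      then show "\<exists>a>0. lead_coeff P2 = complex_of_real a" using r nl by (metis divide_pos_pos)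
      show "lead_coeff Q2 = 1" using l by (simp add: Q2_def l_def)
      show "degree Q2 < degree P2" "degree P2 = n"
        using dQ1 dP1n l by (simp_all add: P2_def Q2_def)
    qed
    show "r / (norm l)\<^sup>2 > 0" using r nl by simp
    show "norm (poly (wronskian P2 Q2) z) = r / (norm l)\<^sup>2 * norm (poly (wronskian P Q) z)" for z
      using r nl by (simp add: W2 W1 norm_mult norm_divide power2_eq_square)
    show "(norm (poly P2 z))\<^sup>2 + (norm (poly Q2 z))\<^sup>2 = r / (norm l)\<^sup>2 * ((norm (poly P z))\<^sup>2 + (norm (poly Q z))\<^sup>2)" for z
    proof -
      have "(norm (poly P2 z))\<^sup>2 + (norm (poly Q2 z))\<^sup>2 = ((norm (poly P1 z))\<^sup>2 + (norm (poly Q1 z))\<^sup>2) / (norm l)\<^sup>2"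
        by (simp add: P2_def Q2_def norm_divide norm_mult power_divide power_mult_distrib add_divide_distrib)
      then show ?thesis unfolding n1 by simp
    qed
  qed
qed

section \<open>Dimension of spaces of polynomial pairs\<close>

lemma Euclidean_space_eq_top_of_set: "Euclidean_space d = top_of_set {x. \<forall>i\<ge>d. x i = 0}"
  by (simp add: Euclidean_space_def euclidean_product_topology)

text \<open>By invariance of domain, a continuous injection into a space of smaller dimension would have an
  open image inside a hyperplane.\<close>

lemma not_contains_patch:
  assumes f: "continuous_map X (Euclidean_space d) f" "inj_on f (topspace X)" and "d < d'"
  shows "\<not> contains_patch X d'"
proof
  assume "contains_patch X d'"
  then obtain U W k k' where U: "U \<subseteq> topspace X" and W: "openin (Euclidean_space d') W" "W \<noteq> {}"
    and hm: "homeomorphic_maps (subtopology X U) (subtopology (Euclidean_space d') W) k k'"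
    by (auto simp: contains_patch_def homeomorphic_space_def)
  have WE: "W \<subseteq> topspace (Euclidean_space d')" using W(1) by (rule openin_subset)
  have k': "continuous_map (subtopology (Euclidean_space d') W) (subtopology X U) k'"
    and kk': "\<And>y. y \<in> W \<Longrightarrow> k (k' y) = y"
    using hm WE by (auto simp: homeomorphic_maps_def)
  have k'U: "k' y \<in> topspace X" if "y \<in> W" for y
    using continuous_map_image_subset_topspace[OF k'] that WE U by auto
  let ?F = "f \<circ> k'"
  have sub: "topspace (Euclidean_space d) \<subseteq> topspace (Euclidean_space d')"
    using \<open>d < d'\<close> by (auto simp: Euclidean_space_eq_top_of_set)
  have cF: "continuous_map (subtopology (Euclidean_space d') W) (Euclidean_space d) ?F"
    using continuous_map_compose[OF continuous_map_into_fulltopology[OF k'] f(1)] .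
  then have "continuous_map (subtopology (Euclidean_space d') W) (Euclidean_space d') ?F"
    using sub unfolding Euclidean_space_eq_top_of_set by (auto simp: continuous_map_in_subtopology)
  moreover have "inj_on ?F W"
    using f(2) k'U kk' by (auto simp: inj_on_def) metis
  ultimately have op: "openin (Euclidean_space d') (?F ` W)"
    using invariance_of_domain_Euclidean_space W(1) by blast
  obtain y where y: "y \<in> ?F ` W" using W(2) by blast
  have im: "?F ` W \<subseteq> topspace (Euclidean_space d)"
    using continuous_map_image_subset_topspace[OF cF] WE by (simp add: Int_absorb1)
  then have yd: "x d = 0" if "x \<in> ?F ` W" for x
    using that by (auto simp: Euclidean_space_eq_top_of_set)
  obtain T where T: "open T" "?F ` W = {x. \<forall>i\<ge>d'. x i = 0} \<inter> T"
    using op unfolding Euclidean_space_eq_top_of_set by (auto simp: openin_open)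
  \<comment> \<open>Coordinate \<open>d\<close> is free in the larger space because
    \<open>d < d'\<close>, so an open image would allow an interval of its values; yet it is 0 on
    the whole image.\<close>
  have "continuous_on UNIV (\<lambda>t::real. y(d := t))"
  proof (rule continuous_on_coordinatewise_then_product)
    show "continuous_on UNIV (\<lambda>t::real. (y(d := t)) i)" for i
      by (cases "i = d") auto
  qed
  then have "open ((\<lambda>t. y(d := t)) -` T)" using T(1) by (intro open_vimage)
  moreover have "(\<lambda>t. y(d := t)) -` T = {0}"
  proof safe
    fix t assume "y(d := t) \<in> T"
    moreover have "y(d := t) \<in> {x. \<forall>i\<ge>d'. x i = 0}"
      using y T(2) \<open>d < d'\<close> by auto
    ultimately have "y(d := t) \<in> ?F ` W" using T(2) by blast
    from yd[OF this] show "t = 0" by simp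
  next
    have "y(d := 0) = y" using yd[OF y] by (metis fun_upd_triv)
    then show "0 \<in> (\<lambda>t. y(d := t)) -` T" using y T(2) by auto
  qed
  ultimately show False using not_open_singleton[of "0::real"] by simp
qed

text \<open>One map serves both bounds: its injectivity on all of \<open>S\<close> excludes larger
  patches, and its continuous right inverse on \<open>W\<close> exhibits a patch of dimension
  \<open>d\<close>.\<close>

lemma has_dimension_pair_space:
  fixes \<Phi> :: "(nat \<Rightarrow> complex) \<times> (nat \<Rightarrow> complex) \<Rightarrow> nat \<Rightarrow> real"
  assumes \<Phi>: "continuous_on UNIV \<Phi>" "\<And>c i. i \<ge> d \<Longrightarrow> \<Phi> c i = 0"
    and inj: "inj_on (\<lambda>(P, Q). \<Phi> (coeff P, coeff Q)) S"
    and W: "openin (Euclidean_space d) W" "W \<noteq> {}"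
    and \<Psi>: "\<And>i. continuous_on W (\<lambda>x. coeff (p x) i)" "\<And>i. continuous_on W (\<lambda>x. coeff (q x) i)"
    and \<Phi>\<Psi>: "\<And>x. x \<in> W \<Longrightarrow> \<Phi> (coeff (p x), coeff (q x)) = x"
    and WS: "\<And>x. x \<in> W \<Longrightarrow> (p x, q x) \<in> S"
  shows "has_dimension (pair_space S) d"
proof -
  let ?c = "\<lambda>(P, Q). (coeff P, coeff Q) :: (nat \<Rightarrow> complex) \<times> (nat \<Rightarrow> complex)"
  have top: "topspace (pair_space S) = S"
    by (simp add: pair_space_def topspace_pullback_topology)
  have c: "continuous_map (pair_space S) (Euclidean_space d) (\<Phi> \<circ> ?c)"
    unfolding pair_space_def
    by (rule continuous_map_pullback)
       (use \<Phi> in \<open>auto simp: Euclidean_space_eq_top_of_set continuous_map_in_subtopology\<close>)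
  have eq: "\<Phi> \<circ> ?c = (\<lambda>(P, Q). \<Phi> (coeff P, coeff Q))" by auto
  have WE: "W \<subseteq> topspace (Euclidean_space d)" using W(1) by (rule openin_subset)
  let ?\<psi> = "\<lambda>x. (p x, q x)"
  have sW: "subtopology (Euclidean_space d) W = top_of_set W"
    using WE by (simp add: Euclidean_space_eq_top_of_set subtopology_subtopology Int_absorb1)
  have "homeomorphic_maps (subtopology (pair_space S) (?\<psi> ` W)) (subtopology (Euclidean_space d) W) (\<Phi> \<circ> ?c) ?\<psi>"
    unfolding homeomorphic_maps_def
  proof (intro conjI)
    show "continuous_map (subtopology (pair_space S) (?\<psi> ` W)) (subtopology (Euclidean_space d) W) (\<Phi> \<circ> ?c)"
      using continuous_map_from_subtopology[OF c] \<Phi>\<Psi> by (auto simp: continuous_map_in_subtopology)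
    have "continuous_on W (\<lambda>x. (coeff (p x), coeff (q x)))"
      by (intro continuous_on_Pair continuous_on_coordinatewise_then_product \<Psi>)
    then have "continuous_map (top_of_set W) (pair_space S) ?\<psi>"
      unfolding pair_space_def using WS by (intro continuous_map_pullback') (auto simp: comp_def)
    then show "continuous_map (subtopology (Euclidean_space d) W) (subtopology (pair_space S) (?\<psi> ` W)) ?\<psi>"
      unfolding sW by (auto simp: continuous_map_in_subtopology)
  qed (use \<Phi>\<Psi> in \<open>auto simp: top\<close>)
  then have "subtopology (pair_space S) (?\<psi> ` W) homeomorphic_space subtopology (Euclidean_space d) W"
    unfolding homeomorphic_space_def by blast
  moreover have "?\<psi> ` W \<subseteq> topspace (pair_space S)" using WS by (auto simp: top)
  ultimately have "contains_patch (pair_space S) d"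
    using W unfolding contains_patch_def by blast
  moreover have "\<not> contains_patch (pair_space S) d'" if "d' > d" for d'
    by (rule not_contains_patch[OF c _ that]) (use inj in \<open>simp add: top eq\<close>)
  ultimately show ?thesis by (simp add: has_dimension_def)
qed

section \<open>Coprime pairs with an open set of coefficients\<close>

lemma coprime_if_no_common_root:
  fixes P Q :: "complex poly"
  assumes "\<And>z. poly P z = 0 \<Longrightarrow> poly Q z \<noteq> 0"
  shows "coprime P Q"
proof (rule coprimeI)
  fix d assume d: "d dvd P" "d dvd Q"
  show "is_unit d"
  proof (rule ccontr)
    assume "\<not> is_unit d"
    moreover have "d \<noteq> 0" using d assms[of 0] by auto
    ultimately have "degree d \<noteq> 0" by (simp add: is_unit_iff_degree)
    then obtain z where "poly d z = 0"
      using fundamental_theorem_of_algebra[of d] by (auto simp: constant_degree)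
    with d have "poly P z = 0" "poly Q z = 0" by (auto elim!: dvdE)
    with assms show False by blast
  qed
qed

text \<open>The roots of \<open>Q\<close> lie inside the unit disc, those of \<open>P\<close> outside.\<close>

definition dominated :: "nat \<Rightarrow> nat \<Rightarrow> complex poly \<Rightarrow> complex poly \<Rightarrow> bool" where
  "dominated l m P Q \<longleftrightarrow> (\<Sum>i=1..l. norm (coeff P i)) < norm (coeff P 0) \<and> (\<Sum>i<m. norm (coeff Q i)) < norm (coeff Q m)"

text \<open>An explicit inequality takes the place of a nonzero resultant: it excludes common roots,
  is open in the coefficients and is easy to satisfy. A root in the closed unit disc contradicts the
  dominant constant term of \<open>P\<close>, one outside it the dominant top term of
  \<open>Q\<close>.\<close>

lemma dominated_imp_coprime:
  assumes "degree P \<le> l" "degree Q \<le> m" "dominated l m P Q"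
  shows "coprime P Q"
proof (rule coprime_if_no_common_root, rule notI)
  fix z assume z: "poly P z = 0" "poly Q z = 0"
  show False
  proof (cases "norm z \<le> 1")
    case True
    have "{..l} = insert 0 {1..l}" by auto
    then have "0 = coeff P 0 + (\<Sum>i=1..l. coeff P i * z ^ i)"
      using z(1) poly_eq_sum_coeff[OF assms(1)] by simp
    then have "norm (coeff P 0) = norm (\<Sum>i=1..l. coeff P i * z ^ i)"
      by (metis add.inverse_unique norm_minus_cancel)
    also have "\<dots> \<le> (\<Sum>i=1..l. norm (coeff P i))"
      using True by (intro sum_norm_le) (simp add: norm_mult norm_power mult_left_le power_le_one)
    finally show False using assms(3) by (simp add: dominated_def)
  next
    case False
    then have z1: "norm z > 1" by simp
    have "{..m} = insert m {..<m}" by auto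
    then have "0 = coeff Q m * z ^ m + (\<Sum>i<m. coeff Q i * z ^ i)"
      using z(2) poly_eq_sum_coeff[OF assms(2)] by simp
    then have "norm (coeff Q m) * norm z ^ m = norm (\<Sum>i<m. coeff Q i * z ^ i)"
      by (metis add.inverse_unique norm_minus_cancel norm_mult norm_power)
    also have "\<dots> \<le> (\<Sum>i<m. norm (coeff Q i) * norm z ^ m)"
      using z1 by (intro sum_norm_le) (auto simp: norm_mult norm_power intro!: mult_left_mono power_increasing)
    also have "\<dots> = (\<Sum>i<m. norm (coeff Q i)) * norm z ^ m" by (simp add: sum_distrib_right)
    finally have le: "norm (coeff Q m) * norm z ^ m \<le> (\<Sum>i<m. norm (coeff Q i)) * norm z ^ m" .
    have "norm z ^ m > 0" using z1 by (intro zero_less_power) linarith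
    with le have "norm (coeff Q m) \<le> (\<Sum>i<m. norm (coeff Q i))"
      by (simp only: mult_le_cancel_right_pos)
    then show False using assms(3) by (simp add: dominated_def)
  qed
qed

lemma openin_dominated:
  assumes "\<And>i. continuous_on E (\<lambda>x. coeff (p x) i)" "\<And>i. continuous_on E (\<lambda>x. coeff (q x) i)"
  shows "openin (top_of_set E) {x \<in> E. dominated l m (p x) (q x)}"
proof -
  have lt: "openin (top_of_set E) {x \<in> E. f x < g x}" if "continuous_on E f" "continuous_on E g"
    for f g :: "_ \<Rightarrow> real"
  proof -
    have "{x \<in> E. f x < g x} = E \<inter> (\<lambda>x. g x - f x) -` {0<..}" by auto
    then show ?thesis
      using continuous_openin_preimage_gen[OF continuous_on_diff[OF that(2,1)] open_greaterThan] by simp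
  qed
  have "{x \<in> E. dominated l m (p x) (q x)} =
      {x \<in> E. (\<Sum>i=1..l. norm (coeff (p x) i)) < norm (coeff (p x) 0)} \<inter>
      {x \<in> E. (\<Sum>i<m. norm (coeff (q x) i)) < norm (coeff (q x) m)}"
    by (auto simp: dominated_def)
  then show ?thesis
    by (simp only:) (intro openin_Int lt continuous_intros assms)
qed

section \<open>Real coordinates on polynomial pairs\<close>

definition poly_of :: "nat \<Rightarrow> (nat \<Rightarrow> complex) \<Rightarrow> complex poly" where
  "poly_of k a = (\<Sum>i<k. monom (a i) i)"

lemma coeff_poly_of: "coeff (poly_of k a) i = (if i < k then a i else 0)"
  by (simp add: poly_of_def coeff_sum if_distrib cong: if_cong)

lemma degree_poly_of: "degree (poly_of (Suc k) a) \<le> k"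
  by (rule degree_le) (auto simp: coeff_poly_of)

lemma continuous_on_Complex:
  "continuous_on S f \<Longrightarrow> continuous_on S g \<Longrightarrow> continuous_on S (\<lambda>x. Complex (f x) (g x))"
  unfolding Complex_eq by (intro continuous_intros)

lemma continuous_on_coordinate: "continuous_on S (\<lambda>x :: nat \<Rightarrow> 'b::topological_space. x i)"
  by (rule continuous_on_subset[OF continuous_on_product_coordinates]) simp

lemma continuous_on_coordinate_fst: "continuous_on S (\<lambda>c :: (nat \<Rightarrow> complex) \<times> (nat \<Rightarrow> complex). fst c i)"
  and continuous_on_coordinate_snd: "continuous_on S (\<lambda>c :: (nat \<Rightarrow> complex) \<times> (nat \<Rightarrow> complex). snd c i)"
  by (rule continuous_on_compose2[OF continuous_on_coordinate[of UNIV]], intro continuous_intros, simp)+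

lemma div_mod_4:
  fixes i :: nat
  shows "(4 * i) div 4 = i" "Suc (4 * i) div 4 = i" "Suc (Suc (4 * i)) div 4 = i" "(4 * i + 3) div 4 = i"
    "(4 * i) mod 4 = 0" "Suc (4 * i) mod 4 = Suc 0" "Suc (Suc (4 * i)) mod 4 = 2" "(4 * i + 3) mod 4 = 3"
  by presburger+

lemma continuous_on_if_constant_condition:
  "continuous_on S f \<Longrightarrow> continuous_on S g \<Longrightarrow> continuous_on S (\<lambda>x. if b then f x else g x)"
  by (cases b) auto

lemma has_dimension_coprime_pairs:
  assumes n: "n \<ge> 1"
  shows "has_dimension (pair_space (coprime_pairs n)) (4 * (n + 1))"
proof -
  let ?d = "4 * (n + 1)"
  define E where "E = {x :: nat \<Rightarrow> real. \<forall>i\<ge>?d. x i = 0}"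
  \<comment> \<open>The slots \<open>4 * i\<close> to \<open>4 * i + 3\<close> hold the real and
    imaginary parts of the \<open>i\<close>-th coefficients of \<open>P\<close> and
    \<open>Q\<close>, for \<open>i <= n\<close>.\<close>
  define \<Phi> where "\<Phi> = (\<lambda>(c :: (nat \<Rightarrow> complex) \<times> (nat \<Rightarrow> complex)) k. if k \<ge> ?d then 0
     else if k mod 4 = 0 then Re (fst c (k div 4)) else if k mod 4 = 1 then Im (fst c (k div 4))
     else if k mod 4 = 2 then Re (snd c (k div 4)) else Im (snd c (k div 4)))"
  define p where "p = (\<lambda>x. poly_of (Suc n) (\<lambda>i. Complex (x (4 * i)) (x (4 * i + 1))))"
  define q where "q = (\<lambda>x. poly_of (Suc n) (\<lambda>i. Complex (x (4 * i + 2)) (x (4 * i + 3))))"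
  define W where "W = {x \<in> E. dominated n n (p x) (q x)}"
  have cpq: "continuous_on S (\<lambda>x. coeff (p x) i)" "continuous_on S (\<lambda>x. coeff (q x) i)" for S i
    unfolding p_def q_def coeff_poly_of
    by (cases "i < Suc n"; simp add: continuous_on_Complex continuous_on_coordinate)+
  have deg: "degree (p x) \<le> n" "degree (q x) \<le> n" for x
    unfolding p_def q_def by (rule degree_poly_of)+
  show ?thesis
  proof (rule has_dimension_pair_space[where \<Phi> = \<Phi> and W = W and p = p and q = q])
    show "continuous_on UNIV \<Phi>"
      unfolding \<Phi>_def
      by (rule continuous_on_coordinatewise_then_product)
         (intro continuous_on_if_constant_condition continuous_intros continuous_on_coordinate_fst
            continuous_on_coordinate_snd)
    show "inj_on (\<lambda>(P, Q). \<Phi> (coeff P, coeff Q)) (coprime_pairs n)"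
    proof (rule inj_onI, clarsimp)
      fix P Q P' Q'
      assume PQ: "(P, Q) \<in> coprime_pairs n" "(P', Q') \<in> coprime_pairs n"
        and eq: "\<Phi> (coeff P, coeff Q) = \<Phi> (coeff P', coeff Q')"
      have c: "coeff P i = coeff P' i \<and> coeff Q i = coeff Q' i" for i
      proof (cases "i \<le> n")
        case True
        have "\<Phi> (coeff P, coeff Q) (4 * i + j) = \<Phi> (coeff P', coeff Q') (4 * i + j)" for j
          using eq by simp
        from this[of 0] this[of 1] this[of 2] this[of 3] show ?thesis
          using True by (simp add: \<Phi>_def complex_eq_iff div_mod_4)
      next
        case False
        then show ?thesis using PQ by (auto simp: coprime_pairs_def coeff_eq_0)
      qed
      then show "P = P' \<and> Q = Q'" by (simp add: poly_eq_iff)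
    qed
    show "openin (Euclidean_space ?d) W"
      unfolding Euclidean_space_eq_top_of_set W_def E_def[symmetric] by (rule openin_dominated) (rule cpq)+
    \<comment> \<open>The pair \<open>P = 1\<close>, \<open>Q = z ^ n\<close>.\<close>
    define x0 where "x0 = (\<lambda>k. if k = 0 \<or> k = 4 * n + 2 then 1 else 0 :: real)"
    have x0: "x0 \<in> E" by (auto simp: x0_def E_def)
    have "coeff (p x0) i = (if i = 0 then 1 else 0)" "coeff (q x0) i = (if i = n then 1 else 0)" for i
    proof -
      have "4 * i = 4 * n + 2 \<longleftrightarrow> False" "4 * i + 1 = 4 * n + 2 \<longleftrightarrow> False" "4 * i + 3 = 4 * n + 2 \<longleftrightarrow> False"
        by presburger+
      then show "coeff (p x0) i = (if i = 0 then 1 else 0)" "coeff (q x0) i = (if i = n then 1 else 0)"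
        by (auto simp: p_def q_def coeff_poly_of x0_def complex_eq_iff)
    qed
    then have "dominated n n (p x0) (q x0)" by (simp add: dominated_def)
    with x0 show "W \<noteq> {}" unfolding W_def by blast
    show "\<Phi> (coeff (p x), coeff (q x)) = x" if "x \<in> W" for x
    proof
      fix k :: nat
      have k4: "4 * (k div 4) + k mod 4 = k" by simp
      show "\<Phi> (coeff (p x), coeff (q x)) k = x k"
      proof (cases "k \<ge> ?d")
        case True
        then show ?thesis using that by (simp add: \<Phi>_def W_def E_def)
      next
        case False
        then have i: "k div 4 < Suc n" by auto
        have "k mod 4 = 0 \<or> k mod 4 = 1 \<or> k mod 4 = 2 \<or> k mod 4 = 3" by linarith
        then show ?thesis
          using False i k4 by (elim disjE) (simp_all add: \<Phi>_def p_def q_def coeff_poly_of)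
      qed
    qed
    show "(p x, q x) \<in> coprime_pairs n" if "x \<in> W" for x
    proof -
      have d: "dominated n n (p x) (q x)" using that by (simp add: W_def)
      then have "coprime (p x) (q x)" by (rule dominated_imp_coprime[OF deg])
      moreover have "coeff (q x) n \<noteq> 0"
        using d sum_nonneg[of "{..<n}" "\<lambda>i. norm (coeff (q x) i)"] by (auto simp: dominated_def)
      then have "degree (q x) = n" using deg le_degree le_antisym by blast
      ultimately show ?thesis using deg coprime_pairs_eq[OF n] by (simp add: max_absorb2)
    qed
  qed (simp_all add: cpq, simp add: \<Phi>_def)
qed

text \<open>The coefficient of \<open>z ^ (n - 1)\<close> in \<open>Q\<close> is \<open>1\<close> or \<open>0\<close> according to whether \<open>degree Q = n - 1\<close>; this
  bit is stored as the sign of the leading coefficient of \<open>P\<close>.\<close>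

lemma has_dimension_normalized_pairs:
  assumes n: "n \<ge> 1"
  shows "has_dimension (pair_space (normalized_pairs n)) (4 * n - 1)"
proof -
  let ?d = "4 * n - 1"
  define E where "E = {x :: nat \<Rightarrow> real. \<forall>i\<ge>?d. x i = 0}"
  \<comment> \<open>Real count: 2n for the lower coefficients of \<open>P\<close>, 2(n - 1) for
    those of \<open>Q\<close> below \<open>z ^ (n - 1)\<close>, and 1 for the leading coefficient of
    \<open>P\<close>. The latter, with its sign bit, takes slot \<open>4 * n - 2\<close>, which
    would otherwise hold the real part of coefficient n - 1 of \<open>Q\<close>; the imaginary part
    is always 0 and its slot is cut off.\<close>
  define \<Phi> where "\<Phi> = (\<lambda>(c :: (nat \<Rightarrow> complex) \<times> (nat \<Rightarrow> complex)) k. if k \<ge> ?d then 0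
     else if k = 4 * n - 2 then Re (fst c n) * (2 * Re (snd c (n - 1)) - 1)
     else if k mod 4 = 0 then Re (fst c (k div 4)) else if k mod 4 = 1 then Im (fst c (k div 4))
     else if k mod 4 = 2 then Re (snd c (k div 4)) else Im (snd c (k div 4)))"
  define p where "p = (\<lambda>x. poly_of (Suc n) (\<lambda>i. if i < n then Complex (x (4 * i)) (x (4 * i + 1)) else complex_of_real (x (4 * n - 2))))"
  define q where "q = (\<lambda>x. poly_of (Suc (n - 1)) (\<lambda>i. if i < n - 1 then Complex (x (4 * i + 2)) (x (4 * i + 3)) else 1))"
  \<comment> \<open>By construction \<open>q x\<close> has coefficient 1 at
    \<open>z ^ (n - 1)\<close>, so the sign bit is positive; the condition on slot
    \<open>4 * n - 2\<close> makes the leading coefficient of \<open>p x\<close> positive.\<close>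
  define W where "W = {x \<in> E. dominated n (n - 1) (p x) (q x)} \<inter> {x \<in> E. x (4 * n - 2) > 0}"
  have cpq: "continuous_on S (\<lambda>x. coeff (p x) i)" "continuous_on S (\<lambda>x. coeff (q x) i)" for S i
  proof -
    show "continuous_on S (\<lambda>x. coeff (p x) i)"
      unfolding p_def coeff_poly_of
      by (cases "i < n"; cases "i < Suc n"; simp add: continuous_on_Complex continuous_on_coordinate continuous_on_of_real)
    show "continuous_on S (\<lambda>x. coeff (q x) i)"
      unfolding q_def coeff_poly_of
      by (cases "i < n - 1"; cases "i < Suc (n - 1)"; simp add: continuous_on_Complex continuous_on_coordinate)
  qed
  have deg: "degree (p x) \<le> n" "degree (q x) \<le> n - 1" for x
    unfolding p_def q_def by (rule degree_poly_of)+
  have nk: "\<not> 4 * n - 2 \<ge> ?d" using n by linarith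
  have \<Phi>top: "\<Phi> c (4 * n - 2) = Re (fst c n) * (2 * Re (snd c (n - 1)) - 1)" for c
    unfolding \<Phi>_def using nk by (simp only: if_False if_True simp_thms)
  show ?thesis
  proof (rule has_dimension_pair_space[where \<Phi> = \<Phi> and W = W and p = p and q = q])
    show "continuous_on UNIV \<Phi>"
      unfolding \<Phi>_def
      by (rule continuous_on_coordinatewise_then_product)
         (intro continuous_on_if_constant_condition continuous_intros continuous_on_coordinate_fst
            continuous_on_coordinate_snd)
    show "inj_on (\<lambda>(P, Q). \<Phi> (coeff P, coeff Q)) (normalized_pairs n)"
    proof (rule inj_onI, clarsimp)
      fix P Q P' Q'
      assume PQ: "(P, Q) \<in> normalized_pairs n" "(P', Q') \<in> normalized_pairs n"
        and eq: "\<Phi> (coeff P, coeff Q) = \<Phi> (coeff P', coeff Q')"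
      have eqk: "\<Phi> (coeff P, coeff Q) k = \<Phi> (coeff P', coeff Q') k" for k
        using eq by simp
      have norm: "\<exists>a>0. coeff P n = complex_of_real a" "coeff Q (n - 1) = 0 \<or> coeff Q (n - 1) = 1"
        "\<And>i. i > n \<Longrightarrow> coeff P i = 0" "\<And>i. i > n - 1 \<Longrightarrow> coeff Q i = 0"
        if "(P, Q) \<in> normalized_pairs n" for P Q
      proof -
        have l: "lead_coeff Q = 1" "degree Q < n" "degree P = n" "\<exists>a>0. lead_coeff P = complex_of_real a"
          using that by (auto simp: normalized_pairs_def)
        then show "\<exists>a>0. coeff P n = complex_of_real a" by simp
        show "coeff Q (n - 1) = 0 \<or> coeff Q (n - 1) = 1"
          using l by (cases "degree Q = n - 1") (auto simp: coeff_eq_0)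
        show "coeff P i = 0" if "i > n" for i using l that by (simp add: coeff_eq_0)
        show "coeff Q i = 0" if "i > n - 1" for i using l that by (simp add: coeff_eq_0)
      qed
      obtain a a' where a: "a > 0" "coeff P n = complex_of_real a" "a' > 0" "coeff P' n = complex_of_real a'"
        using norm(1)[OF PQ(1)] norm(1)[OF PQ(2)] by blast
      have "a * (2 * Re (coeff Q (n - 1)) - 1) = a' * (2 * Re (coeff Q' (n - 1)) - 1)"
        using eqk[of "4 * n - 2"] a unfolding \<Phi>top by simp
      \<comment> \<open>The bracketed factors are 1 or -1 while \<open>a\<close> and
        \<open>a'\<close> are positive, so the product determines both.\<close>
      then have top: "a = a'" "coeff Q (n - 1) = coeff Q' (n - 1)"
        using norm(2)[OF PQ(1)] norm(2)[OF PQ(2)] a by auto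
      have "coeff P i = coeff P' i" for i
      proof -
        consider "i < n" | "i = n" | "i > n" by linarith
        then show ?thesis
        proof cases
          case 1
          have "4 * i \<noteq> 4 * n - 2" "4 * i + 1 \<noteq> 4 * n - 2" using n by presburger+
          then show ?thesis using 1 eqk[of "4 * i"] eqk[of "4 * i + 1"]
            by (simp add: \<Phi>_def complex_eq_iff div_mod_4 split: if_splits)
        qed (use a top norm(3) PQ in auto)
      qed
      moreover have "coeff Q i = coeff Q' i" for i
      proof -
        consider "i < n - 1" | "i = n - 1" | "i > n - 1" by linarith
        then show ?thesis
        proof cases
          case 1
          then show ?thesis using eqk[of "4 * i + 2"] eqk[of "4 * i + 3"]
            by (simp add: \<Phi>_def complex_eq_iff div_mod_4 split: if_splits)
        qed (use top norm(4) PQ in auto)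
      qed
      ultimately show "P = P' \<and> Q = Q'" by (simp add: poly_eq_iff)
    qed
    show "openin (Euclidean_space ?d) W"
      unfolding Euclidean_space_eq_top_of_set E_def[symmetric] W_def
    proof (intro openin_Int openin_dominated cpq)
      have "{x \<in> E. x (4 * n - 2) > 0} = E \<inter> (\<lambda>x. x (4 * n - 2)) -` {0<..}" by auto
      then show "openin (top_of_set E) {x \<in> E. x (4 * n - 2) > 0}"
        using continuous_openin_preimage_gen[OF continuous_on_coordinate open_greaterThan] by simp
    qed
    \<comment> \<open>The pair \<open>P = z ^ n + 4\<close>, \<open>Q = z ^ (n - 1)\<close>; 4
      exceeds the leading coefficient 1.\<close>
    define x0 where "x0 = (\<lambda>k. if k = 0 then 4 else if k = 4 * n - 2 then 1 else 0 :: real)"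
    have x0: "x0 \<in> E" "x0 (4 * n - 2) > 0" using n by (auto simp: x0_def E_def)
    have "coeff (p x0) i = (if i = 0 then 4 else if i = n then 1 else 0)" "coeff (q x0) i = (if i = n - 1 then 1 else 0)" for i
    proof -
      have "4 * i = 4 * n - 2 \<longleftrightarrow> False" "4 * i + 1 = 4 * n - 2 \<longleftrightarrow> False" "4 * i + 3 = 4 * n - 2 \<longleftrightarrow> False"
        "4 * i + 2 = 4 * n - 2 \<longleftrightarrow> i = n - 1"
        using n by presburger+
      then show "coeff (p x0) i = (if i = 0 then 4 else if i = n then 1 else 0)" "coeff (q x0) i = (if i = n - 1 then 1 else 0)"
        using n by (auto simp: p_def q_def coeff_poly_of x0_def complex_eq_iff)
    qed
    note c0 = this
    have "(\<Sum>i=1..n. norm (coeff (p x0) i)) = (\<Sum>i=1..n. if i = n then 1 else 0)"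
      unfolding c0 by (intro sum.cong) auto
    then have "dominated n (n - 1) (p x0) (q x0)" using n c0 by (simp add: dominated_def)
    with x0 show "W \<noteq> {}" unfolding W_def by blast
    show "\<Phi> (coeff (p x), coeff (q x)) = x" if "x \<in> W" for x
    proof
      fix k :: nat
      have k4: "4 * (k div 4) + k mod 4 = k" by simp
      consider "k \<ge> ?d" | "k = 4 * n - 2" | "k < 4 * n - 2" by linarith
      then show "\<Phi> (coeff (p x), coeff (q x)) k = x k"
      proof cases
        case 1
        then show ?thesis using that by (simp add: \<Phi>_def W_def E_def)
      next
        case 2
        then show ?thesis using n by (simp add: \<Phi>_def p_def q_def coeff_poly_of)
      next
        case 3
        then have i: "k div 4 < n" by auto
        have i': "k div 4 < n - 1" if "k mod 4 = 2 \<or> k mod 4 = 3"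
        proof -
          have "4 * (k div 4) + 2 \<le> k" using that k4 by linarith
          then show ?thesis using 3 by linarith
        qed
        have "k mod 4 = 0 \<or> k mod 4 = 1 \<or> k mod 4 = 2 \<or> k mod 4 = 3" by linarith
        then show ?thesis
          using 3 i i' k4 by (elim disjE) (simp_all add: \<Phi>_def p_def q_def coeff_poly_of)
      qed
    qed
    show "(p x, q x) \<in> normalized_pairs n" if "x \<in> W" for x
    proof -
      have d: "dominated n (n - 1) (p x) (q x)" and pos: "x (4 * n - 2) > 0" using that by (auto simp: W_def)
      have c: "coprime (p x) (q x)" by (rule dominated_imp_coprime[OF deg d])
      have cp: "coeff (p x) n = complex_of_real (x (4 * n - 2))" "coeff (q x) (n - 1) = 1"
        by (simp_all add: p_def q_def coeff_poly_of)
      then have "degree (p x) = n" "degree (q x) = n - 1"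
        using pos deg by (metis le_antisym le_degree less_irrefl of_real_eq_0_iff, metis le_antisym le_degree deg(2) one_neq_zero)
      with c cp pos n show ?thesis by (auto simp: normalized_pairs_def)
    qed
  qed (simp_all add: cpq, simp add: \<Phi>_def)
qed

lemma polynomial_pair_iff: "n \<ge> 1 \<Longrightarrow> polynomial_pair P Q n \<longleftrightarrow> (P, Q) \<in> coprime_pairs n"
  by (simp add: polynomial_pair_def coprime_pairs_eq)

theorem corollary1p12:
  fixes V :: "complex \<Rightarrow> real" and n :: nat and \<beta> \<gamma> :: real
  assumes "smooth V" and "bdd_below (range V)"
    and "n \<ge> 1" and "\<beta> = 2 * real n" and "\<gamma> \<le> 4 * pi * real n"
  shows
    "(\<forall>(P, Q) \<in> coprime_pairs n \<union> normalized_pairs n.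
        energy \<beta> \<gamma> V (u_PQ n P Q) =
        ext_integral lborel (\<lambda>z.
          (4 * pi * real n - \<gamma>) * (1 / (pi\<^sup>2 * (real n)\<^sup>2)) *
            ((norm (poly (wronskian P Q) z)) ^ 4 / ((norm (poly P z))\<^sup>2 + (norm (poly Q z))\<^sup>2) ^ 4)
          + V z * (1 / (pi * real n)) *
            ((norm (poly (wronskian P Q) z))\<^sup>2 / ((norm (poly P z))\<^sup>2 + (norm (poly Q z))\<^sup>2)\<^sup>2)))
   \<and> ground_energy \<beta> \<gamma> V \<le> (INF (P, Q) \<in> coprime_pairs n. energy \<beta> \<gamma> V (u_PQ n P Q))
   \<and> (INF (P, Q) \<in> coprime_pairs n. energy \<beta> \<gamma> V (u_PQ n P Q)) =
      (INF (P, Q) \<in> normalized_pairs n. energy \<beta> \<gamma> V (u_PQ n P Q))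
   \<and> has_dimension (pair_space (coprime_pairs n)) (4 * (n + 1))
   \<and> has_dimension (pair_space (normalized_pairs n)) (4 * n - 1)"
proof -
  let ?e = "\<lambda>(P, Q). energy \<beta> \<gamma> V (u_PQ n P Q)"
  have pair: "polynomial_pair P Q n" if "(P, Q) \<in> coprime_pairs n" for P Q
    using that polynomial_pair_iff[OF \<open>n \<ge> 1\<close>] by simp
  have formula: "energy \<beta> \<gamma> V (u_PQ n P Q) =
        ext_integral lborel (\<lambda>z.
          (4 * pi * real n - \<gamma>) * (1 / (pi\<^sup>2 * (real n)\<^sup>2)) *
            ((norm (poly (wronskian P Q) z)) ^ 4 / ((norm (poly P z))\<^sup>2 + (norm (poly Q z))\<^sup>2) ^ 4)
          + V z * (1 / (pi * real n)) *
            ((norm (poly (wronskian P Q) z))\<^sup>2 / ((norm (poly P z))\<^sup>2 + (norm (poly Q z))\<^sup>2)\<^sup>2))"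
    if "(P, Q) \<in> coprime_pairs n" for P Q
    using polynomial_pair.energy_u_eq[OF pair[OF that] assms(1,2)] unfolding \<open>\<beta> = 2 * real n\<close> .
  have sub: "normalized_pairs n \<subseteq> coprime_pairs n"
    using \<open>n \<ge> 1\<close> by (rule normalized_pairs_subset)
  have ground: "ground_energy \<beta> \<gamma> V \<le> (INF c \<in> coprime_pairs n. ?e c)"
  proof (rule INF_greatest)
    fix c assume c: "c \<in> coprime_pairs n"
    obtain P Q where "c = (P, Q)" by (cases c)
    with c show "ground_energy \<beta> \<gamma> V \<le> ?e c"
      using polynomial_pair.ground_energy_le[OF pair assms(1,2)] unfolding \<open>\<beta> = 2 * real n\<close> by simp
  qed
  have inf: "(INF c \<in> coprime_pairs n. ?e c) = (INF c \<in> normalized_pairs n. ?e c)"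
  proof (rule antisym)
    show "(INF c \<in> coprime_pairs n. ?e c) \<le> (INF c \<in> normalized_pairs n. ?e c)"
      using sub by (rule INF_superset_mono) simp
    show "(INF c \<in> normalized_pairs n. ?e c) \<le> (INF c \<in> coprime_pairs n. ?e c)"
    proof (rule INF_mono)
      fix c assume c: "c \<in> coprime_pairs n"
      obtain P Q where PQ: "c = (P, Q)" by (cases c)
      with c have "(P, Q) \<in> coprime_pairs n" by simp
      from exists_normalized_pair[OF \<open>n \<ge> 1\<close> this]
      obtain P' Q' and k :: real where nm: "(P', Q') \<in> normalized_pairs n" and k: "k > 0"
        "\<And>z. norm (poly (wronskian P' Q') z) = k * norm (poly (wronskian P Q) z)"
        "\<And>z. (norm (poly P' z))\<^sup>2 + (norm (poly Q' z))\<^sup>2 = k * ((norm (poly P z))\<^sup>2 + (norm (poly Q z))\<^sup>2)"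
        by metis
      \<comment> \<open>The energy formula depends on the pair only through \<open>|W| / s\<close>,
        and both numerator and denominator acquire the factor \<open>k\<close>.\<close>
      have "energy \<beta> \<gamma> V (u_PQ n P' Q') = energy \<beta> \<gamma> V (u_PQ n P Q)"
        using formula[of P' Q'] formula[of P Q] nm sub c PQ k(1)
        unfolding k(2,3) by (simp add: power_mult_distrib subset_iff)
      then show "\<exists>d \<in> normalized_pairs n. ?e d \<le> ?e c"
        using nm PQ by (intro bexI[of _ "(P', Q')"]) auto
    qed
  qed
  show ?thesis
    using formula sub ground inf has_dimension_coprime_pairs[OF \<open>n \<ge> 1\<close>]
      has_dimension_normalized_pairs[OF \<open>n \<ge> 1\<close>] by blast
qed

end
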